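(* Let $d\ge1$, $\Omega=[0,1]^d$, $s\ge0$, and let $V\in\mathcal B^s(\Omega)$ with $V(x)\ge V_{\min}>0$ for every $x\in\Omega$, for some constant $V_{\min}$. Then for every $f\in\mathcal B^s(\Omega)$ the static Schrödinger problem $$-\Delta u+Vu=f\ \text{ on }\Omega,\qquad\frac{\partial u}{\partial\nu}=0\ \text{ on }\partial\Omega$$ has a unique solution $u\in\mathcal B^{s+2}(\Omega)$. Moreover, there exists a constant $C_8>0$ depending on $V$ and $d$ (and on the fixed $s$), but not on $f$, such that $$\|u\|_{\mathcal B^{s+2}(\Omega)}\le C_8\|f\|_{\mathcal B^s(\Omega)}.$$ In particular, when $s=0$, $\|u\|_{\mathcal B^2(\Omega)}\le C_8\|f\|_{\mathcal B^0(\Omega)}$.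
   Context: $\mathbb N_0=\{0,1,2,\dots\}$ and $|\cdot|_1$ is the $\ell^1$-norm. For $k\in\mathbb N_0^d$ put $\Phi_k(x)=\prod_{i=1}^d\cos(\pi k_ix_i)$, and for $u\in L^1(\Omega)$ let $\hat u(k)=\int_\Omega u\,\Phi_k\,dx\big/\int_\Omega\Phi_k^2\,dx$. For $s\ge0$ the spectral Barron space is $\mathcal B^s(\Omega)=\{u\in L^1(\Omega):\|u\|_{\mathcal B^s(\Omega)}<\infty\}$ with $\|u\|_{\mathcal B^s(\Omega)}=\sum_{k\in\mathbb N_0^d}(1+\pi^s|k|_1^s)|\hat u(k)|$ (for $s=0$, $|k|_1^0$ is read as $1$). Solutions are understood in the weak sense: $u\in H^1(\Omega)$ and $\int_\Omega(\nabla u\cdot\nabla v+Vuv)\,dx=\int_\Omega fv\,dx$ for all $v\in H^1(\Omega)$. *)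

theory Defs
  imports "HOL-Analysis.Analysis"
begin

text \<open>
  The dimension is \<open>d = CARD('n)\<close>. Elements of \<open>L\<^sup>1\<close>, \<open>L\<^sup>2\<close> and \<open>H\<^sup>1\<close> are represented by functions on
  the whole space; only their restriction to the cube matters, and equality of classes is
  equality almost everywhere on the cube.
\<close>

definition cube :: "(real ^ 'n) set" where
  "cube = cbox 0 1"

abbreviation cube_measure :: "(real ^ 'n) measure" where
  "cube_measure \<equiv> lebesgue_on cube"

definition cos_basis :: "nat ^ 'n \<Rightarrow> real ^ 'n \<Rightarrow> real" where
  "cos_basis k x = (\<Prod>i\<in>UNIV. cos (pi * real (k $ i) * x $ i))"

definition cos_coeff :: "(real ^ 'n \<Rightarrow> real) \<Rightarrow> nat ^ 'n \<Rightarrow> real" where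
  "cos_coeff u k =
     (LINT x|cube_measure. u x * cos_basis k x) / (LINT x|cube_measure. (cos_basis k x)\<^sup>2)"

definition l1_norm :: "nat ^ 'n \<Rightarrow> real" where
  "l1_norm k = (\<Sum>i\<in>UNIV. real (k $ i))"

text \<open>
  Since \<open>0 powr 0 = 0\<close> in the library, the case \<open>s = 0\<close>, where every power is read as 1 (also at
  \<open>k = 0\<close>), is treated separately.
\<close>

definition barron_weight :: "real \<Rightarrow> nat ^ 'n \<Rightarrow> real" where
  "barron_weight s k = 1 + pi powr s * (if s = 0 then 1 else l1_norm k powr s)"

definition barron_norm :: "real \<Rightarrow> (real ^ 'n \<Rightarrow> real) \<Rightarrow> ennreal" where
  "barron_norm s u = (\<Sum>\<^sub>\<infinity>k\<in>UNIV. ennreal (barron_weight s k * \<bar>cos_coeff u k\<bar>))"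

definition barron_space :: "real \<Rightarrow> (real ^ 'n \<Rightarrow> real) set" where
  "barron_space s = {u. integrable cube_measure u \<and> barron_norm s u < \<infinity>}"

definition partial_deriv :: "'n \<Rightarrow> (real ^ 'n \<Rightarrow> real) \<Rightarrow> real ^ 'n \<Rightarrow> real" where
  "partial_deriv i \<phi> x = frechet_derivative \<phi> (at x) (axis i 1)"

primrec C_k :: "nat \<Rightarrow> (real ^ 'n \<Rightarrow> real) \<Rightarrow> bool" where
  "C_k 0 \<phi> \<longleftrightarrow> continuous_on UNIV \<phi>"
| "C_k (Suc m) \<phi> \<longleftrightarrow> (\<forall>x. \<phi> differentiable (at x)) \<and> (\<forall>i. C_k m (partial_deriv i \<phi>))"

definition test_functions :: "(real ^ 'n \<Rightarrow> real) set" where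
  "test_functions = {\<phi>. (\<forall>m. C_k m \<phi>) \<and> compact (closure {x. \<phi> x \<noteq> 0})
     \<and> closure {x. \<phi> x \<noteq> 0} \<subseteq> interior cube}"

definition square_integrable :: "(real ^ 'n \<Rightarrow> 'b::euclidean_space) \<Rightarrow> bool" where
  "square_integrable g \<longleftrightarrow>
     g \<in> borel_measurable cube_measure \<and> integrable cube_measure (\<lambda>x. (norm (g x))\<^sup>2)"

text \<open>
  \<open>has_H1_gradient u G\<close> says that \<open>u\<close> belongs to \<open>H\<^sup>1\<close> of the cube with weak gradient \<open>G\<close>. The weak
  gradient is unique up to null sets, so \<open>u\<close> is in \<open>H\<^sup>1\<close> iff some such \<open>G\<close> exists, and the integrals
  below do not depend on its choice.
\<close>

definition has_H1_gradient :: "(real ^ 'n \<Rightarrow> real) \<Rightarrow> (real ^ 'n \<Rightarrow> real ^ 'n) \<Rightarrow> bool" where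
  "has_H1_gradient u G \<longleftrightarrow> square_integrable u \<and> square_integrable G \<and>
     (\<forall>\<phi>\<in>test_functions. \<forall>i.
        (LINT x|cube_measure. u x * partial_deriv i \<phi> x)
          = - (LINT x|cube_measure. G x $ i * \<phi> x))"

text \<open>
  Weak form of \<open>- \<Delta> u + V u = f\<close> with homogeneous Neumann condition, which is the natural boundary
  condition for test functions ranging over all of \<open>H\<^sup>1\<close>. It is meant for essentially bounded
  \<open>V\<close> and \<open>f\<close>, such as functions in a Barron space, for which both integrands are integrable.
\<close>

definition weak_solution ::
  "(real ^ 'n \<Rightarrow> real) \<Rightarrow> (real ^ 'n \<Rightarrow> real) \<Rightarrow> (real ^ 'n \<Rightarrow> real) \<Rightarrow> bool" where
  "weak_solution V f u \<longleftrightarrow> (\<exists>G. has_H1_gradient u G \<and>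
     (\<forall>v H. has_H1_gradient v H \<longrightarrow>
        (LINT x|cube_measure. G x \<bullet> H x + V x * u x * v x)
          = (LINT x|cube_measure. f x * v x)))"

end

theory Submission
  imports Defs "HOL-Computational_Algebra.Polynomial"
begin

text \<open>
  A function of a Barron space is, up to a null set, the sum of its cosine series, so the problem
  can be transported to the coefficients. There \<open>- \<Delta>\<close> with the Neumann condition is multiplication by
  \<open>\<lambda>\<^sub>k = \<Sum>\<^sub>i (\<pi> k\<^sub>i)\<^sup>2\<close>, multiplication by \<open>V\<close> is a bounded operator of the weighted \<open>\<ell>\<^sup>1\<close>-space, because
  products of cosines are averages of cosines and the weight is submultiplicative
  (\<open>cos_series_mult\<close>), and the equation reads \<open>\<lambda>\<^sub>k c\<^sub>k + (V c)\<^sub>k = f\<^sub>k\<close>.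

  Solvability is obtained by deforming \<open>1 - \<Delta>\<close> into \<open>- \<Delta> + V\<close> along \<open>- \<Delta> + (1 - t) + t V\<close>
  (\<open>continuity_principle\<close>): by a contraction argument, solvability propagates in \<open>t\<close> as soon as there is a
  bound \<open>\<parallel>c\<parallel> \<le> C \<parallel>f\<parallel>\<close> in the weighted norm that is uniform in \<open>t\<close>. This bound
  (\<open>apriori_estimate\<close>) has two sources. For all but finitely many frequencies \<open>\<lambda>\<^sub>k\<close> exceeds twice the
  norm of the zeroth order term, so the high frequencies can be absorbed. The remaining finitely
  many coefficients are controlled by the energy identity, since \<open>(1 - t) + t V\<close> is bounded below by
  \<open>min 1 Vmin\<close>. The constant does not depend on \<open>f\<close>. Finally
  \<open>(1 + \<lambda>\<^sub>k) c\<^sub>k = f\<^sub>k - (V c)\<^sub>k + c\<^sub>k\<close> shows that the solution gains two powers of the frequency.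

  Two links to the weak formulation remain. First, the cosine series has to be a weak solution when
  tested with every element of \<open>H\<^sup>1\<close>, although weak gradients are defined through test functions of
  compact support. This rests on \<open>\<integral> H\<^sub>i \<partial>\<^sub>i \<Phi>\<^sub>k = (\<pi> k\<^sub>i)\<^sup>2 \<integral> v \<Phi>\<^sub>k\<close> for every \<open>v\<close> in \<open>H\<^sup>1\<close> with
  weak gradient \<open>H\<close> (\<open>H1_Neumann_integration_by_parts\<close>), proved with smooth cutoffs; it also yields the
  orthogonality of the cosines. Secondly, the coefficients of an integrable function determine it
  almost everywhere (\<open>cos_basis_complete\<close>), by the Stone--Weierstrass theorem. Uniqueness among all
  weak solutions is the energy identity for the difference of two solutions
  (\<open>weak_solution_unique\<close>), and it extends the norm bound from the constructed solution to every
  weak solution.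
\<close>

section \<open>Weighted summable families and the continuity principle\<close>

definition wl1 :: "('k \<Rightarrow> real) \<Rightarrow> ('k \<Rightarrow> real) set" where
  "wl1 w = {c. (\<lambda>k. w k * \<bar>c k\<bar>) summable_on UNIV}"

definition wnorm :: "('k \<Rightarrow> real) \<Rightarrow> ('k \<Rightarrow> real) \<Rightarrow> real" where
  "wnorm w c = (\<Sum>\<^sub>\<infinity>k. w k * \<bar>c k\<bar>)"

locale weight =
  fixes w :: "'k \<Rightarrow> real"
  assumes weight_ge_1: "1 \<le> w k"
begin

lemma weight_nonneg: "0 \<le> w k"
  using weight_ge_1[of k] by linarith

lemma wl1_comparison:
  assumes "c \<in> wl1 w" "\<And>k. \<bar>b k\<bar> \<le> \<bar>c k\<bar>"
  shows "b \<in> wl1 w" "wnorm w b \<le> wnorm w c"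
proof -
  show *: "b \<in> wl1 w"
    using assms(1) unfolding wl1_def mem_Collect_eq
    by (rule summable_on_comparison_test)
       (auto intro!: mult_left_mono mult_nonneg_nonneg assms(2) weight_nonneg)
  show "wnorm w b \<le> wnorm w c"
    using assms * unfolding wl1_def wnorm_def mem_Collect_eq
    by (intro infsum_mono mult_left_mono weight_nonneg) auto
qed

lemma wl1_add:
  assumes "a \<in> wl1 w" "b \<in> wl1 w"
  shows "(\<lambda>k. a k + b k) \<in> wl1 w" "wnorm w (\<lambda>k. a k + b k) \<le> wnorm w a + wnorm w b"
proof -
  have le: "w k * \<bar>a k + b k\<bar> \<le> w k * \<bar>a k\<bar> + w k * \<bar>b k\<bar>" for k
    unfolding distrib_left[symmetric] by (intro mult_left_mono weight_nonneg) auto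
  have s: "(\<lambda>k. w k * \<bar>a k\<bar> + w k * \<bar>b k\<bar>) summable_on UNIV"
    using assms unfolding wl1_def by (intro summable_on_add) auto
  show *: "(\<lambda>k. a k + b k) \<in> wl1 w"
    unfolding wl1_def mem_Collect_eq
    by (rule summable_on_comparison_test[OF s le]) (simp add: weight_nonneg)
  have "wnorm w (\<lambda>k. a k + b k) \<le> (\<Sum>\<^sub>\<infinity>k. w k * \<bar>a k\<bar> + w k * \<bar>b k\<bar>)"
    using * unfolding wnorm_def wl1_def mem_Collect_eq by (intro infsum_mono s le)
  also have "\<dots> = wnorm w a + wnorm w b"
    using assms unfolding wnorm_def wl1_def by (intro infsum_add) auto
  finally show "wnorm w (\<lambda>k. a k + b k) \<le> wnorm w a + wnorm w b" .
qed

lemma wl1_cmult: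
  assumes "a \<in> wl1 w"
  shows "(\<lambda>k. r * a k) \<in> wl1 w" "wnorm w (\<lambda>k. r * a k) = \<bar>r\<bar> * wnorm w a"
proof -
  have eq: "(\<lambda>k. w k * \<bar>r * a k\<bar>) = (\<lambda>k. \<bar>r\<bar> * (w k * \<bar>a k\<bar>))"
    by (auto simp: abs_mult)
  show "(\<lambda>k. r * a k) \<in> wl1 w"
    using assms unfolding wl1_def mem_Collect_eq eq by (rule summable_on_cmult_right)
  show "wnorm w (\<lambda>k. r * a k) = \<bar>r\<bar> * wnorm w a"
    unfolding wnorm_def eq by (rule infsum_cmult_right')
qed

lemma wl1_minus: "wnorm w (\<lambda>k. - a k) = wnorm w a" "(\<lambda>k. - a k) \<in> wl1 w \<longleftrightarrow> a \<in> wl1 w"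
  by (auto simp: wnorm_def wl1_def)

lemma wl1_diff:
  assumes "a \<in> wl1 w" "b \<in> wl1 w"
  shows "(\<lambda>k. a k - b k) \<in> wl1 w" "wnorm w (\<lambda>k. a k - b k) \<le> wnorm w a + wnorm w b"
  using wl1_add[of a "\<lambda>k. - b k"] assms by (auto simp: wl1_minus)

lemma wnorm_nonneg: "0 \<le> wnorm w c"
  unfolding wnorm_def by (intro infsum_nonneg mult_nonneg_nonneg weight_nonneg) auto

lemma weighted_coeff_le_wnorm:
  assumes "c \<in> wl1 w"
  shows "w k * \<bar>c k\<bar> \<le> wnorm w c"
  using finite_sum_le_infsum[of "\<lambda>k. w k * \<bar>c k\<bar>" UNIV "{k}"] assms
  by (auto simp: wl1_def wnorm_def weight_nonneg)

lemma coeff_le_wnorm: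
  assumes "c \<in> wl1 w"
  shows "\<bar>c k\<bar> \<le> wnorm w c"
proof -
  have "1 * \<bar>c k\<bar> \<le> w k * \<bar>c k\<bar>"
    by (intro mult_right_mono weight_ge_1) auto
  then show ?thesis
    using weighted_coeff_le_wnorm[OF assms, of k] by linarith
qed

lemma wnorm_eq_0:
  assumes "c \<in> wl1 w" "wnorm w c = 0"
  shows "c = (\<lambda>_. 0)"
  using coeff_le_wnorm[OF assms(1)] assms(2) by (auto intro: ext)

lemma wl1_abs_summable:
  assumes "c \<in> wl1 w"
  shows "(\<lambda>k. \<bar>c k\<bar>) summable_on UNIV" "(\<Sum>\<^sub>\<infinity>k. \<bar>c k\<bar>) \<le> wnorm w c"
proof -
  have le: "\<bar>c k\<bar> \<le> w k * \<bar>c k\<bar>" for k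
    using mult_right_mono[OF weight_ge_1, of "\<bar>c k\<bar>" k] by simp
  show *: "(\<lambda>k. \<bar>c k\<bar>) summable_on UNIV"
    using assms unfolding wl1_def mem_Collect_eq
    by (rule summable_on_comparison_test) (auto intro: le)
  show "(\<Sum>\<^sub>\<infinity>k. \<bar>c k\<bar>) \<le> wnorm w c"
    unfolding wnorm_def using assms unfolding wl1_def mem_Collect_eq by (intro infsum_mono * le)
qed

sublocale wl1: Metric_space "wl1 w" "\<lambda>a b. wnorm w (\<lambda>k. a k - b k)"
proof
  fix a b c assume abc: "a \<in> wl1 w" "b \<in> wl1 w" "c \<in> wl1 w"
  show "wnorm w (\<lambda>k. a k - c k) \<le> wnorm w (\<lambda>k. a k - b k) + wnorm w (\<lambda>k. b k - c k)"
    using wl1_add(2)[OF wl1_diff(1)[OF abc(1,2)] wl1_diff(1)[OF abc(2,3)]] by simp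
next
  fix a b :: "'k \<Rightarrow> real"
  show "0 \<le> wnorm w (\<lambda>k. a k - b k)" by (rule wnorm_nonneg)
  show "wnorm w (\<lambda>k. a k - b k) = wnorm w (\<lambda>k. b k - a k)"
    by (simp add: wnorm_def abs_minus_commute)
  assume ab: "a \<in> wl1 w" "b \<in> wl1 w"
  show "(wnorm w (\<lambda>k. a k - b k) = 0) = (a = b)"
  proof
    assume "wnorm w (\<lambda>k. a k - b k) = 0"
    then have "(\<lambda>k. a k - b k) = (\<lambda>_. 0)"
      by (rule wnorm_eq_0[OF wl1_diff(1)[OF ab]])
    then show "a = b" by (auto simp: fun_eq_iff)
  qed (simp add: wnorm_def)
qed

text \<open>
  Fatou's argument: a Cauchy sequence converges in each coordinate, and a bound on the finite
  partial sums of \<open>\<sigma> n - \<sigma> m\<close> survives the coordinatewise limit \<open>m \<rightarrow> \<infinity>\<close>.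
\<close>

lemma wl1_mcomplete: "wl1.mcomplete"
  unfolding wl1.mcomplete_def
proof (intro allI impI)
  fix \<sigma> assume "wl1.MCauchy \<sigma>"
  then have mem: "\<And>n. \<sigma> n \<in> wl1 w"
    and cau: "\<And>e. e > 0 \<Longrightarrow> \<exists>N. \<forall>n n'. N \<le> n \<longrightarrow> N \<le> n' \<longrightarrow> wnorm w (\<lambda>k. \<sigma> n k - \<sigma> n' k) < e"
    unfolding wl1.MCauchy_def by auto
  have "convergent (\<lambda>n. \<sigma> n k)" for k
  proof -
    have "Cauchy (\<lambda>n. \<sigma> n k)"
    proof (rule metric_CauchyI)
      fix e :: real assume "e > 0"
      then obtain N where N: "\<And>m n. N \<le> m \<Longrightarrow> N \<le> n \<Longrightarrow> wnorm w (\<lambda>k. \<sigma> m k - \<sigma> n k) < e"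
        using cau by blast
      show "\<exists>M. \<forall>m\<ge>M. \<forall>n\<ge>M. dist (\<sigma> m k) (\<sigma> n k) < e"
      proof (intro exI allI impI)
        fix m n assume "N \<le> m" "N \<le> n"
        then show "dist (\<sigma> m k) (\<sigma> n k) < e"
          using coeff_le_wnorm[OF wl1_diff(1)[OF mem[of m] mem[of n]], of k] N[of m n]
          by (simp add: dist_real_def)
      qed
    qed
    then show ?thesis by (rule Cauchy_convergent)
  qed
  then obtain l where l: "\<And>k. (\<lambda>n. \<sigma> n k) \<longlonglongrightarrow> l k"
    unfolding convergent_def by metis
  have fin: "(\<Sum>k\<in>F. w k * \<bar>\<sigma> n k - l k\<bar>) \<le> e"
    if "finite F" "\<And>m. m \<ge> N \<Longrightarrow> wnorm w (\<lambda>k. \<sigma> n k - \<sigma> m k) \<le> e" for F n N e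
  proof (rule tendsto_upperbound)
    show "(\<lambda>m. \<Sum>k\<in>F. w k * \<bar>\<sigma> n k - \<sigma> m k\<bar>) \<longlonglongrightarrow> (\<Sum>k\<in>F. w k * \<bar>\<sigma> n k - l k\<bar>)"
      by (intro tendsto_intros l)
    show "\<forall>\<^sub>F m in sequentially. (\<Sum>k\<in>F. w k * \<bar>\<sigma> n k - \<sigma> m k\<bar>) \<le> e"
      unfolding eventually_sequentially
    proof (intro exI allI impI)
      fix m assume "N \<le> m"
      have "(\<Sum>k\<in>F. w k * \<bar>\<sigma> n k - \<sigma> m k\<bar>) \<le> wnorm w (\<lambda>k. \<sigma> n k - \<sigma> m k)"
        using wl1_diff(1)[OF mem mem, of n m] that(1) unfolding wl1_def wnorm_def
        by (intro finite_sum_le_infsum) (auto simp: weight_nonneg)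
      also have "\<dots> \<le> e" using that(2)[OF \<open>N \<le> m\<close>] .
      finally show "(\<Sum>k\<in>F. w k * \<bar>\<sigma> n k - \<sigma> m k\<bar>) \<le> e" .
    qed
  qed auto
  have lim: "\<exists>N. \<forall>n\<ge>N. (\<lambda>k. \<sigma> n k - l k) \<in> wl1 w \<and> wnorm w (\<lambda>k. \<sigma> n k - l k) \<le> e" if e: "e > 0" for e
  proof -
    obtain N where N: "\<And>n n'. N \<le> n \<Longrightarrow> N \<le> n' \<Longrightarrow> wnorm w (\<lambda>k. \<sigma> n k - \<sigma> n' k) < e"
      using cau[OF e] by blast
    have "(\<lambda>k. \<sigma> n k - l k) \<in> wl1 w \<and> wnorm w (\<lambda>k. \<sigma> n k - l k) \<le> e" if "n \<ge> N" for n
    proof -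
      have f: "(\<Sum>k\<in>F. w k * \<bar>\<sigma> n k - l k\<bar>) \<le> e" if "finite F" for F
        using fin[OF that, of N n e] N[OF \<open>n \<ge> N\<close>] by (meson less_imp_le)
      then have s: "(\<lambda>k. w k * \<bar>\<sigma> n k - l k\<bar>) summable_on UNIV"
        by (intro nonneg_bdd_above_summable_on bdd_aboveI2[where M=e]) (auto simp: weight_nonneg)
      then show ?thesis
        unfolding wl1_def wnorm_def using infsum_le_finite_sums[OF s f] by auto
    qed
    then show ?thesis by blast
  qed
  obtain N where "(\<lambda>k. \<sigma> N k - l k) \<in> wl1 w" using lim[of 1] by auto
  from wl1_diff(1)[OF mem[of N] this] have l_mem: "l \<in> wl1 w" by simp
  show "\<exists>x. limitin wl1.mtopology \<sigma> x sequentially"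
  proof (rule exI[of _ l], unfold wl1.limit_metric_sequentially, intro conjI l_mem allI impI)
    fix e :: real assume "e > 0"
    then obtain N where "\<And>n. N \<le> n \<Longrightarrow> wnorm w (\<lambda>k. \<sigma> n k - l k) \<le> e / 2"
      using lim[of "e/2"] by auto
    then have "\<forall>n\<ge>N. \<sigma> n \<in> wl1 w \<and> wnorm w (\<lambda>k. \<sigma> n k - l k) < e"
      using mem \<open>e > 0\<close> by (smt (verit) field_sum_of_halves)
    then show "\<exists>N. \<forall>n\<ge>N. \<sigma> n \<in> wl1 w \<and> wnorm w (\<lambda>k. \<sigma> n k - l k) < e" ..
  qed
qed

text \<open>
  The continuity principle. The operators \<open>A\<^sub>t c = E c + t W c\<close> interpolate between the diagonal
  operator \<open>E\<close>, which is trivially onto, and the operator of interest \<open>A\<^sub>1\<close>. An a priori bound that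
  is uniform in \<open>t\<close> makes the inverse of \<open>A\<^sub>t\<close> Lipschitz with a fixed constant \<open>C\<close>, so that
  solvability at \<open>t\<close> gives, by a contraction argument, solvability at \<open>t + h\<close> for a step \<open>h\<close> that
  depends on \<open>C\<close> and the norm of \<open>W\<close> only. Finitely many such steps lead from 0 to 1.
\<close>

lemma continuity_principle:
  fixes W :: "('k \<Rightarrow> real) \<Rightarrow> ('k \<Rightarrow> real)" and E :: "'k \<Rightarrow> real"
  assumes E: "\<And>k. 1 \<le> E k"
    and W_mem: "\<And>c. c \<in> wl1 w \<Longrightarrow> W c \<in> wl1 w"
    and W_bound: "\<And>c. c \<in> wl1 w \<Longrightarrow> wnorm w (W c) \<le> L * wnorm w c"
    and W_diff: "\<And>a b. a \<in> wl1 w \<Longrightarrow> b \<in> wl1 w \<Longrightarrow> W (\<lambda>k. a k - b k) = (\<lambda>k. W a k - W b k)"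
    and apriori: "\<And>t c g. 0 \<le> t \<Longrightarrow> t \<le> 1 \<Longrightarrow> c \<in> wl1 w \<Longrightarrow> g \<in> wl1 w \<Longrightarrow>
        (\<And>k. E k * c k + t * W c k = g k) \<Longrightarrow> wnorm w c \<le> C * wnorm w g"
    and C: "0 \<le> C" and L: "0 \<le> L"
    and g: "g \<in> wl1 w"
  shows "\<exists>c\<in>wl1 w. \<forall>k. E k * c k + W c k = g k"
proof -
  define solvable where
    "solvable t \<longleftrightarrow> (\<forall>g\<in>wl1 w. \<exists>c\<in>wl1 w. \<forall>k. E k * c k + t * W c k = g k)" for t
  have start: "solvable 0"
    unfolding solvable_def
  proof
    fix g assume g: "g \<in> wl1 w"
    have "\<bar>g k / E k\<bar> \<le> \<bar>g k\<bar>" for k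
    proof -
      have "\<bar>g k\<bar> / E k \<le> \<bar>g k\<bar> / 1"
        using E[of k] by (intro divide_left_mono) auto
      then show ?thesis using E[of k] by (simp add: abs_divide)
    qed
    then have "(\<lambda>k. g k / E k) \<in> wl1 w" by (rule wl1_comparison(1)[OF g])
    moreover have "E k * (g k / E k) + 0 * W (\<lambda>k. g k / E k) k = g k" for k
      using E[of k] by simp
    ultimately show "\<exists>c\<in>wl1 w. \<forall>k. E k * c k + 0 * W c k = g k"
      by (intro bexI[of _ "\<lambda>k. g k / E k"] allI)
  qed
  have step: "solvable (t + h)" if t: "0 \<le> t" "t \<le> 1" and h: "0 \<le> h" "C * h * L \<le> 1/2"
    and sol: "solvable t" for t h
    unfolding solvable_def
  proof
    fix g assume g: "g \<in> wl1 w"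
    define rhs where "rhs c = (\<lambda>k. g k - h * W c k)" for c
    have rhs: "rhs c \<in> wl1 w" if "c \<in> wl1 w" for c
      unfolding rhs_def by (intro wl1_diff(1) g wl1_cmult(1) W_mem that)
    define \<Psi> where "\<Psi> c = (SOME b. b \<in> wl1 w \<and> (\<forall>k. E k * b k + t * W b k = rhs c k))" for c
    have \<Psi>: "\<Psi> c \<in> wl1 w \<and> (\<forall>k. E k * \<Psi> c k + t * W (\<Psi> c) k = rhs c k)" if "c \<in> wl1 w" for c
    proof -
      have "\<exists>b. b \<in> wl1 w \<and> (\<forall>k. E k * b k + t * W b k = rhs c k)"
        using sol rhs[OF that] unfolding solvable_def by blast
      then show ?thesis unfolding \<Psi>_def by (rule someI_ex)
    qed
    have contr: "wnorm w (\<lambda>k. \<Psi> a k - \<Psi> b k) \<le> 1/2 * wnorm w (\<lambda>k. a k - b k)"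
      if "a \<in> wl1 w" "b \<in> wl1 w" for a b
    proof -
      have ab: "(\<lambda>k. a k - b k) \<in> wl1 w" by (rule wl1_diff(1)[OF that])
      have eq: "E k * (\<Psi> a k - \<Psi> b k) + t * W (\<lambda>k. \<Psi> a k - \<Psi> b k) k
          = (- h) * W (\<lambda>k. a k - b k) k" for k
      proof -
        have "W (\<lambda>k. \<Psi> a k - \<Psi> b k) k = W (\<Psi> a) k - W (\<Psi> b) k"
          using \<Psi>[OF that(1)] \<Psi>[OF that(2)] by (subst W_diff) auto
        moreover have "W (\<lambda>k. a k - b k) k = W a k - W b k"
          by (subst W_diff[OF that]) simp
        moreover have "E k * \<Psi> a k + t * W (\<Psi> a) k = g k - h * W a k"
          "E k * \<Psi> b k + t * W (\<Psi> b) k = g k - h * W b k"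
          using \<Psi>[OF that(1)] \<Psi>[OF that(2)] unfolding rhs_def by blast+
        ultimately show ?thesis
          by (simp only: right_diff_distrib)
      qed
      have "wnorm w (\<lambda>k. \<Psi> a k - \<Psi> b k) \<le> C * wnorm w (\<lambda>k. (- h) * W (\<lambda>k. a k - b k) k)"
        by (rule apriori[OF t wl1_diff(1) wl1_cmult(1)[OF W_mem[OF ab]] eq])
           (use \<Psi> that in blast)+
      also have "\<dots> = C * h * wnorm w (W (\<lambda>k. a k - b k))"
        using wl1_cmult(2)[OF W_mem[OF ab], of "-h"] h by simp
      also have "\<dots> \<le> C * h * (L * wnorm w (\<lambda>k. a k - b k))"
        by (intro mult_left_mono W_bound ab) (use C h in auto)
      also have "\<dots> = C * h * L * wnorm w (\<lambda>k. a k - b k)" by simp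
      also have "\<dots> \<le> 1/2 * wnorm w (\<lambda>k. a k - b k)"
        by (intro mult_right_mono h wnorm_nonneg)
      finally show ?thesis .
    qed
    obtain c where c: "c \<in> wl1 w" "\<Psi> c = c"
      by (rule wl1.Banach_fixedpoint_thm[OF wl1_mcomplete, of \<Psi> "1/2"])
         (use g \<Psi> contr in auto)
    have "E k * c k + (t + h) * W c k = g k" for k
    proof -
      have "E k * c k + t * W c k = g k - h * W c k"
        using \<Psi>[OF c(1)] unfolding c(2) rhs_def by blast
      then show ?thesis by (simp only: distrib_right)
    qed
    then show "\<exists>c\<in>wl1 w. \<forall>k. E k * c k + (t + h) * W c k = g k" using c(1) by blast
  qed
  obtain n :: nat where "max 0 (2 * C * L) < n"
    using reals_Archimedean2 by blast
  then have n: "2 * C * L < n" "0 < n" by auto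
  have "solvable (real j * (1 / real n))" if "j \<le> n" for j
    using that
  proof (induction j)
    case 0
    then show ?case using start by simp
  next
    case (Suc j)
    have "solvable (real j * (1 / real n) + 1 / real n)"
      by (rule step) (use Suc n in \<open>auto simp: field_simps\<close>)
    then show ?case by (simp add: algebra_simps add_divide_distrib)
  qed
  from this[of n] n have "solvable 1" by simp
  then show ?thesis using g unfolding solvable_def by simp
qed

end

section \<open>Products of cosine series\<close>

lemma has_sum_fibres:
  fixes h :: "'t \<Rightarrow> real" and \<mu> :: "'t \<Rightarrow> 'k"
  assumes "h summable_on UNIV"
  shows "((\<lambda>m. \<Sum>\<^sub>\<infinity>t\<in>{t. \<mu> t = m}. h t) has_sum (\<Sum>\<^sub>\<infinity>t. h t)) UNIV"
proof -
  have bij: "bij_betw (\<lambda>t. (\<mu> t, t)) UNIV (Sigma UNIV (\<lambda>m. {t. \<mu> t = m}))"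
    by (intro bij_betwI[where g=snd]) auto
  have "((\<lambda>p. h (snd p)) has_sum (\<Sum>\<^sub>\<infinity>t. h t)) (Sigma UNIV (\<lambda>m. {t. \<mu> t = m}))"
    unfolding has_sum_reindex_bij_betw[OF bij, symmetric] using assms by simp
  moreover have "((\<lambda>t. h (snd (m, t))) has_sum (\<Sum>\<^sub>\<infinity>t\<in>{t. \<mu> t = m}. h t)) {t. \<mu> t = m}" for m
    using summable_on_subset_banach[OF assms, of "{t. \<mu> t = m}"] by simp
  ultimately show ?thesis by (rule has_sum_SigmaD)
qed

text \<open>
  This is what makes the product of two cosine series a cosine series again: the terms \<open>t\<close> of the
  double series carry frequencies \<open>\<mu> t\<close>, and the weight \<open>v t\<close> of a term dominates the weight of its
  frequency, so collecting equal frequencies does not increase the weighted sum.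
\<close>

lemma (in weight) wl1_collect:
  fixes \<mu> :: "'t \<Rightarrow> 'k" and g v :: "'t \<Rightarrow> real"
  assumes wv: "\<And>t. w (\<mu> t) \<le> v t" and g: "(\<lambda>t. v t * \<bar>g t\<bar>) summable_on UNIV"
  defines "b \<equiv> \<lambda>m. \<Sum>\<^sub>\<infinity>t\<in>{t. \<mu> t = m}. g t"
  shows "b \<in> wl1 w" "wnorm w b \<le> (\<Sum>\<^sub>\<infinity>t. v t * \<bar>g t\<bar>)"
    and "\<And>\<phi>. (\<And>k. \<bar>\<phi> k\<bar> \<le> 1) \<Longrightarrow> (\<Sum>\<^sub>\<infinity>m. b m * \<phi> m) = (\<Sum>\<^sub>\<infinity>t. g t * \<phi> (\<mu> t))"
proof -
  have v1: "1 \<le> v t" for t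
    using wv[of t] weight_ge_1[of "\<mu> t"] by linarith
  have ag: "(\<lambda>t. \<bar>g t\<bar>) summable_on UNIV"
    by (rule summable_on_comparison_test[OF g]) (use mult_right_mono[OF v1] in auto)
  have ag_fibre: "(\<lambda>t. \<bar>g t\<bar>) summable_on {t. \<mu> t = m}" for m
    by (rule summable_on_subset_banach[OF ag]) auto
  note sums = has_sum_fibres[OF g, of \<mu>]
  have le: "w m * \<bar>b m\<bar> \<le> (\<Sum>\<^sub>\<infinity>t\<in>{t. \<mu> t = m}. v t * \<bar>g t\<bar>)" for m
  proof -
    have "\<bar>b m\<bar> \<le> (\<Sum>\<^sub>\<infinity>t\<in>{t. \<mu> t = m}. \<bar>g t\<bar>)"
      unfolding b_def using norm_infsum_bound[of g "{t. \<mu> t = m}"] ag_fibre[of m] by simp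
    then have "w m * \<bar>b m\<bar> \<le> w m * (\<Sum>\<^sub>\<infinity>t\<in>{t. \<mu> t = m}. \<bar>g t\<bar>)"
      by (intro mult_left_mono weight_nonneg)
    also have "\<dots> = (\<Sum>\<^sub>\<infinity>t\<in>{t. \<mu> t = m}. w m * \<bar>g t\<bar>)"
      by (rule infsum_cmult_right'[symmetric])
    also have "\<dots> \<le> (\<Sum>\<^sub>\<infinity>t\<in>{t. \<mu> t = m}. v t * \<bar>g t\<bar>)"
      by (intro infsum_mono summable_on_cmult_right ag_fibre summable_on_subset_banach[OF g]
            mult_right_mono) (use wv in auto)
    finally show ?thesis .
  qed
  have "(\<lambda>m. \<Sum>\<^sub>\<infinity>t\<in>{t. \<mu> t = m}. v t * \<bar>g t\<bar>) summable_on UNIV"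
    using sums by (rule has_sum_imp_summable)
  from summable_on_comparison_test[OF this le] show b: "b \<in> wl1 w"
    unfolding wl1_def by (simp add: weight_nonneg)
  have "wnorm w b \<le> (\<Sum>\<^sub>\<infinity>m. \<Sum>\<^sub>\<infinity>t\<in>{t. \<mu> t = m}. v t * \<bar>g t\<bar>)"
    unfolding wnorm_def
    by (intro infsum_mono le has_sum_imp_summable[OF sums]) (use b in \<open>auto simp: wl1_def\<close>)
  also have "\<dots> = (\<Sum>\<^sub>\<infinity>t. v t * \<bar>g t\<bar>)" using sums by (rule infsumI)
  finally show "wnorm w b \<le> (\<Sum>\<^sub>\<infinity>t. v t * \<bar>g t\<bar>)" .
  fix \<phi> :: "'k \<Rightarrow> real" assume \<phi>: "\<And>k. \<bar>\<phi> k\<bar> \<le> 1"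
  have "(\<lambda>t. \<bar>g t * \<phi> (\<mu> t)\<bar>) summable_on UNIV"
    by (rule summable_on_comparison_test[OF ag])
       (use \<phi> in \<open>auto simp: abs_mult intro: mult_left_le\<close>)
  then have s: "(\<lambda>t. g t * \<phi> (\<mu> t)) summable_on UNIV"
    using abs_summable_summable[of "\<lambda>t. g t * \<phi> (\<mu> t)" UNIV] by simp
  have "(\<Sum>\<^sub>\<infinity>t\<in>{t. \<mu> t = m}. g t * \<phi> (\<mu> t)) = b m * \<phi> m" for m
  proof -
    have "(\<Sum>\<^sub>\<infinity>t\<in>{t. \<mu> t = m}. g t * \<phi> (\<mu> t)) = (\<Sum>\<^sub>\<infinity>t\<in>{t. \<mu> t = m}. g t * \<phi> m)"
      by (rule infsum_cong) auto
    also have "\<dots> = b m * \<phi> m" unfolding b_def by (rule infsum_cmult_left')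
    finally show ?thesis .
  qed
  then show "(\<Sum>\<^sub>\<infinity>m. b m * \<phi> m) = (\<Sum>\<^sub>\<infinity>t. g t * \<phi> (\<mu> t))"
    using infsumI[OF has_sum_fibres[OF s, of \<mu>]] by simp
qed

lemma has_sum_Times_mult_nonneg:
  fixes f :: "'a \<Rightarrow> real" and g :: "'b \<Rightarrow> real"
  assumes f: "f summable_on UNIV" "\<And>x. 0 \<le> f x" and g: "g summable_on UNIV" "\<And>y. 0 \<le> g y"
  shows "((\<lambda>(x, y). f x * g y) has_sum (infsum f UNIV * infsum g UNIV)) UNIV"
proof -
  have inner: "((\<lambda>y. (\<lambda>(x, y). f x * g y) (x, y)) has_sum (f x * infsum g UNIV)) UNIV" for x
    using has_sum_cmult_right[OF has_sum_infsum[OF g(1)], of "f x"] by simp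
  have outer: "((\<lambda>x. f x * infsum g UNIV) has_sum (infsum f UNIV * infsum g UNIV)) UNIV"
    using has_sum_cmult_left[OF has_sum_infsum[OF f(1)], of "infsum g UNIV"] by simp
  have "(\<lambda>(x, y). f x * g y) summable_on (UNIV \<times> UNIV)"
    by (rule summable_on_SigmaI[OF inner has_sum_imp_summable[OF outer]]) (use f g in auto)
  from has_sum_SigmaI[OF inner outer this] show ?thesis by simp
qed

lemma has_sum_Times_mult:
  fixes f :: "'a \<Rightarrow> real" and g :: "'b \<Rightarrow> real"
  assumes f: "(\<lambda>x. \<bar>f x\<bar>) summable_on UNIV" and g: "(\<lambda>y. \<bar>g y\<bar>) summable_on UNIV"
  shows "((\<lambda>(x, y). f x * g y) has_sum (infsum f UNIV * infsum g UNIV)) UNIV"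
proof -
  have f': "f summable_on UNIV" and g': "g summable_on UNIV"
    using f g abs_summable_summable[of f UNIV] abs_summable_summable[of g UNIV] by auto
  have "(\<lambda>(x, y). \<bar>f x\<bar> * \<bar>g y\<bar>) summable_on UNIV"
    using has_sum_imp_summable[OF has_sum_Times_mult_nonneg[OF f _ g]] by simp
  then have "(\<lambda>p. \<bar>(\<lambda>(x, y). f x * g y) p\<bar>) summable_on UNIV"
    by (rule summable_on_cong[THEN iffD1, rotated]) (auto simp: abs_mult)
  then have s: "(\<lambda>(x, y). f x * g y) summable_on (UNIV \<times> UNIV)"
    using abs_summable_summable[of "\<lambda>(x, y). f x * g y" UNIV] by simp
  have inner: "((\<lambda>y. (\<lambda>(x, y). f x * g y) (x, y)) has_sum (f x * infsum g UNIV)) UNIV" for x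
    using has_sum_cmult_right[OF has_sum_infsum[OF g'], of "f x"] by simp
  have outer: "((\<lambda>x. f x * infsum g UNIV) has_sum (infsum f UNIV * infsum g UNIV)) UNIV"
    using has_sum_cmult_left[OF has_sum_infsum[OF f'], of "infsum g UNIV"] by simp
  from has_sum_SigmaI[OF inner outer s] show ?thesis by simp
qed

text \<open>
  The frequencies occurring in \<open>\<Phi>\<^sub>j \<Phi>\<^sub>k\<close> are \<open>\<bar>j\<^sub>i \<plusminus> k\<^sub>i\<bar>\<close>, one choice of signs for each set \<open>S\<close>
  of coordinates.
\<close>

definition combine_freq :: "'n set \<Rightarrow> nat ^ 'n \<Rightarrow> nat ^ 'n \<Rightarrow> nat ^ 'n" where
  "combine_freq S j k =
     (\<chi> i. if i \<in> S then j $ i + k $ i else if k $ i \<le> j $ i then j $ i - k $ i else k $ i - j $ i)"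

text \<open>
  The addition theorem \<open>cos a cos b = (cos (a + b) + cos (a - b)) / 2\<close> in each coordinate, multiplied
  out over the coordinates.
\<close>

lemma cos_basis_mult:
  fixes j k :: "nat ^ 'n"
  shows "cos_basis j x * cos_basis k x
    = (\<Sum>S\<in>UNIV. cos_basis (combine_freq S j k) x / 2 ^ CARD('n))"
proof -
  define A where "A i = cos (pi * real (j $ i + k $ i) * x $ i) / 2" for i
  define B where "B i = cos (pi * real (if k $ i \<le> j $ i then j $ i - k $ i else k $ i - j $ i) * x $ i) / 2" for i
  have factor: "cos (pi * real (j $ i) * x $ i) * cos (pi * real (k $ i) * x $ i) = A i + B i" for i
  proof -
    have "B i = cos (pi * real (j $ i) * x $ i - pi * real (k $ i) * x $ i) / 2"
    proof (cases "k $ i \<le> j $ i")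
      case True
      then show ?thesis by (simp add: B_def of_nat_diff algebra_simps)
    next
      case False
      have "cos (pi * real (k $ i) * x $ i - pi * real (j $ i) * x $ i)
          = cos (pi * real (j $ i) * x $ i - pi * real (k $ i) * x $ i)"
        using cos_minus[of "pi * real (k $ i) * x $ i - pi * real (j $ i) * x $ i"] by simp
      then show ?thesis using False by (simp add: B_def of_nat_diff algebra_simps)
    qed
    moreover have "A i = cos (pi * real (j $ i) * x $ i + pi * real (k $ i) * x $ i) / 2"
      by (simp add: A_def algebra_simps)
    ultimately show ?thesis by (simp add: cos_add cos_diff)
  qed
  have "cos_basis j x * cos_basis k x = (\<Prod>i\<in>UNIV. A i + B i)"
    by (simp add: cos_basis_def prod.distrib[symmetric] factor)
  also have "\<dots> = (\<Sum>S\<in>UNIV. prod A S * prod B (- S))"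
    by (subst prod_add) (auto simp: Compl_eq_Diff_UNIV)
  also have "\<dots> = (\<Sum>S\<in>UNIV. \<Prod>i\<in>UNIV. if i \<in> S then A i else B i)"
    by (simp add: prod.If_cases)
  also have "\<dots> = (\<Sum>S\<in>UNIV. cos_basis (combine_freq S j k) x / 2 ^ CARD('n))"
  proof (rule sum.cong)
    fix S :: "'n set"
    have "(\<Prod>i\<in>UNIV. if i \<in> S then A i else B i)
        = (\<Prod>i\<in>UNIV. cos (pi * real (combine_freq S j k $ i) * x $ i) / 2)"
      by (intro prod.cong) (auto simp: A_def B_def combine_freq_def)
    also have "\<dots> = cos_basis (combine_freq S j k) x / 2 ^ CARD('n)"
      by (simp add: prod_dividef cos_basis_def)
    finally show "(\<Prod>i\<in>UNIV. if i \<in> S then A i else B i)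
        = cos_basis (combine_freq S j k) x / 2 ^ CARD('n)" .
  qed simp
  finally show ?thesis .
qed

lemma abs_cos_basis_le_1: "\<bar>cos_basis k x\<bar> \<le> 1"
  unfolding cos_basis_def abs_prod by (rule prod_le_1) auto

lemma l1_norm_nonneg: "0 \<le> l1_norm k"
  unfolding l1_norm_def by (intro sum_nonneg) auto

lemma l1_norm_combine_freq: "l1_norm (combine_freq S j k) \<le> l1_norm j + l1_norm k"
  unfolding l1_norm_def sum.distrib[symmetric] combine_freq_def by (intro sum_mono) auto

interpretation barron: weight "barron_weight s" for s
  by standard (simp add: barron_weight_def)

text \<open>
  The factor \<open>2 powr s\<close> comes from \<open>(a + b)\<^sup>s \<le> (2 max a b)\<^sup>s \<le> 2\<^sup>s (a\<^sup>s + b\<^sup>s)\<close>; the cross terms that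
  complete the product of the two weights are nonnegative.
\<close>

lemma barron_weight_submult:
  assumes "0 \<le> s" "l1_norm m \<le> l1_norm j + l1_norm k"
  shows "barron_weight s m \<le> 2 powr s * (barron_weight s j * barron_weight s k)"
proof (cases "s = 0")
  case True
  then show ?thesis by (simp add: barron_weight_def)
next
  case False
  define a b where "a = l1_norm j" and "b = l1_norm k"
  have ab: "0 \<le> a" "0 \<le> b" unfolding a_def b_def by (rule l1_norm_nonneg)+
  define P where "P = pi powr s"
  have P: "0 \<le> P" by (simp add: P_def)
  have "l1_norm m powr s \<le> (a + b) powr s"
    using assms l1_norm_nonneg[of m] by (intro powr_mono2) (auto simp: a_def b_def)
  also have "\<dots> \<le> (2 * max a b) powr s"
    using assms ab by (intro powr_mono2) auto
  also have "\<dots> = 2 powr s * max a b powr s"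
    using ab by (simp add: powr_mult)
  also have "\<dots> \<le> 2 powr s * (a powr s + b powr s)"
    by (intro mult_left_mono) (auto simp: max_def)
  finally have *: "l1_norm m powr s \<le> 2 powr s * (a powr s + b powr s)" .
  have one: "1 \<le> (2::real) powr s" using assms(1) by (simp add: ge_one_powr_ge_zero)
  have "1 + P * l1_norm m powr s \<le> 2 powr s * 1 + P * (2 powr s * (a powr s + b powr s))"
    using one by (intro add_mono mult_left_mono * P) auto
  also have "\<dots> \<le> 2 powr s * 1 + P * (2 powr s * (a powr s + b powr s))
      + 2 powr s * ((P * a powr s) * (P * b powr s))"
    using P by simp
  also have "\<dots> = 2 powr s * ((1 + P * a powr s) * (1 + P * b powr s))"
    by (simp add: algebra_simps)
  finally show ?thesis using False by (simp add: barron_weight_def P_def a_def b_def)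
qed

definition cos_series :: "(nat ^ 'n \<Rightarrow> real) \<Rightarrow> real ^ 'n \<Rightarrow> real" where
  "cos_series c x = (\<Sum>\<^sub>\<infinity>k. c k * cos_basis k x)"

lemma cos_series_abs_summable:
  assumes "c \<in> wl1 (barron_weight s)"
  shows "(\<lambda>k. \<bar>c k * cos_basis k x\<bar>) summable_on UNIV"
  by (rule summable_on_comparison_test[OF barron.wl1_abs_summable(1)[OF assms]])
     (auto simp: abs_mult intro: mult_left_le abs_cos_basis_le_1)

lemma cos_series_has_sum:
  assumes "c \<in> wl1 (barron_weight s)"
  shows "((\<lambda>k. c k * cos_basis k x) has_sum cos_series c x) UNIV"
  unfolding cos_series_def
  using abs_summable_summable[of "\<lambda>k. c k * cos_basis k x" UNIV] cos_series_abs_summable[OF assms]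
  by simp

text \<open>
  The Barron space is an algebra: by the product formula, multiplying two cosine series convolves
  their coefficients, and the weight is submultiplicative along the frequencies that occur.
\<close>

lemma cos_series_mult:
  fixes a c :: "nat ^ 'n \<Rightarrow> real"
  assumes s: "0 \<le> s" and a: "a \<in> wl1 (barron_weight s)" and c: "c \<in> wl1 (barron_weight s)"
  shows "\<exists>b\<in>wl1 (barron_weight s). (\<forall>x. cos_series b x = cos_series a x * cos_series c x) \<and>
    wnorm (barron_weight s) b \<le> 2 powr s * wnorm (barron_weight s) a * wnorm (barron_weight s) c"
proof -
  define w :: "nat ^ 'n \<Rightarrow> real" where "w = barron_weight s"
  have w_nonneg: "0 \<le> w k" for k unfolding w_def by (rule barron.weight_nonneg)
  define \<mu> :: "((nat ^ 'n) \<times> (nat ^ 'n)) \<times> 'n set \<Rightarrow> nat ^ 'n"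
    where "\<mu> = (\<lambda>((j, k), S). combine_freq S j k)"
  define g :: "((nat ^ 'n) \<times> (nat ^ 'n)) \<times> 'n set \<Rightarrow> real"
    where "g = (\<lambda>((j, k), S). (a j * c k) * (1 / 2 ^ CARD('n)))"
  define v :: "((nat ^ 'n) \<times> (nat ^ 'n)) \<times> 'n set \<Rightarrow> real"
    where "v = (\<lambda>((j, k), S). 2 powr s * (w j * w k))"
  have wv: "w (\<mu> t) \<le> v t" for t
    by (cases t) (auto simp: \<mu>_def v_def w_def intro!: barron_weight_submult s l1_norm_combine_freq)
  have wa: "(\<lambda>k. w k * \<bar>a k\<bar>) summable_on UNIV" and wc: "(\<lambda>k. w k * \<bar>c k\<bar>) summable_on UNIV"
    using a c by (auto simp: wl1_def w_def)
  have 1: "((\<lambda>(j, k). (w j * \<bar>a j\<bar>) * (w k * \<bar>c k\<bar>)) has_sum (wnorm w a * wnorm w c)) UNIV"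
    unfolding wnorm_def by (rule has_sum_Times_mult_nonneg[OF wa _ wc]) (auto simp: w_nonneg)
  have nn: "0 \<le> (\<lambda>(j, k). (w j * \<bar>a j\<bar>) * (w k * \<bar>c k\<bar>)) p" for p
    by (auto simp: w_nonneg split: prod.split)
  have fin: "((\<lambda>S::'n set. 2 powr s / 2 ^ CARD('n)) has_sum 2 powr s) UNIV"
    by (rule has_sum_finiteI) (auto simp: card_UNIV_set)
  have "((\<lambda>(p, S). (\<lambda>(j, k). (w j * \<bar>a j\<bar>) * (w k * \<bar>c k\<bar>)) p * (2 powr s / 2 ^ CARD('n)))
      has_sum (wnorm w a * wnorm w c * 2 powr s)) (UNIV :: (((nat ^ 'n) \<times> (nat ^ 'n)) \<times> 'n set) set)"
    using has_sum_Times_mult_nonneg[OF has_sum_imp_summable[OF 1] nn has_sum_imp_summable[OF fin]]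
    unfolding infsumI[OF 1] infsumI[OF fin] by simp
  then have vg: "((\<lambda>t. v t * \<bar>g t\<bar>) has_sum (wnorm w a * wnorm w c * 2 powr s)) UNIV"
    by (rule has_sum_cong[THEN iffD1, rotated])
       (auto simp: v_def g_def abs_mult split: prod.splits)
  interpret w: weight w unfolding w_def by (rule barron.weight_axioms)
  define b where "b = (\<lambda>m. \<Sum>\<^sub>\<infinity>t\<in>{t. \<mu> t = m}. g t)"
  note collect = w.wl1_collect[where \<mu>=\<mu> and v=v, OF wv has_sum_imp_summable[OF vg]]
  have "cos_series b x = cos_series a x * cos_series c x" for x
  proof -
    have "((\<lambda>(j, k). (a j * cos_basis j x) * (c k * cos_basis k x)) has_sum
        (cos_series a x * cos_series c x)) UNIV" (is "(?F has_sum _) _")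
      unfolding cos_series_def
      by (rule has_sum_Times_mult[OF cos_series_abs_summable[OF a] cos_series_abs_summable[OF c]])
    moreover have inner: "((\<lambda>S. g (p, S) * cos_basis (\<mu> (p, S)) x) has_sum ?F p) UNIV" for p
    proof (rule has_sum_finiteI)
      obtain j k where p: "p = (j, k)" by force
      have "?F p = a j * c k * (cos_basis j x * cos_basis k x)" by (simp add: p)
      also have "\<dots> = (\<Sum>S\<in>UNIV. g (p, S) * cos_basis (\<mu> (p, S)) x)"
        by (subst cos_basis_mult) (simp add: sum_distrib_left g_def \<mu>_def p mult_ac)
      finally show "?F p = (\<Sum>S\<in>UNIV. g (p, S) * cos_basis (\<mu> (p, S)) x)" .
    qed simp
    moreover have "(\<lambda>t. g t * cos_basis (\<mu> t) x) summable_on (UNIV \<times> UNIV)"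
    proof -
      have v1: "1 \<le> v t" for t
        using wv[of t] w.weight_ge_1[of "\<mu> t"] by linarith
      have "\<bar>g t * cos_basis (\<mu> t) x\<bar> \<le> v t * \<bar>g t\<bar>" for t
      proof -
        have "\<bar>g t\<bar> * \<bar>cos_basis (\<mu> t) x\<bar> \<le> \<bar>g t\<bar> * 1"
          by (intro mult_left_mono abs_cos_basis_le_1) auto
        also have "\<dots> \<le> v t * \<bar>g t\<bar>" using mult_right_mono[OF v1[of t], of "\<bar>g t\<bar>"] by simp
        finally show ?thesis by (simp add: abs_mult)
      qed
      then have "(\<lambda>t. \<bar>g t * cos_basis (\<mu> t) x\<bar>) summable_on UNIV"
        by (intro summable_on_comparison_test[OF has_sum_imp_summable[OF vg]]) auto
      then show ?thesis
        using abs_summable_summable[of "\<lambda>t. g t * cos_basis (\<mu> t) x" UNIV] by simp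
    qed
    ultimately have "((\<lambda>t. g t * cos_basis (\<mu> t) x) has_sum (cos_series a x * cos_series c x))
        (UNIV \<times> UNIV)"
      by (intro has_sum_SigmaI[where g="?F"])
    then have "(\<Sum>\<^sub>\<infinity>t. g t * cos_basis (\<mu> t) x) = cos_series a x * cos_series c x"
      by (simp add: infsumI)
    then show ?thesis
      using collect(3)[of "\<lambda>k. cos_basis k x", OF abs_cos_basis_le_1] by (simp add: cos_series_def b_def)
  qed
  moreover have "wnorm w b \<le> 2 powr s * wnorm w a * wnorm w c"
    using collect(2) infsumI[OF vg] by (simp add: mult_ac b_def)
  ultimately show ?thesis using collect(1) unfolding w_def b_def by blast
qed

section \<open>Smooth functions, the cosine basis and cutoffs\<close>

lemma partial_deriv_eq:
  assumes "(f has_derivative f') (at x)"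
  shows "partial_deriv i f x = f' (axis i 1)"
  using frechet_derivative_at[OF assms] by (simp add: partial_deriv_def)

lemma has_derivative_nth:
  fixes x :: "real ^ 'n"
  assumes "(f has_real_derivative f') (at (x $ i))"
  shows "((\<lambda>x. f (x $ i)) has_derivative (\<lambda>h. f' * h $ i)) (at x)"
proof -
  have "((\<lambda>x::real ^ 'n. x $ i) has_derivative (\<lambda>h. h $ i)) (at x)"
    by (rule bounded_linear_imp_has_derivative[OF bounded_linear_vec_nth])
  from has_derivative_compose[OF this assms[unfolded has_field_derivative_def]]
  show ?thesis by simp
qed

lemma DERIV_along_axis:
  fixes g :: "real ^ 'n \<Rightarrow> real"
  assumes "g differentiable (at (x + t *\<^sub>R axis i 1))"
  shows "((\<lambda>t. g (x + t *\<^sub>R axis i 1)) has_real_derivative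
    partial_deriv i g (x + t *\<^sub>R axis i 1)) (at t)"
proof -
  have "((\<lambda>t. x + t *\<^sub>R axis i 1) has_derivative (\<lambda>s. s *\<^sub>R axis i 1)) (at t)"
    by (auto intro!: derivative_eq_intros)
  from has_derivative_compose[OF this assms[THEN frechet_derivative_works[THEN iffD1]]]
  have "((\<lambda>t. g (x + t *\<^sub>R axis i 1)) has_derivative
    (\<lambda>s. frechet_derivative g (at (x + t *\<^sub>R axis i 1)) (s *\<^sub>R axis i 1))) (at t)" .
  moreover have "frechet_derivative g (at (x + t *\<^sub>R axis i 1)) (s *\<^sub>R axis i 1)
      = partial_deriv i g (x + t *\<^sub>R axis i 1) * s" for s
    using linear_scale[OF linear_frechet_derivative[OF assms], of s "axis i 1"]
    by (simp add: partial_deriv_def)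
  ultimately show ?thesis by (simp add: has_field_derivative_def)
qed

text \<open>
  Reduces a partial derivative to an ordinary one, so that the calculus of one variable applies to
  functions that are explicit in the \<open>i\<close>-th coordinate.
\<close>

lemma partial_deriv_eq_DERIV:
  fixes g :: "real ^ 'n \<Rightarrow> real"
  assumes "g differentiable (at x)"
    and "((\<lambda>t. g (x + t *\<^sub>R axis i 1)) has_real_derivative D) (at 0)"
  shows "partial_deriv i g x = D"
  using DERIV_unique[OF DERIV_along_axis[of g x 0 i] assms(2)] assms(1) by simp

text \<open>
  A class of smooth functions that is closed under partial derivatives by construction; the
  hypothesis of \<open>coordinate\<close> says that \<open>D 0\<close> is infinitely differentiable with derivatives
  \<open>D 1, D 2, \<dots>\<close>.
\<close>

inductive_set tensor_smooth :: "(real ^ 'n \<Rightarrow> real) set" where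
  coordinate: "(\<And>m t. (D m has_real_derivative D (Suc m) t) (at t)) \<Longrightarrow> (\<lambda>x. D 0 (x $ i)) \<in> tensor_smooth"
| add: "f \<in> tensor_smooth \<Longrightarrow> g \<in> tensor_smooth \<Longrightarrow> (\<lambda>x. f x + g x) \<in> tensor_smooth"
| mult: "f \<in> tensor_smooth \<Longrightarrow> g \<in> tensor_smooth \<Longrightarrow> (\<lambda>x. f x * g x) \<in> tensor_smooth"

lemma tensor_smooth_const: "(\<lambda>x. c) \<in> tensor_smooth"
  using tensor_smooth.coordinate[of "\<lambda>m t. if m = 0 then c else 0"] by auto

lemma tensor_smooth_prod:
  assumes "finite A" "\<And>i. i \<in> A \<Longrightarrow> f i \<in> tensor_smooth"
  shows "(\<lambda>x. \<Prod>i\<in>A. f i x) \<in> tensor_smooth"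
  using assms
  by (induction A rule: finite_induct) (auto intro: tensor_smooth_const tensor_smooth.mult)

lemma tensor_smooth_partial_deriv:
  assumes "f \<in> tensor_smooth"
  shows "(\<forall>x. f differentiable (at x)) \<and> (\<forall>j. partial_deriv j f \<in> tensor_smooth)"
  using assms
proof induction
  case (coordinate D i)
  have *: "((\<lambda>x. D 0 (x $ i)) has_derivative (\<lambda>h. D (Suc 0) (x $ i) * h $ i)) (at x)" for x
    by (rule has_derivative_nth[OF coordinate])
  have "partial_deriv j (\<lambda>x. D 0 (x $ i)) = (\<lambda>x. D (Suc 0) (x $ i) * axis j 1 $ i)" for j
    using partial_deriv_eq[OF *] by auto
  moreover have "(\<lambda>x. D (Suc 0) (x $ i)) \<in> tensor_smooth"
    using tensor_smooth.coordinate[of "\<lambda>m. D (Suc m)" i] coordinate by simp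
  ultimately show ?case
    using * by (auto simp: differentiable_def intro!: tensor_smooth.mult tensor_smooth_const)
next
  case (add f g)
  have *: "((\<lambda>x. f x + g x) has_derivative
      (\<lambda>h. frechet_derivative f (at x) h + frechet_derivative g (at x) h)) (at x)" for x
    using add by (intro has_derivative_add) (auto simp: frechet_derivative_works[symmetric])
  have "partial_deriv j (\<lambda>x. f x + g x) = (\<lambda>x. partial_deriv j f x + partial_deriv j g x)" for j
    using partial_deriv_eq[OF *] by (auto simp: partial_deriv_def)
  then show ?case using * add by (auto simp: differentiable_def intro!: tensor_smooth.add)
next
  case (mult f g)
  have *: "((\<lambda>x. f x * g x) has_derivative
      (\<lambda>h. f x * frechet_derivative g (at x) h + frechet_derivative f (at x) h * g x)) (at x)" for x
    using mult by (intro has_derivative_mult) (auto simp: frechet_derivative_works[symmetric])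
  have "partial_deriv j (\<lambda>x. f x * g x) = (\<lambda>x. f x * partial_deriv j g x + partial_deriv j f x * g x)" for j
    using partial_deriv_eq[OF *] by (auto simp: partial_deriv_def)
  then show ?case
    using * mult by (auto simp: differentiable_def intro!: tensor_smooth.add tensor_smooth.mult)
qed

lemma tensor_smooth_differentiable: "f \<in> tensor_smooth \<Longrightarrow> f differentiable (at x)"
  using tensor_smooth_partial_deriv by blast

lemma tensor_smooth_continuous: "f \<in> tensor_smooth \<Longrightarrow> continuous_on S f"
  using tensor_smooth_differentiable differentiable_imp_continuous_within
  by (metis continuous_at_imp_continuous_on)

lemma partial_deriv_in_tensor_smooth: "f \<in> tensor_smooth \<Longrightarrow> partial_deriv i f \<in> tensor_smooth"
  using tensor_smooth_partial_deriv by blast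

lemma partial_deriv_mult:
  assumes "f differentiable (at x)" "g differentiable (at x)"
  shows "partial_deriv j (\<lambda>x. f x * g x) x = f x * partial_deriv j g x + partial_deriv j f x * g x"
  using partial_deriv_eq[OF has_derivative_mult[OF assms[THEN frechet_derivative_works[THEN iffD1]]]]
  by (simp add: partial_deriv_def)

text \<open>
  Smoothness of every order is immediate by induction, because the class is closed under partial
  derivatives.
\<close>

lemma C_k_tensor_smooth: "f \<in> tensor_smooth \<Longrightarrow> C_k m f"
  by (induction m arbitrary: f)
     (auto intro: tensor_smooth_continuous tensor_smooth_differentiable partial_deriv_in_tensor_smooth)

subsection \<open>Derivatives of the cosine basis\<close>

lemma cos_coordinate_smooth: "(\<lambda>x::real ^ 'n. cos (a * x $ i)) \<in> tensor_smooth"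
proof -
  have "((\<lambda>t. a ^ m * cos (a * t + real m * (pi / 2))) has_real_derivative
      a ^ Suc m * cos (a * t + real (Suc m) * (pi / 2))) (at t)" for m t
  proof -
    have "cos (a * t + real (Suc m) * (pi / 2)) = - sin (a * t + real m * (pi / 2))"
      using minus_sin_cos_eq[of "a * t + real m * (pi / 2)"] by (simp add: algebra_simps add_divide_distrib)
    then show ?thesis by (auto intro!: derivative_eq_intros)
  qed
  from tensor_smooth.coordinate[of "\<lambda>m t. a ^ m * cos (a * t + real m * (pi / 2))", OF this]
  show ?thesis by simp
qed

lemma cos_basis_smooth: "cos_basis k \<in> tensor_smooth"
  unfolding cos_basis_def[abs_def] by (intro tensor_smooth_prod cos_coordinate_smooth) auto

definition cos_cofactor :: "'n \<Rightarrow> nat ^ 'n \<Rightarrow> real ^ 'n \<Rightarrow> real" where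
  "cos_cofactor i k x = (\<Prod>j\<in>UNIV - {i}. cos (pi * real (k $ j) * x $ j))"

lemma cos_basis_split: "cos_basis k x = cos (pi * real (k $ i) * x $ i) * cos_cofactor i k x"
  unfolding cos_basis_def cos_cofactor_def by (rule prod.remove) auto

lemma abs_cos_cofactor_le_1: "\<bar>cos_cofactor i k x\<bar> \<le> 1"
  unfolding cos_cofactor_def abs_prod by (rule prod_le_1) auto

lemma cos_cofactor_along_axis: "cos_cofactor i k (x + t *\<^sub>R axis i 1) = cos_cofactor i k x"
  unfolding cos_cofactor_def by (intro prod.cong) (auto simp: axis_def)

text \<open>
  The factor \<open>sin (\<pi> k\<^sub>i x\<^sub>i)\<close> vanishes on the two faces orthogonal to the \<open>i\<close>-th axis: each \<open>\<Phi>\<^sub>k\<close>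
  satisfies the Neumann condition.
\<close>

lemma partial_deriv_cos_basis:
  "partial_deriv i (cos_basis k) x
     = - (pi * real (k $ i) * sin (pi * real (k $ i) * x $ i)) * cos_cofactor i k x"
proof (rule partial_deriv_eq_DERIV[OF tensor_smooth_differentiable[OF cos_basis_smooth]])
  show "((\<lambda>t. cos_basis k (x + t *\<^sub>R axis i 1)) has_real_derivative
    - (pi * real (k $ i) * sin (pi * real (k $ i) * x $ i)) * cos_cofactor i k x) (at 0)"
    unfolding cos_basis_split[of k _ i] cos_cofactor_along_axis
    by (auto intro!: derivative_eq_intros)
qed

lemma partial_deriv_twice_cos_basis:
  "partial_deriv i (partial_deriv i (cos_basis k)) x = - (pi * real (k $ i))\<^sup>2 * cos_basis k x"
proof (rule partial_deriv_eq_DERIV)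
  show "partial_deriv i (cos_basis k) differentiable at x"
    by (intro tensor_smooth_differentiable partial_deriv_in_tensor_smooth cos_basis_smooth)
  show "((\<lambda>t. partial_deriv i (cos_basis k) (x + t *\<^sub>R axis i 1)) has_real_derivative
    - (pi * real (k $ i))\<^sup>2 * cos_basis k x) (at 0)"
    unfolding partial_deriv_cos_basis cos_basis_split[of k _ i] cos_cofactor_along_axis
    by (auto intro!: derivative_eq_intros simp: power2_eq_square)
qed

lemma abs_partial_deriv_cos_basis_le: "\<bar>partial_deriv i (cos_basis k) x\<bar> \<le> pi * real (k $ i)"
proof -
  have "\<bar>partial_deriv i (cos_basis k) x\<bar>
      = pi * real (k $ i) * (\<bar>sin (pi * real (k $ i) * x $ i)\<bar> * \<bar>cos_cofactor i k x\<bar>)"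
    by (simp add: partial_deriv_cos_basis abs_mult)
  also have "\<dots> \<le> pi * real (k $ i) * (1 * 1)"
    by (intro mult_left_mono mult_mono abs_cos_cofactor_le_1) auto
  finally show ?thesis by simp
qed

subsection \<open>A smooth cutoff\<close>

text \<open>
  The functions \<open>p (1 / t) exp (- 1 / t)\<close>, extended by zero to the left. For \<open>p = 1\<close> this is the
  standard smooth function that is flat at the origin; a general polynomial \<open>p\<close> is allowed because
  the derivatives are of the same form, with \<open>p\<close> replaced by \<open>z\<^sup>2 (p - p')\<close>.
\<close>

definition flat_exp :: "real poly \<Rightarrow> real \<Rightarrow> real" where
  "flat_exp p t = (if 0 < t then poly p (1 / t) * exp (- (1 / t)) else 0)"

lemma poly_times_exp_minus_tendsto_0: "((\<lambda>z::real. poly p z * exp (- z)) \<longlongrightarrow> 0) at_top"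
proof -
  have "((\<lambda>z::real. \<Sum>i\<le>degree p. coeff p i * (z ^ i / exp z)) \<longlongrightarrow> (\<Sum>i\<le>degree p. coeff p i * 0)) at_top"
    by (intro tendsto_intros tendsto_power_div_exp_0)
  moreover have "(\<Sum>i\<le>degree p. coeff p i * (z ^ i / exp z)) = poly p z * exp (- z)" for z :: real
    unfolding poly_altdef sum_distrib_right by (intro sum.cong) (auto simp: exp_minus divide_inverse)
  ultimately show ?thesis by simp
qed

text \<open>
  Away from the origin this is a computation. At the origin the difference quotient is again of the
  form \<open>q (z) exp (- z)\<close> with \<open>z = 1 / t\<close>, and the exponential beats the polynomial.
\<close>

lemma DERIV_flat_exp:
  "(flat_exp p has_real_derivative flat_exp ([:0, 0, 1:] * (p - pderiv p)) t) (at t)"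
proof -
  consider "t > 0" | "t < 0" | "t = 0" by linarith
  then show ?thesis
  proof cases
    case 1
    have "((\<lambda>t. poly p (1 / t) * exp (- (1 / t))) has_real_derivative
        flat_exp ([:0, 0, 1:] * (p - pderiv p)) t) (at t)"
      using 1 unfolding flat_exp_def
      by (auto intro!: derivative_eq_intros DERIV_chain2[OF poly_DERIV]
               simp: power2_eq_square divide_simps) (simp add: algebra_simps)
    moreover have "\<forall>\<^sub>F s in nhds t. poly p (1 / s) * exp (- (1 / s)) = flat_exp p s"
      using eventually_nhds_in_open[of "{0<..}" t] 1
      by (auto elim!: eventually_mono simp: flat_exp_def)
    ultimately show ?thesis by (subst (asm) DERIV_cong_ev[OF refl _ refl])
  next
    case 2
    have "((\<lambda>t. 0) has_real_derivative flat_exp ([:0, 0, 1:] * (p - pderiv p)) t) (at t)"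
      using 2 by (simp add: flat_exp_def)
    moreover have "\<forall>\<^sub>F s in nhds t. 0 = flat_exp p s"
      using eventually_nhds_in_open[of "{..<0}" t] 2
      by (auto elim!: eventually_mono simp: flat_exp_def)
    ultimately show ?thesis by (subst (asm) DERIV_cong_ev[OF refl _ refl])
  next
    case 3
    have right: "((\<lambda>s. flat_exp p s / s) \<longlongrightarrow> 0) (at_right 0)"
    proof -
      have "((\<lambda>s. poly (pCons 0 p) (inverse s) * exp (- inverse s)) \<longlongrightarrow> 0) (at_right (0::real))"
        by (rule filterlim_compose[OF poly_times_exp_minus_tendsto_0 filterlim_inverse_at_top_right])
      moreover have "\<forall>\<^sub>F s in at_right (0::real).
          poly (pCons 0 p) (inverse s) * exp (- inverse s) = flat_exp p s / s"
        unfolding eventually_at_right_field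
        by (intro exI[of _ 1]) (auto simp: flat_exp_def field_simps)
      ultimately show ?thesis by (rule Lim_transform_eventually)
    qed
    have left: "((\<lambda>s. flat_exp p s / s) \<longlongrightarrow> 0) (at_left 0)"
    proof (rule Lim_transform_eventually[OF tendsto_const])
      show "\<forall>\<^sub>F s in at_left (0::real). 0 = flat_exp p s / s"
        unfolding eventually_at_left_field
        by (intro exI[of _ "-1"]) (auto simp: flat_exp_def)
    qed
    have "((\<lambda>s. flat_exp p s / s) \<longlongrightarrow> 0) (at 0)"
      by (rule filterlim_split_at[OF left right])
    then show ?thesis using 3 by (simp add: DERIV_def flat_exp_def)
  qed
qed

lemma flat_exp_coordinate_smooth:
  "(\<lambda>x::real ^ 'n. flat_exp p (a * x $ i + b)) \<in> tensor_smooth"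
proof -
  define P where "P m = ((\<lambda>q. [:0, 0, 1:] * (q - pderiv q)) ^^ m) p" for m
  have "((\<lambda>t. a ^ m * flat_exp (P m) (a * t + b)) has_real_derivative
      a ^ Suc m * flat_exp (P (Suc m)) (a * t + b)) (at t)" for m t
  proof -
    have "((\<lambda>t. flat_exp (P m) (a * t + b)) has_real_derivative
        flat_exp (P (Suc m)) (a * t + b) * a) (at t)"
      using DERIV_flat_exp[of "P m" "a * t + b"] unfolding P_def
      by (intro DERIV_chain2[where g="\<lambda>t. a * t + b"])
         (auto intro!: derivative_eq_intros simp del: mult_pCons_left)
    from DERIV_cmult[OF this, of "a ^ m"] show ?thesis by (simp add: mult_ac)
  qed
  from tensor_smooth.coordinate[of "\<lambda>m t. a ^ m * flat_exp (P m) (a * t + b)", OF this]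
  show ?thesis by (simp add: P_def)
qed

text \<open>
  The cutoff vanishes within distance \<open>1 / n\<close> of the end points of the unit interval. It tends
  to 1 at each interior point, which suits limits taken by dominated convergence. \<open>coord_cutoff_deriv\<close> is its derivative.
\<close>

definition coord_cutoff :: "nat \<Rightarrow> real \<Rightarrow> real" where
  "coord_cutoff n t = flat_exp 1 (real n * t - 1) * flat_exp 1 (real n * (1 - t) - 1)"

definition coord_cutoff_deriv :: "nat \<Rightarrow> real \<Rightarrow> real" where
  "coord_cutoff_deriv n t =
     real n * flat_exp [:0, 0, 1:] (real n * t - 1) * flat_exp 1 (real n * (1 - t) - 1)
   - real n * flat_exp 1 (real n * t - 1) * flat_exp [:0, 0, 1:] (real n * (1 - t) - 1)"

definition cube_cutoff :: "nat \<Rightarrow> real ^ 'n \<Rightarrow> real" where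
  "cube_cutoff n x = (\<Prod>i\<in>UNIV. coord_cutoff n (x $ i))"

lemma cube_cutoff_smooth: "(cube_cutoff n :: real ^ 'n \<Rightarrow> real) \<in> tensor_smooth"
proof -
  have "(\<lambda>x::real ^ 'n. flat_exp 1 (real n * x $ i + (- 1)) * flat_exp 1 (- real n * x $ i + (real n - 1)))
      \<in> tensor_smooth" for i :: 'n
    by (intro tensor_smooth.mult flat_exp_coordinate_smooth)
  then have "(\<lambda>x::real ^ 'n. coord_cutoff n (x $ i)) \<in> tensor_smooth" for i :: 'n
    unfolding coord_cutoff_def by (simp add: algebra_simps)
  then show ?thesis unfolding cube_cutoff_def[abs_def] by (intro tensor_smooth_prod) auto
qed

lemma flat_exp_1_bounds: "0 \<le> flat_exp 1 t" "flat_exp 1 t \<le> 1"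
  by (auto simp: flat_exp_def)

lemma coord_cutoff_bounds: "0 \<le> coord_cutoff n t" "coord_cutoff n t \<le> 1"
  unfolding coord_cutoff_def
  by (auto intro!: mult_nonneg_nonneg mult_le_one flat_exp_1_bounds)

lemma cube_cutoff_bounds: "0 \<le> cube_cutoff n x" "cube_cutoff n x \<le> 1"
  unfolding cube_cutoff_def by (auto intro!: prod_nonneg prod_le_1 coord_cutoff_bounds)

lemma DERIV_coord_cutoff:
  "(coord_cutoff n has_real_derivative coord_cutoff_deriv n t) (at t)"
proof -
  have D: "(flat_exp 1 has_real_derivative flat_exp [:0, 0, 1:] y) (at y)" for y
    using DERIV_flat_exp[of 1 y] by (simp add: pderiv_1)
  have 1: "((\<lambda>t. flat_exp 1 (real n * t - 1)) has_real_derivative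
      flat_exp [:0, 0, 1:] (real n * t - 1) * real n) (at t)"
    by (rule DERIV_chain2[OF D]) (auto intro!: derivative_eq_intros)
  have 2: "((\<lambda>t. flat_exp 1 (real n * (1 - t) - 1)) has_real_derivative
      flat_exp [:0, 0, 1:] (real n * (1 - t) - 1) * (- real n)) (at t)"
    by (rule DERIV_chain2[OF D]) (auto intro!: derivative_eq_intros)
  show ?thesis
    unfolding coord_cutoff_def[abs_def] coord_cutoff_deriv_def
    using DERIV_mult[OF 1 2] by (simp add: algebra_simps)
qed

lemma partial_deriv_cube_cutoff:
  "partial_deriv i (cube_cutoff n) x
    = coord_cutoff_deriv n (x $ i) * (\<Prod>j\<in>UNIV - {i}. coord_cutoff n (x $ j))"
proof (rule partial_deriv_eq_DERIV[OF tensor_smooth_differentiable[OF cube_cutoff_smooth]])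
  have *: "cube_cutoff n (x + t *\<^sub>R axis i 1)
      = coord_cutoff n (x $ i + t) * (\<Prod>j\<in>UNIV - {i}. coord_cutoff n (x $ j))" for t
  proof -
    have "cube_cutoff n (x + t *\<^sub>R axis i 1) = coord_cutoff n ((x + t *\<^sub>R axis i 1) $ i)
        * (\<Prod>j\<in>UNIV - {i}. coord_cutoff n ((x + t *\<^sub>R axis i 1) $ j))"
      unfolding cube_cutoff_def by (rule prod.remove) auto
    also have "(\<Prod>j\<in>UNIV - {i}. coord_cutoff n ((x + t *\<^sub>R axis i 1) $ j))
        = (\<Prod>j\<in>UNIV - {i}. coord_cutoff n (x $ j))"
      by (intro prod.cong) (auto simp: axis_def)
    finally show ?thesis by simp
  qed
  have "((\<lambda>t. coord_cutoff n (x $ i + t)) has_real_derivative coord_cutoff_deriv n (x $ i)) (at 0)"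
    using DERIV_shift[of "coord_cutoff n" "coord_cutoff_deriv n (x $ i)" 0 "x $ i"]
      DERIV_coord_cutoff[of n "x $ i"] by (simp add: add.commute)
  then show "((\<lambda>t. cube_cutoff n (x + t *\<^sub>R axis i 1)) has_real_derivative
      coord_cutoff_deriv n (x $ i) * (\<Prod>j\<in>UNIV - {i}. coord_cutoff n (x $ j))) (at 0)"
    unfolding * by (rule DERIV_cmult_right)
qed

text \<open>
  With \<open>y = n t - 1\<close> one has \<open>y + 1 = n t\<close>, so this bounds \<open>t\<close> times the derivative of the rescaled
  function \<open>flat_exp 1 (n t - 1)\<close> uniformly in \<open>n\<close>.
\<close>

lemma flat_exp_deriv_bound: "(y + 1) * flat_exp [:0, 0, 1:] y \<le> 3"
proof (cases "0 < y")
  case True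
  define z where "z = 1 / y"
  have z: "0 < z" and y: "y = 1 / z" using True by (auto simp: z_def)
  \<comment> \<open>In the variable \<open>z\<close> the claim is \<open>z + z\<^sup>2 \<le> 3 exp z\<close>, which follows from the quadratic Taylor bound.\<close>
  have "(y + 1) * flat_exp [:0, 0, 1:] y = (z + z\<^sup>2) / exp z"
    using True z by (simp add: flat_exp_def y exp_minus power2_eq_square field_simps)
  also have "z + z\<^sup>2 \<le> 3 * exp z"
    using exp_lower_Taylor_quadratic[of z] z zero_le_power2[of z] by linarith
  then have "(z + z\<^sup>2) / exp z \<le> 3" by (simp add: divide_le_eq)
  finally show ?thesis .
qed (simp add: flat_exp_def)

lemma flat_exp_deriv_nonneg: "0 \<le> flat_exp [:0, 0, 1:] y"
  by (auto simp: flat_exp_def)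

text \<open>
  The derivative of the cutoff is of size \<open>n\<close> in boundary layers of width \<open>1 / n\<close>. Multiplying it
  by a function that vanishes at the two end points like the distance restores boundedness, which
  is how the Neumann condition satisfied by \<open>\<Phi>\<^sub>k\<close> enters.
\<close>

lemma coord_cutoff_deriv_bound:
  assumes t: "0 \<le> t" "t \<le> 1" and u: "\<bar>u\<bar> \<le> c * t" "\<bar>u\<bar> \<le> c * (1 - t)" and c: "0 \<le> c"
  shows "\<bar>u * coord_cutoff_deriv n t\<bar> \<le> 6 * c"
proof -
  have key: "\<bar>u\<bar> * (real n * flat_exp [:0, 0, 1:] (real n * r - 1)) * flat_exp 1 q \<le> 3 * c"
    if "\<bar>u\<bar> \<le> c * r" for r q
  proof -
    have "\<bar>u\<bar> * (real n * flat_exp [:0, 0, 1:] (real n * r - 1)) * flat_exp 1 q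
        \<le> \<bar>u\<bar> * (real n * flat_exp [:0, 0, 1:] (real n * r - 1)) * 1"
      by (intro mult_left_mono flat_exp_1_bounds mult_nonneg_nonneg flat_exp_deriv_nonneg) auto
    also have "\<dots> \<le> (c * r) * (real n * flat_exp [:0, 0, 1:] (real n * r - 1)) * 1"
      by (intro mult_right_mono that mult_nonneg_nonneg flat_exp_deriv_nonneg) auto
    also have "\<dots> = c * (((real n * r - 1) + 1) * flat_exp [:0, 0, 1:] (real n * r - 1))"
      by simp
    also have "\<dots> \<le> c * 3" by (intro mult_left_mono flat_exp_deriv_bound c)
    finally show ?thesis by simp
  qed
  have "\<bar>u * coord_cutoff_deriv n t\<bar> \<le>
      \<bar>u\<bar> * (real n * flat_exp [:0, 0, 1:] (real n * t - 1)) * flat_exp 1 (real n * (1 - t) - 1)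
    + \<bar>u\<bar> * (real n * flat_exp [:0, 0, 1:] (real n * (1 - t) - 1)) * flat_exp 1 (real n * t - 1)"
    unfolding coord_cutoff_deriv_def abs_mult
    using flat_exp_deriv_nonneg flat_exp_1_bounds(1)
    by (auto simp: abs_mult algebra_simps intro!: order_trans[OF mult_left_mono[OF abs_triangle_ineq4]])
  also have "\<dots> \<le> 3 * c + 3 * c" by (intro add_mono key u)
  finally show ?thesis by simp
qed

lemma scaled_at_top:
  assumes "0 < (t::real)"
  shows "filterlim (\<lambda>n. real n * t - 1) at_top sequentially"
  using filterlim_tendsto_add_at_top[OF tendsto_const[of "-1"]
    filterlim_at_top_mult_tendsto_pos[OF tendsto_const assms filterlim_real_sequentially]]
  by (simp add: mult.commute)

lemma flat_exp_1_tendsto: "(flat_exp 1 \<longlongrightarrow> 1) at_top"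
proof -
  have "((\<lambda>y::real. exp (- inverse y)) \<longlongrightarrow> exp (- 0)) at_top"
    by (intro tendsto_intros tendsto_inverse_0_at_top filterlim_ident)
  then have "((\<lambda>y::real. exp (- inverse y)) \<longlongrightarrow> 1) at_top" by simp
  then show ?thesis
    by (rule Lim_transform_eventually)
       (use eventually_gt_at_top[of 0] in \<open>auto elim!: eventually_mono simp: flat_exp_def divide_inverse\<close>)
qed

lemma flat_exp_deriv_tendsto: "((\<lambda>y. (y + 1) * flat_exp [:0, 0, 1:] y) \<longlongrightarrow> 0) at_top"
proof -
  have "((\<lambda>y::real. (inverse y + inverse y * inverse y) * exp (- inverse y))
      \<longlongrightarrow> (0 + 0 * 0) * exp (- 0)) at_top"
    by (intro tendsto_intros tendsto_inverse_0_at_top filterlim_ident)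
  then have "((\<lambda>y::real. (inverse y + inverse y * inverse y) * exp (- inverse y)) \<longlongrightarrow> 0) at_top"
    by simp
  then show ?thesis
  proof (rule Lim_transform_eventually)
    show "\<forall>\<^sub>F y in at_top. (inverse y + inverse y * inverse y) * exp (- inverse y)
        = (y + 1) * flat_exp [:0, 0, 1:] y"
      using eventually_gt_at_top[of 0]
    proof eventually_elim
      case (elim y)
      then show ?case by (simp add: flat_exp_def field_simps)
    qed
  qed
qed

lemma coord_cutoff_tendsto:
  assumes "0 < t" "t < 1"
  shows "(\<lambda>n. coord_cutoff n t) \<longlonglongrightarrow> 1"
proof -
  have "(\<lambda>n. flat_exp 1 (real n * t - 1) * flat_exp 1 (real n * (1 - t) - 1)) \<longlonglongrightarrow> 1 * 1"
    using assms by (intro tendsto_mult filterlim_compose[OF flat_exp_1_tendsto] scaled_at_top) auto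
  then show ?thesis by (simp add: coord_cutoff_def)
qed

lemma coord_cutoff_deriv_tendsto:
  assumes "0 < t" "t < 1"
  shows "(\<lambda>n. coord_cutoff_deriv n t) \<longlonglongrightarrow> 0"
proof -
  have "(\<lambda>n. (real n * r - 1 + 1) * flat_exp [:0, 0, 1:] (real n * r - 1) * (1 / r)) \<longlonglongrightarrow> 0 * (1 / r)"
    if "0 < r" for r :: real
    using that by (intro tendsto_mult tendsto_const filterlim_compose[OF flat_exp_deriv_tendsto] scaled_at_top)
  moreover have "(real n * r - 1 + 1) * flat_exp [:0, 0, 1:] (real n * r - 1) * (1 / r)
      = real n * flat_exp [:0, 0, 1:] (real n * r - 1)" if "0 < r" for r n
    using that by simp
  ultimately have *: "(\<lambda>n. real n * flat_exp [:0, 0, 1:] (real n * r - 1)) \<longlonglongrightarrow> 0" if "0 < r" for r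
    using that by simp
  have "(\<lambda>n. real n * flat_exp [:0, 0, 1:] (real n * t - 1) * flat_exp 1 (real n * (1 - t) - 1)
      - flat_exp 1 (real n * t - 1) * (real n * flat_exp [:0, 0, 1:] (real n * (1 - t) - 1)))
      \<longlonglongrightarrow> 0 * 1 - 1 * 0"
    using assms
    by (intro tendsto_intros * filterlim_compose[OF flat_exp_1_tendsto] scaled_at_top) auto
  then show ?thesis by (simp add: coord_cutoff_deriv_def mult_ac)
qed

lemma mem_cube: "x \<in> cube \<longleftrightarrow> (\<forall>i. 0 \<le> x $ i \<and> x $ i \<le> 1)"
  by (auto simp: cube_def mem_box_cart)

lemma mem_interior_cube: "x \<in> interior cube \<longleftrightarrow> (\<forall>i. 0 < x $ i \<and> x $ i < 1)"
  by (auto simp: cube_def mem_box_cart)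

text \<open>
  The support lies in the smaller cube \<open>[1 / n, 1 - 1 / n]\<^sup>d\<close>; for \<open>n = 0\<close> the cutoff is identically
  zero.
\<close>

lemma cube_cutoff_times_smooth_test:
  fixes \<psi> :: "real ^ 'n \<Rightarrow> real"
  assumes "\<psi> \<in> tensor_smooth"
  shows "(\<lambda>x. \<psi> x * cube_cutoff n x) \<in> test_functions"
proof -
  define K :: "(real ^ 'n) set" where "K = (if n = 0 then {} else cbox (\<chi> i. 1 / real n) (\<chi> i. 1 - 1 / real n))"
  have K: "compact K" "closed K"
    by (auto simp: K_def)
  have "{x. \<psi> x * cube_cutoff n x \<noteq> 0} \<subseteq> K"
  proof
    fix x assume "x \<in> {x. \<psi> x * cube_cutoff n x \<noteq> 0}"
    then have nz: "coord_cutoff n (x $ i) \<noteq> 0" for i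
      by (auto simp: cube_cutoff_def)
    have "0 < real n * x $ i - 1 \<and> 0 < real n * (1 - x $ i) - 1" for i
      using nz[of i] by (auto simp: coord_cutoff_def flat_exp_def split: if_splits)
    then show "x \<in> K"
      by (cases "n = 0") (auto simp: K_def mem_box_cart field_simps less_imp_le)
  qed
  then have cl: "closure {x. \<psi> x * cube_cutoff n x \<noteq> 0} \<subseteq> K"
    using K by (intro closure_minimal)
  moreover have "K \<subseteq> interior cube"
    by (auto simp: K_def cube_def mem_box_cart subset_iff split: if_splits)
       (smt (verit) divide_pos_pos of_nat_0_less_iff)+
  moreover have "compact (closure {x. \<psi> x * cube_cutoff n x \<noteq> 0})"
    using K(1) cl compact_Int_closed[of K "closure {x. \<psi> x * cube_cutoff n x \<noteq> 0}"]
    by (simp add: Int_absorb1)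
  moreover have "C_k m (\<lambda>x. \<psi> x * cube_cutoff n x)" for m
    by (intro C_k_tensor_smooth tensor_smooth.mult assms cube_cutoff_smooth)
  ultimately show ?thesis unfolding test_functions_def by blast
qed

section \<open>Integration over the cube\<close>

lemma cube_lebesgue [measurable]: "cube \<in> sets lebesgue"
  by (simp add: cube_def)

lemma integrable_continuous_cube:
  fixes f :: "real ^ 'n \<Rightarrow> 'b::euclidean_space"
  shows "continuous_on cube f \<Longrightarrow> integrable cube_measure f"
  unfolding cube_def by (rule continuous_imp_integrable)

lemma measurable_continuous_cube:
  fixes f :: "real ^ 'n \<Rightarrow> 'b::euclidean_space"
  shows "continuous_on cube f \<Longrightarrow> f \<in> borel_measurable cube_measure"
  by (intro borel_measurable_integrable integrable_continuous_cube)

lemma AE_cubeI: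
  assumes "negligible N" "\<And>x. x \<in> cube \<Longrightarrow> x \<notin> N \<Longrightarrow> P x"
  shows "AE x in cube_measure. P x"
proof -
  have "AE x in lebesgue. x \<notin> N"
    using assms(1) by (intro AE_not_in) (simp add: negligible_iff_null_sets)
  then have "AE x in lebesgue. x \<in> cube \<longrightarrow> P x"
    by (rule AE_mp) (auto intro!: AE_I2 assms(2))
  then show ?thesis by (subst AE_restrict_space_iff) auto
qed

lemma AE_interior_cube: "AE x in cube_measure. x \<in> interior cube"
  by (rule AE_cubeI[OF negligible_frontier_interval[of 0 1]]) (auto simp: cube_def)

lemma integrable_mult_bounded:
  fixes f g :: "real ^ 'n \<Rightarrow> real"
  assumes f: "integrable cube_measure f" and g: "g \<in> borel_measurable cube_measure"
    and bound: "AE x in cube_measure. \<bar>g x\<bar> \<le> M"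
  shows "integrable cube_measure (\<lambda>x. f x * g x)"
proof (rule Bochner_Integration.integrable_bound)
  show "integrable cube_measure (\<lambda>x. f x * M)" using f by simp
  show "(\<lambda>x. f x * g x) \<in> borel_measurable cube_measure"
    using f g by measurable
  show "AE x in cube_measure. norm (f x * g x) \<le> norm (f x * M)"
    using bound by eventually_elim (auto simp: abs_mult intro!: mult_left_mono)
qed

lemma integrable_mult_continuous:
  fixes f g :: "real ^ 'n \<Rightarrow> real"
  assumes f: "integrable cube_measure f" and g: "continuous_on cube g"
  shows "integrable cube_measure (\<lambda>x. f x * g x)"
proof -
  have "bounded (g ` cube)"
    by (intro compact_imp_bounded compact_continuous_image g) (simp add: cube_def)
  then obtain M where "\<And>x. x \<in> cube \<Longrightarrow> \<bar>g x\<bar> \<le> M"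
    unfolding bounded_iff by auto
  then show ?thesis
    by (intro integrable_mult_bounded[OF f measurable_continuous_cube[OF g], of M] AE_I2) simp
qed

lemma square_integrable_mult:
  fixes f g :: "real ^ 'n \<Rightarrow> real"
  assumes f: "square_integrable f" and g: "square_integrable g"
  shows "integrable cube_measure (\<lambda>x. f x * g x)"
proof (rule Bochner_Integration.integrable_bound)
  have [measurable]: "f \<in> borel_measurable cube_measure" "g \<in> borel_measurable cube_measure"
    and i: "integrable cube_measure (\<lambda>x. (norm (f x))\<^sup>2)" "integrable cube_measure (\<lambda>x. (norm (g x))\<^sup>2)"
    using f g unfolding square_integrable_def by auto
  show "integrable cube_measure (\<lambda>x. (norm (f x))\<^sup>2 + (norm (g x))\<^sup>2)"
    using i by (rule Bochner_Integration.integrable_add)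
  show "(\<lambda>x. f x * g x) \<in> borel_measurable cube_measure" by measurable
  have "\<bar>a * b\<bar> \<le> a\<^sup>2 + b\<^sup>2" for a b :: real
  proof -
    have "0 \<le> (\<bar>a\<bar> - \<bar>b\<bar>)\<^sup>2" by simp
    then have "2 * (\<bar>a\<bar> * \<bar>b\<bar>) \<le> a\<^sup>2 + b\<^sup>2" by (simp add: power2_diff)
    moreover have "0 \<le> \<bar>a\<bar> * \<bar>b\<bar>" by simp
    ultimately show ?thesis unfolding abs_mult by linarith
  qed
  then show "AE x in cube_measure. norm (f x * g x) \<le> norm ((norm (f x))\<^sup>2 + (norm (g x))\<^sup>2)"
    by (intro AE_I2) (auto simp: abs_mult)
qed

lemma square_integrable_continuous:
  fixes f :: "real ^ 'n \<Rightarrow> 'b::euclidean_space"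
  assumes "continuous_on cube f"
  shows "square_integrable f"
  unfolding square_integrable_def
  by (intro conjI measurable_continuous_cube integrable_continuous_cube continuous_intros assms)

lemma square_integrable_imp_integrable:
  fixes f :: "real ^ 'n \<Rightarrow> real"
  assumes "square_integrable f"
  shows "integrable cube_measure f"
  using square_integrable_mult[OF assms square_integrable_continuous[of "\<lambda>x. 1::real"]] by simp

lemma square_integrable_nth:
  fixes G :: "real ^ 'n \<Rightarrow> real ^ 'n"
  assumes "square_integrable G"
  shows "square_integrable (\<lambda>x. G x $ i)"
proof -
  have [measurable]: "G \<in> borel_measurable cube_measure"
    and int: "integrable cube_measure (\<lambda>x. (norm (G x))\<^sup>2)"
    using assms unfolding square_integrable_def by auto
  have m: "(\<lambda>x. G x $ i) \<in> borel_measurable cube_measure"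
    using borel_measurable_inner[OF \<open>G \<in> _\<close> borel_measurable_const[of "axis i 1"]]
    by (simp add: inner_axis)
  moreover have "integrable cube_measure (\<lambda>x. (norm (G x $ i))\<^sup>2)"
  proof (rule Bochner_Integration.integrable_bound[OF int])
    show "(\<lambda>x. (norm (G x $ i))\<^sup>2) \<in> borel_measurable cube_measure" using m by measurable
    show "AE x in cube_measure. norm ((norm (G x $ i))\<^sup>2) \<le> norm ((norm (G x))\<^sup>2)"
      by (intro AE_I2) (use power_mono[OF component_le_norm_cart abs_ge_zero, where n=2] in simp)
  qed
  ultimately show ?thesis unfolding square_integrable_def by blast
qed

section \<open>Integration by parts\<close>

text \<open>
  The integral of \<open>g\<close> does not change when \<open>g\<close> is shifted inside the cube, so the difference
  quotients of \<open>g\<close> in the direction of the \<open>i\<close>-th axis integrate to zero; by dominated convergence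
  so does their limit.
\<close>

lemma integral_partial_deriv_compact_support:
  fixes g :: "real ^ 'n \<Rightarrow> real"
  assumes diff: "\<And>x. g differentiable (at x)"
    and cont: "continuous_on UNIV (partial_deriv i g)"
    and K: "compact K" "K \<subseteq> interior cube" and supp: "\<And>x. x \<notin> K \<Longrightarrow> g x = 0"
  shows "(LINT x|cube_measure. partial_deriv i g x) = 0"
proof -
  define e :: "real ^ 'n" where "e = axis i 1"
  have norm_e: "norm e = 1" by (simp add: e_def)
  obtain \<epsilon> where "\<epsilon> > 0" and \<epsilon>: "(\<Union>x\<in>K. ball x \<epsilon>) \<subseteq> interior cube"
    using compact_subset_open_imp_ball_epsilon_subset[OF K(1) open_interior K(2)] .
  \<comment> \<open>Steps tending to zero and smaller than \<open>\<epsilon>\<close>, so that shifting by them keeps \<open>K\<close> inside the cube.\<close>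
  define h where "h n = min 1 \<epsilon> / (real n + 2)" for n :: nat
  have h: "0 < h n" "h n < \<epsilon>" "h n \<le> 1" for n
  proof -
    show pos: "0 < h n" using \<open>\<epsilon> > 0\<close> by (simp add: h_def)
    have "h n * 2 \<le> h n * (real n + 2)" using pos by (intro mult_left_mono) auto
    also have "\<dots> = min 1 \<epsilon>" by (simp add: h_def)
    finally show "h n < \<epsilon>" "h n \<le> 1" using pos by auto
  qed
  have h_lim: "h \<longlonglongrightarrow> 0"
    unfolding h_def by real_asymp
  have cont_g: "continuous_on S g" for S
    by (intro continuous_at_imp_continuous_on ballI differentiable_imp_continuous_within diff)
  have g_int: "g integrable_on cbox a b" for a b
    by (intro integrable_continuous cont_g)
  have shift: "((\<lambda>x. g (x + h n *\<^sub>R e)) has_integral integral cube g) cube" for n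
  proof -
    have K_shift: "K \<subseteq> cbox (0 + h n *\<^sub>R e) (1 + h n *\<^sub>R e)"
    proof
      fix x assume "x \<in> K"
      have "x - h n *\<^sub>R e \<in> ball x \<epsilon>" using h[of n] by (simp add: dist_norm norm_e)
      then have "x - h n *\<^sub>R e \<in> interior cube" using \<epsilon> \<open>x \<in> K\<close> by blast
      then show "x \<in> cbox (0 + h n *\<^sub>R e) (1 + h n *\<^sub>R e)"
        unfolding mem_interior_cube mem_box_cart
        by (auto simp: algebra_simps less_imp_le)
    qed
    have "(g has_integral integral cube g) cube"
      unfolding cube_def by (rule integrable_integral[OF g_int])
    then have "((\<lambda>x. if x \<in> cube then g x else 0) has_integral integral cube g) UNIV"
      by (simp add: has_integral_restrict_UNIV)
    also have "(\<lambda>x. if x \<in> cube then g x else 0) =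
        (\<lambda>x. if x \<in> cbox (0 + h n *\<^sub>R e) (1 + h n *\<^sub>R e) then g x else 0)"
    proof
      fix x
      show "(if x \<in> cube then g x else 0) =
          (if x \<in> cbox (0 + h n *\<^sub>R e) (1 + h n *\<^sub>R e) then g x else 0)"
      proof (cases "x \<in> K")
        case True
        then have "x \<in> cube" "x \<in> cbox (0 + h n *\<^sub>R e) (1 + h n *\<^sub>R e)"
          using K_shift K(2) interior_subset[of cube] by blast+
        then show ?thesis by simp
      next
        case False
        then show ?thesis using supp by simp
      qed
    qed
    finally have "(g has_integral integral cube g) (cbox (0 + h n *\<^sub>R e) (1 + h n *\<^sub>R e))"
      by (simp add: has_integral_restrict_UNIV)
    then have "((g \<circ> (+) (h n *\<^sub>R e)) has_integral integral cube g) (cbox 0 1)"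
      by (subst has_integral_shift_cbox_iff)
    then show ?thesis by (simp add: cube_def o_def add.commute)
  qed
  obtain R where R: "\<And>x::real ^ 'n. x \<in> cube \<Longrightarrow> norm x \<le> R"
    using bounded_cbox[of "0 :: real ^ 'n" 1] unfolding cube_def bounded_iff by auto
  have "bounded (partial_deriv i g ` cball 0 (R + 1))"
    by (intro compact_imp_bounded compact_continuous_image continuous_on_subset[OF cont]) auto
  then obtain M where "\<forall>y\<in>partial_deriv i g ` cball 0 (R + 1). norm y \<le> M"
    unfolding bounded_iff by blast
  then have M: "\<bar>partial_deriv i g x\<bar> \<le> M" if "norm x \<le> R + 1" for x
    using that by simp
  \<comment> \<open>The difference quotients; the mean value theorem bounds them by the maximum of \<open>\<partial>\<^sub>i g\<close>.\<close>
  define q where "q n x = (g (x + h n *\<^sub>R e) - g x) / h n" for n x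
  have q_int: "(q n has_integral 0) cube" for n
  proof -
    have "((\<lambda>x. g (x + h n *\<^sub>R e) - g x) has_integral (integral cube g - integral cube g)) cube"
      by (intro has_integral_diff shift) (simp add: cube_def integrable_integral[OF g_int])
    from has_integral_divide[OF this, of "h n"] show ?thesis by (simp add: q_def[abs_def])
  qed
  have q_bound: "norm (q n x) \<le> M" if "x \<in> cube" for n x
  proof -
    have "\<exists>z. 0 < z \<and> z < h n \<and> g (x + h n *\<^sub>R axis i 1) - g (x + 0 *\<^sub>R axis i 1)
        = (h n - 0) * partial_deriv i g (x + z *\<^sub>R axis i 1)"
      by (rule MVT2[OF h(1)]) (rule DERIV_along_axis[OF diff])
    then obtain z where z: "0 < z" "z < h n"
      and eq: "g (x + h n *\<^sub>R e) - g x = h n * partial_deriv i g (x + z *\<^sub>R e)"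
      by (auto simp: e_def)
    have "norm (x + z *\<^sub>R e) \<le> norm x + norm (z *\<^sub>R e)" by (rule norm_triangle_ineq)
    also have "\<dots> \<le> R + 1" using R[OF that] z h(3)[of n] by (simp add: norm_e)
    finally have "\<bar>partial_deriv i g (x + z *\<^sub>R e)\<bar> \<le> M" by (rule M)
    then show ?thesis using h(1)[of n] unfolding q_def eq by simp
  qed
  have q_lim: "(\<lambda>n. q n x) \<longlonglongrightarrow> partial_deriv i g x" for x
  proof -
    have "((\<lambda>t. g (x + t *\<^sub>R e)) has_real_derivative partial_deriv i g x) (at 0)"
      using DERIV_along_axis[of g x 0 i] diff by (simp add: e_def)
    then have "((\<lambda>t. (g (x + t *\<^sub>R e) - g x) / t) \<longlongrightarrow> partial_deriv i g x) (at 0)"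
      by (simp add: DERIV_def)
    moreover have "filterlim h (at 0) sequentially"
      unfolding filterlim_at using h_lim h(1) by (auto intro!: always_eventually simp: less_imp_neq[symmetric])
    ultimately show ?thesis unfolding q_def by (rule filterlim_compose)
  qed
  have "(\<lambda>n. integral cube (q n)) \<longlonglongrightarrow> integral cube (partial_deriv i g)"
    by (rule dominated_convergence(2)[where h="\<lambda>_. M"])
       (use q_int q_bound q_lim in \<open>auto simp: cube_def integrable_on_def\<close>)
  moreover have "(\<lambda>n. integral cube (q n)) = (\<lambda>_. 0)"
    using integral_unique[OF q_int] by (rule ext)
  ultimately have "(\<lambda>_. 0) \<longlonglongrightarrow> integral cube (partial_deriv i g)" by simp
  from LIMSEQ_unique[OF this tendsto_const] have "integral cube (partial_deriv i g) = 0" .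
  then show ?thesis
    by (subst lebesgue_integral_eq_integral)
       (auto intro!: integrable_continuous_cube continuous_on_subset[OF cont])
qed

text \<open>
  For smooth functions the weak gradient is the classical one: integrate \<open>\<partial>\<^sub>i (f \<phi>)\<close>, which has compact
  support in the interior.
\<close>

lemma has_H1_gradient_smooth:
  fixes f :: "real ^ 'n \<Rightarrow> real"
  assumes f: "f \<in> tensor_smooth"
  shows "has_H1_gradient f (\<lambda>x. \<chi> i. partial_deriv i f x)"
  unfolding has_H1_gradient_def
proof (intro conjI ballI allI)
  note cont = tensor_smooth_continuous[OF f] tensor_smooth_continuous[OF partial_deriv_in_tensor_smooth[OF f]]
  show "square_integrable f" by (intro square_integrable_continuous cont)
  show "square_integrable (\<lambda>x. \<chi> i. partial_deriv i f x)"
    by (intro square_integrable_continuous continuous_on_vec_lambda cont)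
  fix \<phi> :: "real ^ 'n \<Rightarrow> real" and i assume \<phi>: "\<phi> \<in> test_functions"
  have "C_k (Suc 0) \<phi>" using \<phi> unfolding test_functions_def by blast
  then have \<phi>_diff: "\<And>x. \<phi> differentiable (at x)" and \<phi>_cont: "continuous_on UNIV (partial_deriv i \<phi>)"
    by auto
  have \<phi>_cont': "continuous_on S \<phi>" for S
    by (intro continuous_at_imp_continuous_on ballI differentiable_imp_continuous_within \<phi>_diff)
  have eq: "partial_deriv i (\<lambda>x. f x * \<phi> x) = (\<lambda>x. f x * partial_deriv i \<phi> x + partial_deriv i f x * \<phi> x)"
    by (intro ext partial_deriv_mult tensor_smooth_differentiable f \<phi>_diff)
  have "(LINT x|cube_measure. partial_deriv i (\<lambda>x. f x * \<phi> x) x) = 0"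
  proof (rule integral_partial_deriv_compact_support)
    show "(\<lambda>x. f x * \<phi> x) differentiable (at x)" for x
      by (intro differentiable_mult tensor_smooth_differentiable f \<phi>_diff)
    show "continuous_on UNIV (partial_deriv i (\<lambda>x. f x * \<phi> x))"
      unfolding eq by (intro continuous_intros cont \<phi>_cont \<phi>_cont')
    show "compact (closure {x. \<phi> x \<noteq> 0})" "closure {x. \<phi> x \<noteq> 0} \<subseteq> interior cube"
      using \<phi> unfolding test_functions_def by auto
    show "f x * \<phi> x = 0" if "x \<notin> closure {x. \<phi> x \<noteq> 0}" for x
      using that closure_subset[of "{x. \<phi> x \<noteq> 0}"] by auto
  qed
  moreover have "(LINT x|cube_measure. f x * partial_deriv i \<phi> x + partial_deriv i f x * \<phi> x)
      = (LINT x|cube_measure. f x * partial_deriv i \<phi> x) + (LINT x|cube_measure. partial_deriv i f x * \<phi> x)"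
    by (intro Bochner_Integration.integral_add integrable_continuous_cube continuous_intros cont
          \<phi>_cont' continuous_on_subset[OF \<phi>_cont]) auto
  ultimately show "(LINT x|cube_measure. f x * partial_deriv i \<phi> x)
      = - (LINT x|cube_measure. (\<chi> i. partial_deriv i f x) $ i * \<phi> x)"
    unfolding eq by simp
qed

text \<open>
  Integration by parts without boundary terms against an arbitrary element of \<open>H\<^sup>1\<close>, which is
  what makes \<open>\<Phi>\<^sub>k\<close> a weak Neumann eigenfunction in each coordinate. The weak gradient is only
  tested against functions of compact support, so \<open>\<partial>\<^sub>i \<Phi>\<^sub>k\<close> is first cut off near the boundary. On
  the faces orthogonal to the \<open>i\<close>-th axis it vanishes, so the error term \<open>\<partial>\<^sub>i \<Phi>\<^sub>k \<partial>\<^sub>i \<eta>\<^sub>n\<close> stays bounded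
  and tends to zero pointwise; on the other faces the cutoff is not differentiated.
\<close>

lemma H1_Neumann_integration_by_parts:
  fixes v :: "real ^ 'n \<Rightarrow> real"
  assumes vH: "has_H1_gradient v H"
  shows "(LINT x|cube_measure. H x $ i * partial_deriv i (cos_basis k) x)
       = (pi * real (k $ i))\<^sup>2 * (LINT x|cube_measure. v x * cos_basis k x)"
proof -
  define \<psi> where "\<psi> = partial_deriv i (cos_basis k)"
  define a where "a = pi * real (k $ i)"
  have a: "0 \<le> a" by (simp add: a_def)
  have \<psi>_smooth: "\<psi> \<in> tensor_smooth"
    unfolding \<psi>_def by (intro partial_deriv_in_tensor_smooth cos_basis_smooth)
  have \<psi>_deriv: "partial_deriv i \<psi> x = - a\<^sup>2 * cos_basis k x" for x
    by (simp add: \<psi>_def a_def partial_deriv_twice_cos_basis)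
  have \<psi>_bound: "\<bar>\<psi> x\<bar> \<le> a" for x
    unfolding \<psi>_def a_def by (rule abs_partial_deriv_cos_basis_le)
  have v: "square_integrable v" and H: "square_integrable H"
    using vH unfolding has_H1_gradient_def by auto
  note v_int = square_integrable_imp_integrable[OF v]
  note H_int = square_integrable_imp_integrable[OF square_integrable_nth[OF H, of i]]
  have meas_vH: "v \<in> borel_measurable cube_measure" "(\<lambda>x. H x $ i) \<in> borel_measurable cube_measure"
    using v_int H_int by auto
  have meas: "\<psi> \<in> borel_measurable cube_measure" "cos_basis k \<in> borel_measurable cube_measure"
    "cube_cutoff n \<in> borel_measurable cube_measure" "partial_deriv i (cube_cutoff n) \<in> borel_measurable cube_measure" for n
    by (intro measurable_continuous_cube tensor_smooth_continuous \<psi>_smooth cos_basis_smooth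
          cube_cutoff_smooth partial_deriv_in_tensor_smooth)+
  have cutoff_lim: "(\<lambda>n. cube_cutoff n x) \<longlonglongrightarrow> 1" if "x \<in> interior cube" for x :: "real ^ 'n"
  proof -
    have "(\<lambda>n. cube_cutoff n x) \<longlonglongrightarrow> (\<Prod>i::'n\<in>UNIV. 1)"
      unfolding cube_cutoff_def
      by (rule tendsto_prod, rule coord_cutoff_tendsto) (use that in \<open>auto simp: mem_interior_cube\<close>)
    then show ?thesis by simp
  qed
  have layer_bound: "\<bar>\<psi> x * partial_deriv i (cube_cutoff n) x\<bar> \<le> 6 * a\<^sup>2" if x: "x \<in> cube" for x n
  proof -
    define t where "t = x $ i"
    have t: "0 \<le> t" "t \<le> 1" using x by (auto simp: t_def mem_cube)
    \<comment> \<open>The sine vanishes at both ends \<open>t = 0\<close> and \<open>t = 1\<close>, at the latter because \<open>a\<close> is a multiple of \<open>\<pi>\<close>.\<close>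
    have s1: "\<bar>a * sin (a * t)\<bar> \<le> a\<^sup>2 * t"
      using mult_left_mono[OF abs_sin_x_le_abs_x[of "a * t"] a] a t by (simp add: abs_mult power2_eq_square mult.assoc)
    have "\<bar>sin (a * t)\<bar> = \<bar>sin (a * (1 - t))\<bar>"
      by (simp add: right_diff_distrib sin_diff abs_mult a_def mult.commute[of pi] sin_npi cos_npi)
    then have s2: "\<bar>a * sin (a * t)\<bar> \<le> a\<^sup>2 * (1 - t)"
      using mult_left_mono[OF abs_sin_x_le_abs_x[of "a * (1 - t)"] a] a t by (simp add: abs_mult power2_eq_square mult.assoc)
    have "\<bar>\<psi> x * partial_deriv i (cube_cutoff n) x\<bar> =
        \<bar>(a * sin (a * t)) * coord_cutoff_deriv n t\<bar> * (\<bar>cos_cofactor i k x\<bar> * \<bar>\<Prod>j\<in>UNIV - {i}. coord_cutoff n (x $ j)\<bar>)"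
      by (simp add: \<psi>_def partial_deriv_cos_basis partial_deriv_cube_cutoff abs_mult a_def t_def mult_ac)
    also have "\<dots> \<le> (6 * a\<^sup>2) * (1 * 1)"
    proof (intro mult_mono abs_cos_cofactor_le_1)
      show "\<bar>(a * sin (a * t)) * coord_cutoff_deriv n t\<bar> \<le> 6 * a\<^sup>2"
        by (rule coord_cutoff_deriv_bound[OF t s1 s2]) simp
      show "\<bar>\<Prod>j\<in>UNIV - {i}. coord_cutoff n (x $ j)\<bar> \<le> 1"
        unfolding abs_prod by (rule prod_le_1) (simp add: coord_cutoff_bounds)
    qed auto
    finally show ?thesis by simp
  qed
  have layer_lim: "(\<lambda>n. partial_deriv i (cube_cutoff n) x) \<longlonglongrightarrow> 0" if "x \<in> interior cube" for x :: "real ^ 'n"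
  proof -
    have "(\<lambda>n. coord_cutoff_deriv n (x $ i) * (\<Prod>j\<in>UNIV - {i}. coord_cutoff n (x $ j)))
        \<longlonglongrightarrow> 0 * (\<Prod>j\<in>UNIV - {i}. 1)"
      by (rule tendsto_mult[OF coord_cutoff_deriv_tendsto tendsto_prod], rule_tac[3] coord_cutoff_tendsto)
         (use that in \<open>auto simp: mem_interior_cube\<close>)
    then show ?thesis by (simp add: partial_deriv_cube_cutoff)
  qed
  have test: "(LINT x|cube_measure. v x * (\<psi> x * partial_deriv i (cube_cutoff n) x + partial_deriv i \<psi> x * cube_cutoff n x))
      = - (LINT x|cube_measure. H x $ i * (\<psi> x * cube_cutoff n x))" for n
  proof -
    have "partial_deriv i (\<lambda>x. \<psi> x * cube_cutoff n x) x
        = \<psi> x * partial_deriv i (cube_cutoff n) x + partial_deriv i \<psi> x * cube_cutoff n x" for x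
      by (intro partial_deriv_mult tensor_smooth_differentiable \<psi>_smooth cube_cutoff_smooth)
    moreover have "(LINT x|cube_measure. v x * partial_deriv i (\<lambda>x. \<psi> x * cube_cutoff n x) x)
        = - (LINT x|cube_measure. H x $ i * (\<psi> x * cube_cutoff n x))"
      using vH cube_cutoff_times_smooth_test[OF \<psi>_smooth, of n] unfolding has_H1_gradient_def by blast
    ultimately show ?thesis by simp
  qed
  have "(\<lambda>n. LINT x|cube_measure. v x * (\<psi> x * partial_deriv i (cube_cutoff n) x + (- a\<^sup>2 * cos_basis k x) * cube_cutoff n x))
      \<longlonglongrightarrow> (LINT x|cube_measure. v x * (- a\<^sup>2 * cos_basis k x))"
  proof (rule integral_dominated_convergence)
    show "integrable cube_measure (\<lambda>x. \<bar>v x\<bar> * (7 * a\<^sup>2))" using v_int by simp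
    show "AE x in cube_measure. (\<lambda>n. v x * (\<psi> x * partial_deriv i (cube_cutoff n) x + (- a\<^sup>2 * cos_basis k x) * cube_cutoff n x))
        \<longlonglongrightarrow> v x * (- a\<^sup>2 * cos_basis k x)"
      using AE_interior_cube
    proof eventually_elim
      case (elim x)
      have "(\<lambda>n. v x * (\<psi> x * partial_deriv i (cube_cutoff n) x + (- a\<^sup>2 * cos_basis k x) * cube_cutoff n x))
        \<longlonglongrightarrow> v x * (\<psi> x * 0 + (- a\<^sup>2 * cos_basis k x) * 1)"
        by (intro tendsto_intros layer_lim cutoff_lim elim)
      then show ?case by simp
    qed
    show "AE x in cube_measure. norm (v x * (\<psi> x * partial_deriv i (cube_cutoff n) x + (- a\<^sup>2 * cos_basis k x) * cube_cutoff n x))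
        \<le> \<bar>v x\<bar> * (7 * a\<^sup>2)" for n
    proof (intro AE_I2)
      fix x assume "x \<in> space (cube_measure :: (real ^ 'n) measure)"
      then have x: "x \<in> cube" by simp
      have "\<bar>a\<^sup>2 * (cos_basis k x * cube_cutoff n x)\<bar> \<le> a\<^sup>2 * (1 * 1)"
        unfolding abs_mult using cube_cutoff_bounds[of n x]
        by (intro mult_mono abs_cos_basis_le_1) auto
      then have "\<bar>\<psi> x * partial_deriv i (cube_cutoff n) x + (- a\<^sup>2 * cos_basis k x) * cube_cutoff n x\<bar> \<le> 7 * a\<^sup>2"
        using layer_bound[OF x, of n] by (simp add: mult.assoc)
      then show "norm (v x * (\<psi> x * partial_deriv i (cube_cutoff n) x + (- a\<^sup>2 * cos_basis k x) * cube_cutoff n x))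
        \<le> \<bar>v x\<bar> * (7 * a\<^sup>2)"
        unfolding real_norm_def abs_mult[of "v x"] by (intro mult_left_mono) auto
    qed
  qed (intro borel_measurable_times borel_measurable_add borel_measurable_const meas meas_vH)+
  moreover have "(\<lambda>n. - (LINT x|cube_measure. H x $ i * (\<psi> x * cube_cutoff n x)))
      \<longlonglongrightarrow> - (LINT x|cube_measure. H x $ i * \<psi> x)"
  proof (intro tendsto_minus integral_dominated_convergence)
    show "integrable cube_measure (\<lambda>x. \<bar>H x $ i\<bar> * a)" using H_int by simp
    show "AE x in cube_measure. (\<lambda>n. H x $ i * (\<psi> x * cube_cutoff n x)) \<longlonglongrightarrow> H x $ i * \<psi> x"
      using AE_interior_cube
    proof eventually_elim
      case (elim x)
      have "(\<lambda>n. H x $ i * (\<psi> x * cube_cutoff n x)) \<longlonglongrightarrow> H x $ i * (\<psi> x * 1)"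
        by (intro tendsto_intros cutoff_lim elim)
      then show ?case by simp
    qed
    show "AE x in cube_measure. norm (H x $ i * (\<psi> x * cube_cutoff n x)) \<le> \<bar>H x $ i\<bar> * a" for n
    proof (intro AE_I2)
      fix x
      have "\<bar>\<psi> x\<bar> * \<bar>cube_cutoff n x\<bar> \<le> a * 1"
        using cube_cutoff_bounds[of n x] a by (intro mult_mono \<psi>_bound) auto
      then show "norm (H x $ i * (\<psi> x * cube_cutoff n x)) \<le> \<bar>H x $ i\<bar> * a"
        unfolding real_norm_def abs_mult by (intro mult_left_mono) auto
    qed
  qed (intro borel_measurable_times borel_measurable_add borel_measurable_const meas meas_vH)+
  ultimately have "(LINT x|cube_measure. v x * (- a\<^sup>2 * cos_basis k x)) = - (LINT x|cube_measure. H x $ i * \<psi> x)"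
    unfolding test[unfolded \<psi>_deriv] by (rule LIMSEQ_unique)
  moreover have "(LINT x|cube_measure. v x * (- a\<^sup>2 * cos_basis k x))
      = (- a\<^sup>2) * (LINT x|cube_measure. v x * cos_basis k x)"
    by (subst integral_mult_right_zero[symmetric]) (simp add: mult_ac)
  ultimately show ?thesis by (simp add: \<psi>_def a_def)
qed

section \<open>Orthogonality and completeness of the cosine basis\<close>

lemma cos_basis_continuous: "continuous_on S (cos_basis k)"
  by (rule tensor_smooth_continuous[OF cos_basis_smooth])

definition cos_mass :: "nat ^ 'n \<Rightarrow> real" where
  "cos_mass k = (LINT x|cube_measure. (cos_basis k x)\<^sup>2)"

lemma cos_mass_pos: "0 < cos_mass (k :: nat ^ 'n)"
proof -
  have cont: "continuous_on S (\<lambda>x. (cos_basis k x)\<^sup>2)" for S :: "(real ^ 'n) set"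
    by (intro continuous_intros cos_basis_continuous)
  have "cos_mass k \<noteq> 0"
  proof
    assume "cos_mass k = 0"
    then have "((\<lambda>x. (cos_basis k x)\<^sup>2) has_integral 0) (cbox 0 1)"
      using has_integral_integral_lebesgue_on[OF integrable_continuous_cube[OF cont] cube_lebesgue]
      unfolding cos_mass_def cube_def by simp
    moreover have "(\<chi> i. (1 / 2 :: real)) \<in> box 0 1" "(0 :: real ^ 'n) \<in> cbox 0 1"
      by (auto simp: mem_box_cart)
    ultimately have "(cos_basis k 0)\<^sup>2 = 0"
      by (intro has_integral_0_cbox_imp_0[OF cont]) auto
    then show False by (simp add: cos_basis_def)
  qed
  moreover have "0 \<le> cos_mass k"
    unfolding cos_mass_def by (rule integral_nonneg_AE) simp
  ultimately show ?thesis by simp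
qed

lemma cos_mass_le_1: "cos_mass (k :: nat ^ 'n) \<le> 1"
proof -
  have "cos_mass k \<le> (LINT x|(cube_measure :: (real ^ 'n) measure). (1::real))"
    unfolding cos_mass_def
  proof (rule integral_mono)
    show "integrable cube_measure (\<lambda>x. (cos_basis k x)\<^sup>2)"
      by (intro integrable_continuous_cube continuous_intros cos_basis_continuous)
    show "integrable cube_measure (\<lambda>x::real ^ 'n. 1::real)"
      by (intro integrable_continuous_cube continuous_intros)
    show "(cos_basis k x)\<^sup>2 \<le> 1" for x :: "real ^ 'n"
      using abs_cos_basis_le_1[of k x] by (simp add: abs_square_le_1)
  qed
  also have "(LINT x|(cube_measure :: (real ^ 'n) measure). (1::real)) = measure lborel (cube :: (real ^ 'n) set)"
    by (simp add: measure_restrict_space cube_def)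
  also have "\<dots> = 1"
    by (simp add: cube_def content_cbox_cart interval_ne_empty_cart)
  finally show ?thesis .
qed

lemma integral_mult_cos_basis:
  "(LINT x|cube_measure. u x * cos_basis k x) = cos_coeff u k * cos_mass k"
  using cos_mass_pos[of k] by (simp add: cos_coeff_def cos_mass_def[symmetric])

text \<open>
  Self-adjointness: \<open>\<integral> \<partial>\<^sub>i \<Phi>\<^sub>j \<partial>\<^sub>i \<Phi>\<^sub>k\<close> equals \<open>(\<pi> j\<^sub>i)\<^sup>2 \<integral> \<Phi>\<^sub>j \<Phi>\<^sub>k\<close> as well as \<open>(\<pi> k\<^sub>i)\<^sup>2 \<integral> \<Phi>\<^sub>j \<Phi>\<^sub>k\<close>.
\<close>

lemma cos_basis_orthogonal:
  assumes "j \<noteq> k"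
  shows "(LINT x|cube_measure. cos_basis j x * cos_basis k x) = 0"
proof -
  obtain i where i: "j $ i \<noteq> k $ i" using assms by (auto simp: vec_eq_iff)
  note grad = has_H1_gradient_smooth[OF cos_basis_smooth]
  have "(pi * real (k $ i))\<^sup>2 * (LINT x|cube_measure. cos_basis j x * cos_basis k x)
      = (LINT x|cube_measure. partial_deriv i (cos_basis j) x * partial_deriv i (cos_basis k) x)"
    using H1_Neumann_integration_by_parts[OF grad[of j], of i k] by simp
  also have "\<dots> = (pi * real (j $ i))\<^sup>2 * (LINT x|cube_measure. cos_basis j x * cos_basis k x)"
    using H1_Neumann_integration_by_parts[OF grad[of k], of i j] by (simp add: mult.commute)
  finally have "((pi * real (k $ i))\<^sup>2 - (pi * real (j $ i))\<^sup>2)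
      * (LINT x|cube_measure. cos_basis j x * cos_basis k x) = 0"
    by (simp add: left_diff_distrib)
  moreover have "(pi * real (k $ i))\<^sup>2 \<noteq> (pi * real (j $ i))\<^sup>2"
    using i by (simp add: power_mult_distrib)
  ultimately show ?thesis by simp
qed

subsection \<open>Termwise integration\<close>

text \<open>
  A series that is dominated by a summable family of constants converges uniformly, so its sum is
  continuous and may be integrated term by term against any integrable function.
\<close>

lemma series_continuous_and_integral:
  fixes b :: "'k \<Rightarrow> real ^ 'n \<Rightarrow> real"
  assumes cont: "\<And>k. continuous_on cube (b k)"
    and bound: "\<And>k x. x \<in> cube \<Longrightarrow> \<bar>b k x\<bar> \<le> M k" and M: "M summable_on UNIV"
  shows "continuous_on cube (\<lambda>x. \<Sum>\<^sub>\<infinity>k. b k x)"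
    and "integrable cube_measure g \<Longrightarrow> ((\<lambda>k. LINT x|cube_measure. g x * b k x) has_sum
      (LINT x|cube_measure. g x * (\<Sum>\<^sub>\<infinity>k. b k x))) UNIV"
proof -
  define u where "u x = (\<Sum>\<^sub>\<infinity>k. b k x)" for x
  have lim: "uniform_limit cube (\<lambda>F x. \<Sum>k\<in>F. b k x) u (finite_subsets_at_top UNIV)"
    unfolding u_def using bound M by (intro Weierstrass_m_test_general[where M=M]) auto
  have cont_sum: "continuous_on cube (\<lambda>x. \<Sum>k\<in>F. b k x)" for F
    by (intro continuous_intros cont)
  show "continuous_on cube (\<lambda>x. \<Sum>\<^sub>\<infinity>k. b k x)"
    using uniform_limit_theorem[OF always_eventually lim] cont_sum unfolding u_def by simp
  then have u_cont: "continuous_on cube u" by (simp add: u_def)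
  assume g: "integrable cube_measure g"
  define N where "N = (LINT x|cube_measure. \<bar>g x\<bar>)"
  have N: "0 \<le> N" unfolding N_def by (rule integral_nonneg_AE) simp
  note int = integrable_mult_continuous[OF g]
  have "((\<lambda>F. LINT x|cube_measure. g x * (\<Sum>k\<in>F. b k x)) \<longlongrightarrow> (LINT x|cube_measure. g x * u x))
      (finite_subsets_at_top UNIV)"
  proof (rule tendstoI)
    fix e :: real assume e: "0 < e"
    define d where "d = e / (N + 1)"
    have d: "0 < d" using e N by (simp add: d_def)
    show "\<forall>\<^sub>F F in finite_subsets_at_top UNIV.
        dist (LINT x|cube_measure. g x * (\<Sum>k\<in>F. b k x)) (LINT x|cube_measure. g x * u x) < e"
      using uniform_limitD[OF lim d]
    proof eventually_elim
      case (elim F)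
      have "\<bar>(LINT x|cube_measure. g x * (\<Sum>k\<in>F. b k x)) - (LINT x|cube_measure. g x * u x)\<bar>
          = \<bar>LINT x|cube_measure. g x * ((\<Sum>k\<in>F. b k x) - u x)\<bar>"
        by (subst Bochner_Integration.integral_diff[symmetric])
           (auto intro!: int cont_sum u_cont simp: right_diff_distrib)
      also have "\<dots> \<le> (LINT x|cube_measure. \<bar>g x * ((\<Sum>k\<in>F. b k x) - u x)\<bar>)"
        by (rule integral_abs_bound)
      also have "\<dots> \<le> (LINT x|cube_measure. \<bar>g x\<bar> * d)"
      proof (rule integral_mono)
        show "integrable cube_measure (\<lambda>x. \<bar>g x * ((\<Sum>k\<in>F. b k x) - u x)\<bar>)"
          by (intro integrable_abs int continuous_on_diff cont_sum u_cont)
        show "integrable cube_measure (\<lambda>x. \<bar>g x\<bar> * d)" using g by simp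
        fix x :: "real ^ 'n" assume "x \<in> space cube_measure"
        then have "\<bar>(\<Sum>k\<in>F. b k x) - u x\<bar> \<le> d"
          using elim by (auto simp: dist_real_def less_imp_le)
        then show "\<bar>g x * ((\<Sum>k\<in>F. b k x) - u x)\<bar> \<le> \<bar>g x\<bar> * d"
          unfolding abs_mult by (intro mult_left_mono) auto
      qed
      also have "\<dots> = N * d" by (simp add: N_def)
      also have "\<dots> < (N + 1) * d" using d by simp
      also have "\<dots> = e" using N by (simp add: d_def)
      finally show ?case by (simp add: dist_real_def)
    qed
  qed
  moreover have "(LINT x|cube_measure. g x * (\<Sum>k\<in>F. b k x))
      = (\<Sum>k\<in>F. LINT x|cube_measure. g x * b k x)" for F
    unfolding sum_distrib_left by (intro Bochner_Integration.integral_sum int cont)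
  ultimately show "((\<lambda>k. LINT x|cube_measure. g x * b k x) has_sum
      (LINT x|cube_measure. g x * (\<Sum>\<^sub>\<infinity>k. b k x))) UNIV"
    by (simp add: has_sum_def u_def)
qed

lemma cos_series_continuous:
  assumes "c \<in> wl1 (barron_weight s)"
  shows "continuous_on cube (cos_series c)"
  unfolding cos_series_def[abs_def]
  by (rule series_continuous_and_integral(1)[OF _ _ barron.wl1_abs_summable(1)[OF assms]])
     (auto intro!: continuous_intros cos_basis_continuous mult_left_le abs_cos_basis_le_1 simp: abs_mult)

lemma integral_mult_cos_series:
  assumes "c \<in> wl1 (barron_weight s)" "integrable cube_measure g"
  shows "((\<lambda>k. c k * (LINT x|cube_measure. g x * cos_basis k x)) has_sum
    (LINT x|cube_measure. g x * cos_series c x)) UNIV"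
proof -
  have "((\<lambda>k. LINT x|cube_measure. g x * (c k * cos_basis k x)) has_sum
    (LINT x|cube_measure. g x * cos_series c x)) UNIV"
    unfolding cos_series_def
    by (rule series_continuous_and_integral(2)[OF _ _ barron.wl1_abs_summable(1)[OF assms(1)] assms(2)])
       (auto intro!: continuous_intros cos_basis_continuous mult_left_le abs_cos_basis_le_1 simp: abs_mult)
  then show ?thesis by (simp add: mult.left_commute)
qed

text \<open>
  Summable coefficients are recovered from the function they define, by orthogonality and termwise
  integration. The converse, that an integrable function is recovered from its coefficients, needs
  completeness.
\<close>

lemma cos_coeff_cos_series:
  assumes "c \<in> wl1 (barron_weight s)"
  shows "cos_coeff (cos_series c) = c"
proof
  fix k
  have "((\<lambda>j. c j * (LINT x|cube_measure. cos_basis k x * cos_basis j x)) has_sum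
      (LINT x|cube_measure. cos_basis k x * cos_series c x)) UNIV"
    by (intro integral_mult_cos_series[OF assms] integrable_continuous_cube cos_basis_continuous)
  moreover have "((\<lambda>j. c j * (LINT x|cube_measure. cos_basis k x * cos_basis j x)) has_sum
      (c k * cos_mass k)) UNIV"
  proof -
    have "(\<lambda>j. c j * (LINT x|cube_measure. cos_basis k x * cos_basis j x))
        = (\<lambda>j. if j = k then c k * cos_mass k else 0)"
    proof
      fix j
      show "c j * (LINT x|cube_measure. cos_basis k x * cos_basis j x) = (if j = k then c k * cos_mass k else 0)"
        using cos_basis_orthogonal[of k j] by (cases "j = k") (simp_all add: cos_mass_def power2_eq_square)
    qed
    then show ?thesis
      using has_sum_finite_neutralI[of "{k}" UNIV "\<lambda>j. if j = k then c k * cos_mass k else 0"] by simp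
  qed
  ultimately have eq: "(LINT x|cube_measure. cos_basis k x * cos_series c x) = c k * cos_mass k"
    by (rule has_sum_unique)
  have "cos_coeff (cos_series c) k * cos_mass k = (LINT x|cube_measure. cos_series c x * cos_basis k x)"
    by (rule integral_mult_cos_basis[symmetric])
  also have "\<dots> = (LINT x|cube_measure. cos_basis k x * cos_series c x)"
    by (simp only: mult.commute)
  also note eq
  finally show "cos_coeff (cos_series c) k = c k"
    using cos_mass_pos[of k] by simp
qed

subsection \<open>Completeness\<close>

text \<open>
  The span of the cosine basis. By the product formula it is an algebra, and the functions
  \<open>cos (\<pi> x\<^sub>i)\<close> separate the points of the cube, so that the Stone--Weierstrass theorem applies.
\<close>

inductive_set cos_poly :: "(real ^ 'n \<Rightarrow> real) set" where
  basis: "cos_basis k \<in> cos_poly"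
| add: "p \<in> cos_poly \<Longrightarrow> q \<in> cos_poly \<Longrightarrow> (\<lambda>x. p x + q x) \<in> cos_poly"
| cmult: "p \<in> cos_poly \<Longrightarrow> (\<lambda>x. c * p x) \<in> cos_poly"

lemma cos_basis_0: "cos_basis 0 x = 1"
  by (simp add: cos_basis_def)

lemma cos_poly_const: "(\<lambda>x. c) \<in> cos_poly"
  using cos_poly.cmult[OF cos_poly.basis[of 0], of c] by (simp add: cos_basis_0)

lemma cos_poly_sum:
  assumes "finite A" "\<And>a. a \<in> A \<Longrightarrow> f a \<in> cos_poly"
  shows "(\<lambda>x. \<Sum>a\<in>A. f a x) \<in> cos_poly"
  using assms by (induction A rule: finite_induct) (auto intro: cos_poly_const cos_poly.add)

lemma cos_poly_mult:
  assumes "p \<in> cos_poly" "q \<in> cos_poly"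
  shows "(\<lambda>x. p x * q x) \<in> cos_poly"
  using assms(1)
proof induction
  case (basis j)
  show ?case
    using assms(2)
  proof induction
    case (basis k)
    have "(\<lambda>x. \<Sum>S\<in>UNIV. 1 / 2 ^ CARD('a) * cos_basis (combine_freq S j k) x) \<in> cos_poly"
      by (intro cos_poly_sum cos_poly.cmult cos_poly.basis) auto
    then show ?case by (simp add: cos_basis_mult)
  next
    case (add p q)
    then show ?case by (simp add: distrib_left cos_poly.add)
  next
    case (cmult p c)
    then show ?case using cos_poly.cmult[OF cmult.IH, of c] by (simp add: mult.left_commute)
  qed
next
  case (add p q)
  then show ?case by (simp add: distrib_right cos_poly.add)
next
  case (cmult p c)
  then show ?case using cos_poly.cmult[OF cmult.IH, of c] by (simp add: mult.assoc)
qed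

lemma cos_poly_continuous: "p \<in> cos_poly \<Longrightarrow> continuous_on S p"
  by (induction rule: cos_poly.induct) (auto intro!: continuous_intros cos_basis_continuous)

lemma cos_poly_function_ring: "function_ring_on (cos_poly :: (real ^ 'n \<Rightarrow> real) set) cube"
proof
  fix x y :: "real ^ 'n" assume xy: "x \<in> cube" "y \<in> cube" "x \<noteq> y"
  then obtain i where i: "x $ i \<noteq> y $ i" by (auto simp: vec_eq_iff)
  have "cos_basis (axis i 1) z = cos (pi * z $ i)" for z :: "real ^ 'n"
    unfolding cos_basis_split[of "axis i 1" z i] cos_cofactor_def
    by (simp add: axis_def)
  moreover have "cos (pi * x $ i) \<noteq> cos (pi * y $ i)"
  proof
    assume eq: "cos (pi * x $ i) = cos (pi * y $ i)"
    have bounds: "0 \<le> pi * x $ i" "pi * x $ i \<le> pi" "0 \<le> pi * y $ i" "pi * y $ i \<le> pi"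
      using xy(1,2) by (simp_all add: mem_cube mult_left_le)
    from cos_inj_pi[OF bounds eq] have "pi * x $ i = pi * y $ i" .
    then show False using i by simp
  qed
  ultimately show "\<exists>f\<in>cos_poly. f x \<noteq> f y"
    by (intro bexI[of _ "cos_basis (axis i 1)"] cos_poly.basis) simp
next
  show "compact (cube :: (real ^ 'n) set)" by (simp add: cube_def)
qed (rule cos_poly_continuous cos_poly.add cos_poly_mult cos_poly_const; assumption)+

lemma integral_mult_continuous_eq_0:
  fixes h :: "real ^ 'n \<Rightarrow> real"
  assumes h: "integrable cube_measure h"
    and ortho: "\<And>k. (LINT x|cube_measure. h x * cos_basis k x) = 0"
    and \<phi>: "continuous_on cube \<phi>"
  shows "(LINT x|cube_measure. h x * \<phi> x) = 0"
proof (rule ccontr)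
  note int = integrable_mult_continuous[OF h]
  have poly: "(LINT x|cube_measure. h x * p x) = 0" if "p \<in> cos_poly" for p
    using that
  proof induction
    case (add p q)
    then show ?case
      by (simp add: distrib_left int cos_poly_continuous)
  next
    case (cmult p c)
    then show ?case by (simp add: mult.left_commute)
  qed (rule ortho)
  assume neq: "(LINT x|cube_measure. h x * \<phi> x) \<noteq> 0"
  define N where "N = (LINT x|cube_measure. \<bar>h x\<bar>)"
  have N: "0 \<le> N" unfolding N_def by (rule integral_nonneg_AE) simp
  define e where "e = \<bar>LINT x|cube_measure. h x * \<phi> x\<bar> / (N + 1)"
  have e: "0 < e" using neq N by (simp add: e_def)
  obtain p where p: "p \<in> cos_poly" "\<And>x. x \<in> cube \<Longrightarrow> \<bar>\<phi> x - p x\<bar> < e"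
    using function_ring_on.Stone_Weierstrass_basic[OF cos_poly_function_ring \<phi> e] by blast
  note p_cont = cos_poly_continuous[OF p(1)]
  have "\<bar>LINT x|cube_measure. h x * \<phi> x\<bar> = \<bar>LINT x|cube_measure. h x * (\<phi> x - p x)\<bar>"
    using poly[OF p(1)] by (simp add: right_diff_distrib int \<phi> p_cont)
  also have "\<dots> \<le> (LINT x|cube_measure. \<bar>h x * (\<phi> x - p x)\<bar>)"
    by (rule integral_abs_bound)
  also have "\<dots> \<le> (LINT x|cube_measure. \<bar>h x\<bar> * e)"
  proof (rule integral_mono)
    show "integrable cube_measure (\<lambda>x. \<bar>h x * (\<phi> x - p x)\<bar>)"
      by (intro integrable_abs int continuous_on_diff \<phi> p_cont)
    show "integrable cube_measure (\<lambda>x. \<bar>h x\<bar> * e)" using h by simp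
    fix x :: "real ^ 'n" assume "x \<in> space cube_measure"
    then show "\<bar>h x * (\<phi> x - p x)\<bar> \<le> \<bar>h x\<bar> * e"
      unfolding abs_mult using p(2)[of x] by (intro mult_left_mono) auto
  qed
  also have "\<dots> = N * e" by (simp add: N_def)
  also have "\<dots> < (N + 1) * e" using e by simp
  also have "\<dots> = \<bar>LINT x|cube_measure. h x * \<phi> x\<bar>" using N by (simp add: e_def)
  finally show False by simp
qed

text \<open>
  A measurable function is an almost everywhere limit of continuous functions \<open>g\<^sub>n\<close>. Truncating
  these to \<open>[-1, 1]\<close> and testing with them shows that \<open>h\<close> is orthogonal to its own truncation.
\<close>

lemma cos_basis_complete:
  fixes h :: "real ^ 'n \<Rightarrow> real"
  assumes h: "integrable cube_measure h"
    and ortho: "\<And>k. (LINT x|cube_measure. h x * cos_basis k x) = 0"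
  shows "AE x in cube_measure. h x = 0"
proof -
  define clip :: "real \<Rightarrow> real" where "clip y = max (-1) (min 1 y)" for y
  have clip_cont: "continuous_on S clip" for S
    unfolding clip_def by (intro continuous_intros)
  have clip_bound: "\<bar>clip y\<bar> \<le> 1" for y by (auto simp: clip_def)
  have clip_sign: "0 \<le> y * clip y" "y * clip y = 0 \<longleftrightarrow> y = 0" for y
  proof -
    consider "y < - 1" "clip y = - 1" | "clip y = y" | "1 < y" "clip y = 1"
      unfolding clip_def by linarith
    then have "0 \<le> y * clip y \<and> (y * clip y = 0 \<longleftrightarrow> y = 0)"
      by cases auto
    then show "0 \<le> y * clip y" "y * clip y = 0 \<longleftrightarrow> y = 0" by auto
  qed
  have "h measurable_on cube"
    using h by (subst measurable_on_iff_borel_measurable) auto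
  then obtain Z g where Z: "negligible Z" and g: "\<And>n. continuous_on UNIV (g n)"
    and lim: "\<And>x. x \<notin> Z \<Longrightarrow> (\<lambda>n. g n x) \<longlonglongrightarrow> (if x \<in> cube then h x else 0)"
    unfolding measurable_on_def by blast
  have clip_g: "continuous_on S (\<lambda>x. clip (g n x))" for n S
    by (rule continuous_on_compose2[OF clip_cont continuous_on_subset[OF g]]) auto
  have "(\<lambda>n. LINT x|cube_measure. h x * clip (g n x)) \<longlonglongrightarrow> (LINT x|cube_measure. h x * clip (h x))"
  proof (rule integral_dominated_convergence)
    show "integrable cube_measure (\<lambda>x. \<bar>h x\<bar>)" using h by simp
    have clip_meas: "clip \<in> borel_measurable borel"
      by (rule borel_measurable_continuous_onI[OF clip_cont])
    show "(\<lambda>x. h x * clip (h x)) \<in> borel_measurable cube_measure"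
      by (intro borel_measurable_times borel_measurable_integrable[OF h]
            measurable_compose[OF borel_measurable_integrable[OF h] clip_meas])
    show "(\<lambda>x. h x * clip (g n x)) \<in> borel_measurable cube_measure" for n
      by (intro borel_measurable_times borel_measurable_integrable[OF h] measurable_continuous_cube clip_g)
    show "AE x in cube_measure. (\<lambda>n. h x * clip (g n x)) \<longlonglongrightarrow> h x * clip (h x)"
    proof (rule AE_cubeI[OF Z])
      fix x assume "x \<in> cube" "x \<notin> Z"
      then have "(\<lambda>n. g n x) \<longlonglongrightarrow> h x" using lim[of x] by simp
      moreover have "isCont clip (h x)"
        using clip_cont[of UNIV] by (simp add: continuous_on_eq_continuous_at)
      ultimately have "(\<lambda>n. clip (g n x)) \<longlonglongrightarrow> clip (h x)"
        by (rule isCont_tendsto_compose[rotated])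
      then show "(\<lambda>n. h x * clip (g n x)) \<longlonglongrightarrow> h x * clip (h x)"
        by (rule tendsto_mult_left)
    qed
    show "AE x in cube_measure. norm (h x * clip (g n x)) \<le> \<bar>h x\<bar>" for n
      using clip_bound by (intro AE_I2) (simp add: abs_mult mult_left_le)
  qed
  moreover have "(\<lambda>n. LINT x|cube_measure. h x * clip (g n x)) = (\<lambda>_. 0)"
    by (intro ext integral_mult_continuous_eq_0[OF h ortho] clip_g)
  ultimately have "(\<lambda>_. 0) \<longlonglongrightarrow> (LINT x|cube_measure. h x * clip (h x))" by simp
  from LIMSEQ_unique[OF this tendsto_const]
  have "(LINT x|cube_measure. h x * clip (h x)) = 0" .
  moreover have "integrable cube_measure (\<lambda>x. h x * clip (h x))"
  proof (rule integrable_mult_bounded[OF h])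
    show "(\<lambda>x. clip (h x)) \<in> borel_measurable cube_measure"
      using borel_measurable_continuous_onI[OF clip_cont]
      by (rule measurable_compose[OF borel_measurable_integrable[OF h]])
    show "AE x in cube_measure. \<bar>clip (h x)\<bar> \<le> 1" using clip_bound by (intro AE_I2)
  qed
  ultimately have "AE x in cube_measure. h x * clip (h x) = 0"
    using integral_nonneg_eq_0_iff_AE[of cube_measure "\<lambda>x. h x * clip (h x)"] clip_sign(1) by simp
  then show ?thesis by eventually_elim (simp only: clip_sign(2))
qed

text \<open>
  In particular a function of a Barron space agrees almost everywhere with a continuous function
  and is essentially bounded.
\<close>

lemma eq_cos_series_cos_coeff:
  assumes u: "integrable cube_measure u" and c: "cos_coeff u \<in> wl1 (barron_weight s)"
  shows "AE x in cube_measure. u x = cos_series (cos_coeff u) x"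
proof -
  have series: "integrable cube_measure (cos_series (cos_coeff u))"
    by (intro integrable_continuous_cube cos_series_continuous[OF c])
  have "AE x in cube_measure. u x - cos_series (cos_coeff u) x = 0"
  proof (rule cos_basis_complete)
    show "integrable cube_measure (\<lambda>x. u x - cos_series (cos_coeff u) x)" using u series by simp
    fix k
    have "(LINT x|cube_measure. (u x - cos_series (cos_coeff u) x) * cos_basis k x)
        = (LINT x|cube_measure. u x * cos_basis k x) - (LINT x|cube_measure. cos_series (cos_coeff u) x * cos_basis k x)"
      unfolding left_diff_distrib
      by (intro Bochner_Integration.integral_diff integrable_mult_continuous u series cos_basis_continuous)
    then show "(LINT x|cube_measure. (u x - cos_series (cos_coeff u) x) * cos_basis k x) = 0"
      by (simp add: integral_mult_cos_basis cos_coeff_cos_series[OF c])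
  qed
  then show ?thesis by simp
qed

lemma cos_coeff_cong_AE:
  fixes u v :: "real ^ 'n \<Rightarrow> real"
  assumes "AE x in cube_measure. u x = v x"
    and "u \<in> borel_measurable cube_measure" "v \<in> borel_measurable cube_measure"
  shows "cos_coeff u = cos_coeff v"
proof
  fix k :: "nat ^ 'n"
  have [measurable]: "cos_basis k \<in> borel_measurable cube_measure"
    by (rule measurable_continuous_cube[OF cos_basis_continuous])
  have "(LINT x|cube_measure. u x * cos_basis k x) = (LINT x|cube_measure. v x * cos_basis k x)"
    using assms by (intro integral_cong_AE) auto
  then show "cos_coeff u k = cos_coeff v k" by (simp add: cos_coeff_def)
qed

lemma infsum_ennreal_eq:
  fixes f :: "'k \<Rightarrow> real"
  assumes nn: "\<And>k. 0 \<le> f k"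
  shows "f summable_on UNIV \<Longrightarrow> (\<Sum>\<^sub>\<infinity>k. ennreal (f k)) = ennreal (\<Sum>\<^sub>\<infinity>k. f k)"
    and "(\<Sum>\<^sub>\<infinity>k. ennreal (f k)) < \<infinity> \<Longrightarrow> f summable_on UNIV"
proof -
  have sup: "(\<Sum>\<^sub>\<infinity>k. ennreal (f k)) = (SUP F\<in>{F. finite F \<and> F \<subseteq> UNIV}. ennreal (sum f F))"
    by (subst nonneg_bdd_above_infsum) (auto simp: nn)
  show "(\<Sum>\<^sub>\<infinity>k. ennreal (f k)) = ennreal (\<Sum>\<^sub>\<infinity>k. f k)" if "f summable_on UNIV"
    unfolding sup using infsum_nonneg_is_SUPREMUM_ennreal[OF that] nn by simp
  assume fin: "(\<Sum>\<^sub>\<infinity>k. ennreal (f k)) < \<infinity>"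
  show "f summable_on UNIV"
  proof (rule nonneg_bdd_above_summable_on)
    show "bdd_above (sum f ` {F. F \<subseteq> UNIV \<and> finite F})"
    proof (rule bdd_aboveI2)
      fix F :: "'k set" assume "F \<in> {F. F \<subseteq> UNIV \<and> finite F}"
      then have "ennreal (sum f F) \<le> (\<Sum>\<^sub>\<infinity>k. ennreal (f k))"
        unfolding sup by (intro SUP_upper) auto
      then have "enn2real (ennreal (sum f F)) \<le> enn2real (\<Sum>\<^sub>\<infinity>k. ennreal (f k))"
        using fin by (intro enn2real_mono) auto
      then show "sum f F \<le> enn2real (\<Sum>\<^sub>\<infinity>k. ennreal (f k))" by (simp add: sum_nonneg nn)
    qed
  qed (rule nn)
qed

lemma barron_norm_eq_wnorm:
  assumes "cos_coeff u \<in> wl1 (barron_weight s)"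
  shows "barron_norm s u = ennreal (wnorm (barron_weight s) (cos_coeff u))"
  unfolding barron_norm_def wnorm_def
  by (rule infsum_ennreal_eq(1)) (use assms in \<open>auto simp: wl1_def barron.weight_nonneg\<close>)

lemma mem_barron_space_iff:
  "u \<in> barron_space s \<longleftrightarrow> integrable cube_measure u \<and> cos_coeff u \<in> wl1 (barron_weight s)"
proof -
  have "cos_coeff u \<in> wl1 (barron_weight s)" if "barron_norm s u < \<infinity>"
    using infsum_ennreal_eq(2)[of "\<lambda>k. barron_weight s k * \<bar>cos_coeff u k\<bar>"] that
    by (auto simp: wl1_def barron_norm_def barron.weight_nonneg)
  then show ?thesis unfolding barron_space_def by (auto simp: barron_norm_eq_wnorm)
qed

section \<open>Sobolev functions and weak solutions\<close>

lemma square_integrable_diff: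
  fixes f g :: "real ^ 'n \<Rightarrow> 'b::euclidean_space"
  assumes f: "square_integrable f" and g: "square_integrable g"
  shows "square_integrable (\<lambda>x. f x - g x)"
proof -
  have m: "f \<in> borel_measurable cube_measure" "g \<in> borel_measurable cube_measure"
    and i: "integrable cube_measure (\<lambda>x. (norm (f x))\<^sup>2)" "integrable cube_measure (\<lambda>x. (norm (g x))\<^sup>2)"
    using f g unfolding square_integrable_def by auto
  have d: "(\<lambda>x. f x - g x) \<in> borel_measurable cube_measure"
    by (intro borel_measurable_diff m)
  have "integrable cube_measure (\<lambda>x. (norm (f x - g x))\<^sup>2)"
  proof (rule Bochner_Integration.integrable_bound)
    show "integrable cube_measure (\<lambda>x. 2 * (norm (f x))\<^sup>2 + 2 * (norm (g x))\<^sup>2)"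
      by (intro Bochner_Integration.integrable_add integrable_mult_right i)
    show "(\<lambda>x. (norm (f x - g x))\<^sup>2) \<in> borel_measurable cube_measure"
      using d by measurable
    have "(norm (f x - g x))\<^sup>2 \<le> 2 * (norm (f x))\<^sup>2 + 2 * (norm (g x))\<^sup>2" for x
    proof -
      have "(norm (f x - g x))\<^sup>2 \<le> (norm (f x) + norm (g x))\<^sup>2"
        by (intro power_mono norm_triangle_ineq4) auto
      also have "\<dots> \<le> 2 * (norm (f x))\<^sup>2 + 2 * (norm (g x))\<^sup>2"
        using zero_le_power2[of "norm (f x) - norm (g x)"] by (simp add: power2_sum power2_diff)
      finally show ?thesis .
    qed
    then show "AE x in cube_measure. norm ((norm (f x - g x))\<^sup>2)
        \<le> norm (2 * (norm (f x))\<^sup>2 + 2 * (norm (g x))\<^sup>2)"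
      by (intro AE_I2) simp
  qed
  with d show ?thesis unfolding square_integrable_def by blast
qed

lemma square_integrable_inner:
  fixes G H :: "real ^ 'n \<Rightarrow> real ^ 'n"
  assumes "square_integrable G" "square_integrable H"
  shows "integrable cube_measure (\<lambda>x. G x \<bullet> H x)"
    and "(LINT x|cube_measure. G x \<bullet> H x) = (\<Sum>i\<in>UNIV. LINT x|cube_measure. G x $ i * H x $ i)"
proof -
  have "integrable cube_measure (\<lambda>x. G x $ i * H x $ i)" for i
    by (intro square_integrable_mult square_integrable_nth assms)
  then show "integrable cube_measure (\<lambda>x. G x \<bullet> H x)"
    "(LINT x|cube_measure. G x \<bullet> H x) = (\<Sum>i\<in>UNIV. LINT x|cube_measure. G x $ i * H x $ i)"
    unfolding inner_vec_def by (auto simp: Bochner_Integration.integral_sum)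
qed

lemma test_function_continuous:
  assumes "\<phi> \<in> test_functions"
  shows "continuous_on S \<phi>" "continuous_on S (partial_deriv i \<phi>)"
proof -
  have "C_k (Suc 0) \<phi>" using assms unfolding test_functions_def by blast
  then have \<phi>: "\<And>x. \<phi> differentiable (at x)" "continuous_on UNIV (partial_deriv i \<phi>)" by auto
  show "continuous_on S \<phi>"
    by (intro continuous_at_imp_continuous_on ballI differentiable_imp_continuous_within \<phi>)
  show "continuous_on S (partial_deriv i \<phi>)" by (rule continuous_on_subset[OF \<phi>(2)]) auto
qed

lemma has_H1_gradient_diff:
  fixes u v :: "real ^ 'n \<Rightarrow> real"
  assumes "has_H1_gradient u G" "has_H1_gradient v H"
  shows "has_H1_gradient (\<lambda>x. u x - v x) (\<lambda>x. G x - H x)"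
  unfolding has_H1_gradient_def
proof (intro conjI ballI allI)
  have sq: "square_integrable u" "square_integrable v" "square_integrable G" "square_integrable H"
    using assms unfolding has_H1_gradient_def by auto
  show "square_integrable (\<lambda>x. u x - v x)" "square_integrable (\<lambda>x. G x - H x)"
    by (intro square_integrable_diff sq)+
  fix \<phi> :: "real ^ 'n \<Rightarrow> real" and i assume \<phi>: "\<phi> \<in> test_functions"
  have eq: "(LINT x|cube_measure. (a x - b x) * \<psi> x)
      = (LINT x|cube_measure. a x * \<psi> x) - (LINT x|cube_measure. b x * \<psi> x)"
    if "square_integrable a" "square_integrable b" "continuous_on cube \<psi>" for a b \<psi> :: "real ^ 'n \<Rightarrow> real"
    unfolding left_diff_distrib
    by (intro Bochner_Integration.integral_diff integrable_mult_continuous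
          square_integrable_imp_integrable that)
  have "(LINT x|cube_measure. u x * partial_deriv i \<phi> x) = - (LINT x|cube_measure. G x $ i * \<phi> x)"
    "(LINT x|cube_measure. v x * partial_deriv i \<phi> x) = - (LINT x|cube_measure. H x $ i * \<phi> x)"
    using assms \<phi> unfolding has_H1_gradient_def by blast+
  then show "(LINT x|cube_measure. (u x - v x) * partial_deriv i \<phi> x)
      = - (LINT x|cube_measure. (G x - H x) $ i * \<phi> x)"
    by (simp add: eq sq square_integrable_nth test_function_continuous[OF \<phi>])
qed

text \<open>
  Uniqueness by the energy identity: the difference of two weak solutions is an admissible test
  function, and testing with it leaves \<open>\<integral> \<bar>\<nabla> z\<bar>\<^sup>2 + V z\<^sup>2 = 0\<close>.
\<close>

lemma weak_solution_unique:
  fixes V :: "real ^ 'n \<Rightarrow> real"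
  assumes V_meas: "V \<in> borel_measurable cube_measure"
    and V_bdd: "AE x in cube_measure. \<bar>V x\<bar> \<le> B"
    and V_pos: "\<And>x. x \<in> cube \<Longrightarrow> 0 < V x"
    and u: "weak_solution V f u" and w: "weak_solution V f w"
  shows "AE x in cube_measure. w x = u x"
proof -
  obtain G where G: "has_H1_gradient u G"
    and Gv: "\<And>v H. has_H1_gradient v H \<Longrightarrow>
      (LINT x|cube_measure. G x \<bullet> H x + V x * u x * v x) = (LINT x|cube_measure. f x * v x)"
    using u unfolding weak_solution_def by blast
  obtain K where K: "has_H1_gradient w K"
    and Kv: "\<And>v H. has_H1_gradient v H \<Longrightarrow>
      (LINT x|cube_measure. K x \<bullet> H x + V x * w x * v x) = (LINT x|cube_measure. f x * v x)"
    using w unfolding weak_solution_def by blast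
  define z where "z x = w x - u x" for x
  define Z where "Z x = K x - G x" for x
  have zZ: "has_H1_gradient z Z"
    unfolding z_def Z_def by (rule has_H1_gradient_diff[OF K G])
  have sq: "square_integrable u" "square_integrable w" "square_integrable z"
    "square_integrable G" "square_integrable K" "square_integrable Z"
    using G K zZ unfolding has_H1_gradient_def by auto
  have int_V: "integrable cube_measure (\<lambda>x. V x * a x * z x)" if "square_integrable a" for a
    using integrable_mult_bounded[OF square_integrable_mult[OF that sq(3)] V_meas V_bdd]
    by (simp add: mult_ac)
  have int: "integrable cube_measure (\<lambda>x. K x \<bullet> Z x + V x * w x * z x)"
    "integrable cube_measure (\<lambda>x. G x \<bullet> Z x + V x * u x * z x)"
    "integrable cube_measure (\<lambda>x. Z x \<bullet> Z x + V x * z x * z x)"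
    by (intro Bochner_Integration.integrable_add square_integrable_inner int_V sq)+
  have "(LINT x|cube_measure. Z x \<bullet> Z x + V x * z x * z x)
      = (LINT x|cube_measure. (K x \<bullet> Z x + V x * w x * z x) - (G x \<bullet> Z x + V x * u x * z x))"
    by (intro Bochner_Integration.integral_cong)
       (auto simp: Z_def z_def inner_diff_left algebra_simps)
  also have "\<dots> = 0"
    using Gv[OF zZ] Kv[OF zZ] by (simp add: int)
  finally have zero: "(LINT x|cube_measure. Z x \<bullet> Z x + V x * z x * z x) = 0" .
  have V_cube: "AE x in cube_measure. 0 < V x"
    using V_pos by (intro AE_I2) simp
  have nonneg: "0 \<le> V x * z x * z x" if "0 < V x" for x
  proof -
    have "0 \<le> V x * (z x * z x)" using that by (intro mult_nonneg_nonneg[OF _ zero_le_square]) simp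
    then show ?thesis by (simp add: mult.assoc)
  qed
  have "AE x in cube_measure. 0 \<le> Z x \<bullet> Z x + V x * z x * z x"
    using V_cube
  proof eventually_elim
    case (elim x)
    show ?case using nonneg[OF elim] inner_ge_zero[of "Z x"] by linarith
  qed
  with zero have "AE x in cube_measure. Z x \<bullet> Z x + V x * z x * z x = 0"
    using integral_nonneg_eq_0_iff_AE[OF int(3)] by simp
  with V_cube show ?thesis
  proof eventually_elim
    case (elim x)
    have "V x * z x * z x = 0"
      using nonneg[OF elim(1)] elim(2) inner_ge_zero[of "Z x"] by linarith
    then show ?case using elim(1) by (simp add: z_def)
  qed
qed

section \<open>Cosine series in the Sobolev space\<close>

definition neumann_eigenvalue :: "nat ^ 'n \<Rightarrow> real" where
  "neumann_eigenvalue k = (\<Sum>i\<in>UNIV. (pi * real (k $ i))\<^sup>2)"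

lemma neumann_eigenvalue_nonneg: "0 \<le> neumann_eigenvalue k"
  unfolding neumann_eigenvalue_def by (intro sum_nonneg) auto

lemma neumann_eigenvalue_ge: "(pi * real (k $ i))\<^sup>2 \<le> neumann_eigenvalue k"
  unfolding neumann_eigenvalue_def by (rule member_le_sum) auto

lemma finite_neumann_eigenvalue_less: "finite {k :: nat ^ 'n. neumann_eigenvalue k < B}"
proof -
  obtain N :: nat where N: "B < real N" using reals_Archimedean2 by blast
  have "k $ i \<le> N" if "neumann_eigenvalue k < B" for k :: "nat ^ 'n" and i
  proof -
    have "real (k $ i) \<le> (real (k $ i))\<^sup>2"
      unfolding power2_eq_square of_nat_mult[symmetric] of_nat_le_iff by (rule le_square)
    also have "\<dots> \<le> (pi * real (k $ i))\<^sup>2"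
      using pi_gt3 by (intro power_mono mult_right_mono[of 1 pi, simplified]) auto
    also have "\<dots> \<le> neumann_eigenvalue k" by (rule neumann_eigenvalue_ge)
    finally show ?thesis using that N by simp
  qed
  then have "{k :: nat ^ 'n. neumann_eigenvalue k < B} \<subseteq> vec_lambda ` (UNIV \<rightarrow>\<^sub>E {..N})"
    by (auto intro!: image_eqI[where x="\<lambda>i. _ $ i"] simp: vec_lambda_eta)
  then show ?thesis
    by (rule finite_subset) (intro finite_imageI finite_PiE, auto)
qed

text \<open>
  Two more powers of the frequency in the weight are paid for by one application of the
  Laplacian; the dimension enters through the comparison of the \<open>\<ell>\<^sup>1\<close>- and the \<open>\<ell>\<^sup>2\<close>-norm.
\<close>

lemma barron_weight_add_2_le:
  fixes k :: "nat ^ 'n"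
  assumes "0 \<le> s"
  shows "barron_weight (s + 2) k \<le> real CARD('n) * (barron_weight s k * (1 + neumann_eigenvalue k))"
proof -
  define d where "d = real CARD('n)"
  define a where "a = l1_norm k"
  define D where "D = neumann_eigenvalue k"
  define q where "q = pi powr s * (if s = 0 then 1 else a powr s)"
  have d: "1 \<le> d" by (simp add: d_def Suc_leI)
  have D: "0 \<le> D" by (simp add: D_def neumann_eigenvalue_nonneg)
  have q: "0 \<le> q" by (simp add: q_def)
  have a: "0 \<le> a" by (simp add: a_def l1_norm_nonneg)
  have l2: "pi\<^sup>2 * a\<^sup>2 \<le> d * D"
  proof -
    have "(\<Sum>i\<in>UNIV. 1 * (pi * real (k $ i)))\<^sup>2 \<le> (\<Sum>i\<in>(UNIV :: 'n set). 1\<^sup>2) * (\<Sum>i\<in>UNIV. (pi * real (k $ i))\<^sup>2)"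
      by (rule Cauchy_Schwarz_ineq_sum)
    moreover have "(\<Sum>i\<in>UNIV. 1 * (pi * real (k $ i))) = pi * a"
      by (simp add: a_def l1_norm_def sum_distrib_left)
    ultimately show ?thesis by (simp add: d_def D_def neumann_eigenvalue_def power_mult_distrib)
  qed
  have "pi powr (s + 2) * a powr (s + 2) \<le> q * (d * D)"
  proof (cases "a = 0")
    case True
    then show ?thesis using q d D by simp
  next
    case False
    then have "pi powr (s + 2) * a powr (s + 2) = q * (pi\<^sup>2 * a\<^sup>2)"
      using a by (simp add: q_def powr_add powr_numeral)
    also have "\<dots> \<le> q * (d * D)" by (intro mult_left_mono l2 q)
    finally show ?thesis .
  qed
  then have "barron_weight (s + 2) k \<le> 1 + q * (d * D)"
    using assms by (simp add: barron_weight_def a_def)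
  also have "\<dots> \<le> d * (1 + q) * (1 + D)"
  proof -
    have "d * (1 + q) * (1 + D) = d + d * q + d * D + q * (d * D)"
      by (simp add: algebra_simps)
    moreover have "0 \<le> d * q" "0 \<le> d * D" using d q D by simp_all
    ultimately show ?thesis using d by linarith
  qed
  finally show ?thesis
    unfolding d_def D_def q_def a_def barron_weight_def[of s] by (simp only: mult.assoc)
qed

definition cos_series_grad :: "(nat ^ 'n \<Rightarrow> real) \<Rightarrow> real ^ 'n \<Rightarrow> real ^ 'n" where
  "cos_series_grad c x = (\<chi> i. \<Sum>\<^sub>\<infinity>k. c k * partial_deriv i (cos_basis k) x)"

lemma has_sum_sum:
  fixes f :: "'i \<Rightarrow> 'k \<Rightarrow> real"
  assumes "finite I" "\<And>i. i \<in> I \<Longrightarrow> (f i has_sum a i) A"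
  shows "((\<lambda>k. \<Sum>i\<in>I. f i k) has_sum (\<Sum>i\<in>I. a i)) A"
  using assms by (induction I rule: finite_induct) (auto intro: has_sum_add)

text \<open>
  If \<open>u\<close> and \<open>\<Delta> u\<close> have summable coefficients then so has \<open>\<nabla> u\<close>, because \<open>\<pi> k\<^sub>i \<le> 1 + \<lambda>\<^sub>k\<close>. Hence \<open>u\<close> may be
  differentiated term by term, and integrating the eigenfunctions by parts against \<open>v\<close> gives
  \<open>\<integral> \<nabla> u \<bullet> \<nabla> v = - \<integral> v \<Delta> u\<close> for every \<open>v\<close> in \<open>H\<^sup>1\<close>.
\<close>

lemma cos_series_H1:
  fixes c :: "nat ^ 'n \<Rightarrow> real"
  assumes c: "c \<in> wl1 (barron_weight s)"
    and Dc: "(\<lambda>k. neumann_eigenvalue k * c k) \<in> wl1 (barron_weight s)"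
  shows "has_H1_gradient (cos_series c) (cos_series_grad c)"
    and "has_H1_gradient v H \<Longrightarrow> (LINT x|cube_measure. cos_series_grad c x \<bullet> H x)
      = (LINT x|cube_measure. v x * cos_series (\<lambda>k. neumann_eigenvalue k * c k) x)"
proof -
  define M where "M k = \<bar>c k\<bar> + \<bar>neumann_eigenvalue k * c k\<bar>" for k
  have M: "M summable_on UNIV"
    unfolding M_def by (intro summable_on_add barron.wl1_abs_summable(1)[OF c] barron.wl1_abs_summable(1)[OF Dc])
  have bound: "\<bar>c k * partial_deriv i (cos_basis k) x\<bar> \<le> M k" for i k x
  proof -
    define r where "r = pi * real (k $ i)"
    have "\<bar>partial_deriv i (cos_basis k) x\<bar> \<le> r"
      unfolding r_def by (rule abs_partial_deriv_cos_basis_le)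
    also have "r \<le> 1 + r\<^sup>2"
    proof -
      have "2 * r \<le> 1 + r\<^sup>2" using zero_le_power2[of "r - 1"] by (simp add: power2_diff)
      with zero_le_power2[of r] show ?thesis by linarith
    qed
    also have "r\<^sup>2 \<le> neumann_eigenvalue k" unfolding r_def by (rule neumann_eigenvalue_ge)
    finally have "\<bar>c k\<bar> * \<bar>partial_deriv i (cos_basis k) x\<bar> \<le> \<bar>c k\<bar> * (1 + neumann_eigenvalue k)"
      by (intro mult_left_mono) auto
    then show ?thesis
      using neumann_eigenvalue_nonneg[of k] by (simp add: abs_mult M_def algebra_simps)
  qed
  have cont: "continuous_on cube (\<lambda>x. c k * partial_deriv i (cos_basis k) x)" for k i
    by (intro continuous_intros tensor_smooth_continuous partial_deriv_in_tensor_smooth cos_basis_smooth)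
  have series_cont: "continuous_on cube (\<lambda>x. cos_series_grad c x $ i)" for i
    unfolding cos_series_grad_def vec_lambda_beta
    by (rule series_continuous_and_integral(1)[OF cont bound M])
  have series_int: "((\<lambda>k. c k * (LINT x|cube_measure. g x * partial_deriv i (cos_basis k) x)) has_sum
      (LINT x|cube_measure. g x * cos_series_grad c x $ i)) UNIV"
    if "integrable cube_measure g" for g i
    using series_continuous_and_integral(2)[where b="\<lambda>k x. c k * partial_deriv i (cos_basis k) x", OF cont bound M that]
    unfolding cos_series_grad_def vec_lambda_beta by (simp add: mult.left_commute)
  have u_cont: "continuous_on cube (cos_series c)" by (rule cos_series_continuous[OF c])
  have G_cont: "continuous_on cube (cos_series_grad c)"
    using continuous_on_vec_lambda[where f="\<lambda>i x. cos_series_grad c x $ i", OF series_cont]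
    by (simp add: vec_nth_inverse)
  show H1: "has_H1_gradient (cos_series c) (cos_series_grad c)"
    unfolding has_H1_gradient_def
  proof (intro conjI ballI allI square_integrable_continuous u_cont G_cont)
    fix \<phi> :: "real ^ 'n \<Rightarrow> real" and i assume \<phi>: "\<phi> \<in> test_functions"
    note \<phi>_cont = test_function_continuous[OF \<phi>]
    have "(LINT x|cube_measure. \<phi> x * partial_deriv i (cos_basis k) x)
        = - (LINT x|cube_measure. partial_deriv i \<phi> x * cos_basis k x)" for k
    proof -
      have "(LINT x|cube_measure. cos_basis k x * partial_deriv i \<phi> x)
          = - (LINT x|cube_measure. partial_deriv i (cos_basis k) x * \<phi> x)"
        using has_H1_gradient_smooth[OF cos_basis_smooth, of k] \<phi> unfolding has_H1_gradient_def by simp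
      then show ?thesis by (simp add: mult.commute)
    qed
    then have "((\<lambda>k. - (c k * (LINT x|cube_measure. partial_deriv i \<phi> x * cos_basis k x))) has_sum
        (LINT x|cube_measure. \<phi> x * cos_series_grad c x $ i)) UNIV"
      using series_int[OF integrable_continuous_cube[OF \<phi>_cont(1)], of i] by simp
    moreover have "((\<lambda>k. - (c k * (LINT x|cube_measure. partial_deriv i \<phi> x * cos_basis k x))) has_sum
        - (LINT x|cube_measure. partial_deriv i \<phi> x * cos_series c x)) UNIV"
      using integral_mult_cos_series[OF c integrable_continuous_cube[OF \<phi>_cont(2)]]
      by (simp add: has_sum_uminus)
    ultimately have "(LINT x|cube_measure. \<phi> x * cos_series_grad c x $ i)
        = - (LINT x|cube_measure. partial_deriv i \<phi> x * cos_series c x)"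
      by (rule has_sum_unique)
    then show "(LINT x|cube_measure. cos_series c x * partial_deriv i \<phi> x)
        = - (LINT x|cube_measure. cos_series_grad c x $ i * \<phi> x)"
      by (simp add: mult.commute)
  qed
  assume vH: "has_H1_gradient v H"
  then have v: "square_integrable v" and H: "square_integrable H"
    unfolding has_H1_gradient_def by auto
  have "((\<lambda>k. c k * (LINT x|cube_measure. H x $ i * partial_deriv i (cos_basis k) x)) has_sum
      (LINT x|cube_measure. H x $ i * cos_series_grad c x $ i)) UNIV" for i
    by (intro series_int square_integrable_imp_integrable square_integrable_nth H)
  then have "((\<lambda>k. \<Sum>i\<in>UNIV. c k * (LINT x|cube_measure. H x $ i * partial_deriv i (cos_basis k) x)) has_sum
      (\<Sum>i\<in>UNIV. LINT x|cube_measure. H x $ i * cos_series_grad c x $ i)) UNIV"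
    by (intro has_sum_sum) auto
  moreover have "(\<Sum>i\<in>UNIV. c k * (LINT x|cube_measure. H x $ i * partial_deriv i (cos_basis k) x))
      = (neumann_eigenvalue k * c k) * (LINT x|cube_measure. v x * cos_basis k x)" for k
    by (simp add: H1_Neumann_integration_by_parts[OF vH] neumann_eigenvalue_def
          sum_distrib_left sum_distrib_right mult_ac)
  ultimately have "((\<lambda>k. (neumann_eigenvalue k * c k) * (LINT x|cube_measure. v x * cos_basis k x)) has_sum
      (\<Sum>i\<in>UNIV. LINT x|cube_measure. H x $ i * cos_series_grad c x $ i)) UNIV" by simp
  moreover have "((\<lambda>k. (neumann_eigenvalue k * c k) * (LINT x|cube_measure. v x * cos_basis k x)) has_sum
      (LINT x|cube_measure. v x * cos_series (\<lambda>k. neumann_eigenvalue k * c k) x)) UNIV"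
    by (rule integral_mult_cos_series[OF Dc square_integrable_imp_integrable[OF v]])
  ultimately have "(\<Sum>i\<in>UNIV. LINT x|cube_measure. H x $ i * cos_series_grad c x $ i)
      = (LINT x|cube_measure. v x * cos_series (\<lambda>k. neumann_eigenvalue k * c k) x)"
    by (rule has_sum_unique)
  moreover have "square_integrable (cos_series_grad c)"
    by (intro square_integrable_continuous G_cont)
  ultimately show "(LINT x|cube_measure. cos_series_grad c x \<bullet> H x)
      = (LINT x|cube_measure. v x * cos_series (\<lambda>k. neumann_eigenvalue k * c k) x)"
    using H by (simp add: square_integrable_inner(2) mult.commute)
qed

section \<open>The Schroedinger operator on cosine coefficients\<close>

lemma abs_cos_series_le:
  assumes "c \<in> wl1 (barron_weight s)"
  shows "\<bar>cos_series c x\<bar> \<le> wnorm (barron_weight s) c"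
proof -
  have "\<bar>cos_series c x\<bar> \<le> (\<Sum>\<^sub>\<infinity>k. \<bar>c k * cos_basis k x\<bar>)"
    unfolding cos_series_def
    using norm_infsum_bound[of "\<lambda>k. c k * cos_basis k x" UNIV] cos_series_abs_summable[OF assms, of x]
    by simp
  also have "\<dots> \<le> (\<Sum>\<^sub>\<infinity>k. \<bar>c k\<bar>)"
    by (intro infsum_mono cos_series_abs_summable[OF assms] barron.wl1_abs_summable(1)[OF assms])
       (simp add: abs_mult mult_left_le abs_cos_basis_le_1)
  also have "\<dots> \<le> wnorm (barron_weight s) c" by (rule barron.wl1_abs_summable(2)[OF assms])
  finally show ?thesis .
qed

lemma cos_series_add:
  assumes "a \<in> wl1 (barron_weight s)" "b \<in> wl1 (barron_weight s)"
  shows "cos_series (\<lambda>k. a k + b k) x = cos_series a x + cos_series b x"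
  using has_sum_add[OF cos_series_has_sum[OF assms(1), of x] cos_series_has_sum[OF assms(2), of x]]
  unfolding cos_series_def by (simp add: distrib_right infsumI)

lemma cos_series_diff:
  assumes "a \<in> wl1 (barron_weight s)" "b \<in> wl1 (barron_weight s)"
  shows "cos_series (\<lambda>k. a k - b k) x = cos_series a x - cos_series b x"
  using cos_series_add[of "\<lambda>k. a k - b k" s b x] barron.wl1_diff(1)[OF assms] assms by simp

text \<open>
  Multiplication by \<open>V\<close> acts on coefficients as a bounded operator of the weighted space. Since \<open>V\<close>
  is only integrable, the product of the series gives the product of the functions almost everywhere.
\<close>

lemma barron_mult_cos_series:
  fixes V :: "real ^ 'n \<Rightarrow> real"
  assumes s: "0 \<le> s" and V: "V \<in> barron_space s" and c: "c \<in> wl1 (barron_weight s)"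
  defines "Vc \<equiv> cos_coeff (\<lambda>x. V x * cos_series c x)"
  shows "Vc \<in> wl1 (barron_weight s)"
    and "wnorm (barron_weight s) Vc
      \<le> (2 powr s * wnorm (barron_weight s) (cos_coeff V)) * wnorm (barron_weight s) c"
    and "AE x in cube_measure. V x * cos_series c x = cos_series Vc x"
    and "integrable cube_measure (\<lambda>x. V x * cos_series c x)"
proof -
  have V_int: "integrable cube_measure V" and V_coeff: "cos_coeff V \<in> wl1 (barron_weight s)"
    using V unfolding mem_barron_space_iff by auto
  obtain b where b: "b \<in> wl1 (barron_weight s)"
    and prod: "\<And>x. cos_series b x = cos_series (cos_coeff V) x * cos_series c x"
    and b_norm: "wnorm (barron_weight s) b
      \<le> 2 powr s * wnorm (barron_weight s) (cos_coeff V) * wnorm (barron_weight s) c"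
    using cos_series_mult[OF s V_coeff c] by blast
  show int: "integrable cube_measure (\<lambda>x. V x * cos_series c x)"
    by (intro integrable_mult_continuous V_int cos_series_continuous[OF c])
  have ae: "AE x in cube_measure. V x * cos_series c x = cos_series b x"
    using eq_cos_series_cos_coeff[OF V_int V_coeff] by eventually_elim (simp add: prod)
  have "Vc = cos_coeff (cos_series b)"
    unfolding Vc_def
    by (rule cos_coeff_cong_AE[OF ae borel_measurable_integrable[OF int]
          measurable_continuous_cube[OF cos_series_continuous[OF b]]])
  then have "Vc = b" by (simp add: cos_coeff_cos_series[OF b])
  then show "Vc \<in> wl1 (barron_weight s)"
    "wnorm (barron_weight s) Vc
      \<le> (2 powr s * wnorm (barron_weight s) (cos_coeff V)) * wnorm (barron_weight s) c"
    "AE x in cube_measure. V x * cos_series c x = cos_series Vc x"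
    using b b_norm ae by simp_all
qed

text \<open>
  The energy estimate on the level of coefficients. Multiplying the equation by
  \<open>cos_mass k * c k\<close> and summing gives \<open>\<integral> ((1 - t) + t V) u\<^sup>2\<close> on the left, up to the nonnegative
  contribution of the Laplacian, and this is at least \<open>\<beta> \<integral> u\<^sup>2\<close>. Only the unweighted square sum of \<open>c\<close>
  is controlled, but this suffices for finitely many coefficients.
\<close>

lemma energy_estimate:
  fixes V :: "real ^ 'n \<Rightarrow> real"
  assumes s: "0 \<le> s" and V: "V \<in> barron_space s"
    and \<beta>: "0 < \<beta>" "\<beta> \<le> 1" and V_ge: "\<And>x. x \<in> cube \<Longrightarrow> \<beta> \<le> V x"
    and t: "0 \<le> t" "t \<le> 1"
    and c: "c \<in> wl1 (barron_weight s)" and g: "g \<in> wl1 (barron_weight s)"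
    and eq: "\<And>k. (1 + neumann_eigenvalue k) * c k
        + t * (cos_coeff (\<lambda>x. V x * cos_series c x) k - c k) = g k"
  shows "\<beta>\<^sup>2 * (cos_mass k * (c k)\<^sup>2) \<le> (wnorm (barron_weight s) g)\<^sup>2"
proof -
  define u where "u = cos_series c"
  define Vc where "Vc = cos_coeff (\<lambda>x. V x * cos_series c x)"
  note Vu_int = barron_mult_cos_series(4)[OF s V c, folded u_def]
  have u_cont: "continuous_on cube u" unfolding u_def by (rule cos_series_continuous[OF c])
  have u_int: "integrable cube_measure u" by (rule integrable_continuous_cube[OF u_cont])
  have uu: "((\<lambda>k. c k * (c k * cos_mass k)) has_sum (LINT x|cube_measure. u x * u x)) UNIV"
    using integral_mult_cos_series[OF c u_int]
    by (simp add: integral_mult_cos_basis u_def cos_coeff_cos_series[OF c])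
  have Vuu: "((\<lambda>k. c k * (Vc k * cos_mass k)) has_sum (LINT x|cube_measure. V x * u x * u x)) UNIV"
    using integral_mult_cos_series[OF c Vu_int]
    by (simp add: integral_mult_cos_basis u_def Vc_def)
  have uu_nonneg: "0 \<le> (LINT x|cube_measure. u x * u x)"
    by (rule integral_nonneg_AE) simp
  have "(LINT x|cube_measure. \<beta> * (u x * u x)) \<le> (LINT x|cube_measure. V x * u x * u x)"
  proof (rule integral_mono)
    show "integrable cube_measure (\<lambda>x. \<beta> * (u x * u x))"
      by (intro integrable_mult_right integrable_mult_continuous u_int u_cont)
    show "integrable cube_measure (\<lambda>x. V x * u x * u x)"
      by (intro integrable_mult_continuous Vu_int u_cont)
    fix x :: "real ^ 'n" assume "x \<in> space cube_measure"
    then have "\<beta> * (u x * u x) \<le> V x * (u x * u x)"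
      by (intro mult_right_mono V_ge) auto
    then show "\<beta> * (u x * u x) \<le> V x * u x * u x" by (simp add: mult.assoc)
  qed
  then have V_lower: "\<beta> * (LINT x|cube_measure. u x * u x) \<le> (LINT x|cube_measure. V x * u x * u x)"
    by simp
  define S where "S = (LINT x|cube_measure. u x * u x)"
  define N where "N = wnorm (barron_weight s) g"
  have coercive: "\<beta> * S \<le> (1 - t) * S + t * (LINT x|cube_measure. V x * u x * u x)"
  proof -
    have "(1 - t) * (\<beta> * S) \<le> (1 - t) * S"
      using t \<beta> uu_nonneg by (intro mult_left_mono) (auto simp: S_def mult_left_le_one_le)
    moreover have "t * (\<beta> * S) \<le> t * (LINT x|cube_measure. V x * u x * u x)"
      using t V_lower by (intro mult_left_mono) (auto simp: S_def)
    ultimately show ?thesis by (simp add: left_diff_distrib)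
  qed
  have lhs: "((\<lambda>k. (1 - t) * (c k * (c k * cos_mass k)) + t * (c k * (Vc k * cos_mass k)))
      has_sum ((1 - t) * S + t * (LINT x|cube_measure. V x * u x * u x))) UNIV"
    unfolding S_def by (intro has_sum_add has_sum_cmult_right uu Vuu)
  have g_sum: "((\<lambda>k. N * \<bar>g k\<bar>) has_sum (N * (\<Sum>\<^sub>\<infinity>k. \<bar>g k\<bar>))) UNIV"
    by (intro has_sum_cmult_right has_sum_infsum barron.wl1_abs_summable(1)[OF g])
  have N: "0 \<le> N" unfolding N_def by (rule barron.wnorm_nonneg)
  have term_le: "\<beta> * ((1 - t) * (c k * (c k * cos_mass k)) + t * (c k * (Vc k * cos_mass k)))
      \<le> \<beta>\<^sup>2 / 2 * (c k * (c k * cos_mass k)) + 1 / 2 * (N * \<bar>g k\<bar>)" for k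
  proof -
    have "(1 - t) * (c k * c k) + t * (c k * Vc k) = c k * g k - neumann_eigenvalue k * (c k * c k)"
    proof -
      have g_eq: "g k = c k + neumann_eigenvalue k * c k + t * (Vc k - c k)"
        using eq[of k, folded Vc_def] by (simp add: distrib_right)
      show ?thesis unfolding g_eq by (simp add: algebra_simps)
    qed
    also have "\<dots> \<le> c k * g k" using neumann_eigenvalue_nonneg[of k] by simp
    finally have "\<beta> * ((1 - t) * (c k * c k) + t * (c k * Vc k)) \<le> \<beta> * (c k * g k)"
      using \<beta> by (intro mult_left_mono) auto
    \<comment> \<open>Young's inequality, so that half of the coercive term can be subtracted.\<close>
    also have "\<dots> \<le> (\<beta>\<^sup>2 * (c k * c k) + g k * g k) / 2"
      using zero_le_power2[of "\<beta> * c k - g k"] by (simp add: power2_diff power2_eq_square field_simps)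
    finally have "cos_mass k * (\<beta> * ((1 - t) * (c k * c k) + t * (c k * Vc k)))
        \<le> cos_mass k * ((\<beta>\<^sup>2 * (c k * c k) + g k * g k) / 2)"
      using cos_mass_pos[of k] by (intro mult_left_mono) auto
    moreover have "cos_mass k * (g k * g k) \<le> N * \<bar>g k\<bar>"
    proof -
      have "cos_mass k * (g k * g k) \<le> 1 * (\<bar>g k\<bar> * \<bar>g k\<bar>)"
        using mult_right_mono[OF cos_mass_le_1[of k], of "g k * g k"] by simp
      also have "\<dots> \<le> N * \<bar>g k\<bar>"
        unfolding N_def mult_1 by (intro mult_right_mono barron.coeff_le_wnorm g) auto
      finally show ?thesis .
    qed
    ultimately show ?thesis by (simp add: field_simps)
  qed
  have "\<beta> * ((1 - t) * S + t * (LINT x|cube_measure. V x * u x * u x))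
      \<le> \<beta>\<^sup>2 / 2 * S + 1 / 2 * (N * (\<Sum>\<^sub>\<infinity>k. \<bar>g k\<bar>))"
  proof (rule has_sum_mono[OF _ _ term_le])
    show "((\<lambda>k. \<beta> * ((1 - t) * (c k * (c k * cos_mass k)) + t * (c k * (Vc k * cos_mass k))))
        has_sum \<beta> * ((1 - t) * S + t * (LINT x|cube_measure. V x * u x * u x))) UNIV"
      by (intro has_sum_cmult_right lhs)
    show "((\<lambda>k. \<beta>\<^sup>2 / 2 * (c k * (c k * cos_mass k)) + 1 / 2 * (N * \<bar>g k\<bar>))
        has_sum \<beta>\<^sup>2 / 2 * S + 1 / 2 * (N * (\<Sum>\<^sub>\<infinity>k. \<bar>g k\<bar>))) UNIV"
      unfolding S_def by (intro has_sum_add has_sum_cmult_right uu g_sum)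
  qed
  moreover have "\<beta>\<^sup>2 * S \<le> \<beta> * ((1 - t) * S + t * (LINT x|cube_measure. V x * u x * u x))"
    using mult_left_mono[OF coercive, of \<beta>] \<beta> by (simp add: power2_eq_square mult.assoc)
  moreover have "N * (\<Sum>\<^sub>\<infinity>k. \<bar>g k\<bar>) \<le> N\<^sup>2"
    unfolding power2_eq_square using N barron.wl1_abs_summable(2)[OF g] by (intro mult_left_mono) (simp add: N_def)
  ultimately have S_le: "\<beta>\<^sup>2 * S \<le> N\<^sup>2" by linarith
  have nn: "0 \<le> c k * (c k * cos_mass k)" for k
  proof -
    have "0 \<le> (c k * c k) * cos_mass k"
      using cos_mass_pos[of k] by (intro mult_nonneg_nonneg[OF zero_le_square]) simp
    then show ?thesis by (simp add: mult.assoc)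
  qed
  have "c k * (c k * cos_mass k) \<le> S"
    using finite_sum_le_infsum[OF has_sum_imp_summable[OF uu], of "{k}"] nn infsumI[OF uu]
    by (simp add: S_def)
  then have "\<beta>\<^sup>2 * (c k * (c k * cos_mass k)) \<le> \<beta>\<^sup>2 * S" by (intro mult_left_mono) auto
  also note S_le
  finally show ?thesis by (simp add: N_def power2_eq_square mult_ac)
qed

text \<open>
  The a priori estimate, uniform along the homotopy. At frequencies where the eigenvalue exceeds
  twice the norm of the zeroth order term, the latter is absorbed into the left-hand side; the
  finitely many remaining coefficients are controlled by the energy.
\<close>

lemma apriori_estimate:
  fixes V :: "real ^ 'n \<Rightarrow> real"
  assumes s: "0 \<le> s" and V: "V \<in> barron_space s"
    and \<beta>: "0 < \<beta>" "\<beta> \<le> 1" and V_ge: "\<And>x. x \<in> cube \<Longrightarrow> \<beta> \<le> V x"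
  shows "\<exists>C\<ge>0. \<forall>t c g. 0 \<le> t \<longrightarrow> t \<le> 1 \<longrightarrow> c \<in> wl1 (barron_weight s) \<longrightarrow> g \<in> wl1 (barron_weight s) \<longrightarrow>
     (\<forall>k. (1 + neumann_eigenvalue k) * c k + t * (cos_coeff (\<lambda>x. V x * cos_series c x) k - c k) = g k)
     \<longrightarrow> wnorm (barron_weight s) c \<le> C * wnorm (barron_weight s) g"
proof -
  define w :: "nat ^ 'n \<Rightarrow> real" where "w = barron_weight s"
  interpret w: weight w unfolding w_def by (rule barron.weight_axioms)
  define L where "L = 2 powr s * wnorm w (cos_coeff V) + 1"
  have L: "1 \<le> L" unfolding L_def using w.wnorm_nonneg by simp
  \<comment> \<open>The low frequencies.\<close>
  define F where "F = {k :: nat ^ 'n. neumann_eigenvalue k < 2 * L}"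
  have F: "finite F" unfolding F_def by (rule finite_neumann_eigenvalue_less)
  define A where "A = (\<Sum>k\<in>F. 2 * L * w k / (\<beta> * sqrt (cos_mass k)))"
  have A: "0 \<le> A"
    unfolding A_def using L \<beta> less_imp_le[OF cos_mass_pos] w.weight_nonneg
    by (intro sum_nonneg divide_nonneg_nonneg mult_nonneg_nonneg) auto
  have "wnorm w c \<le> (1 + A) / L * wnorm w g"
    if t: "0 \<le> t" "t \<le> 1" and c: "c \<in> wl1 w" and g: "g \<in> wl1 w"
      and eq: "\<forall>k. (1 + neumann_eigenvalue k) * c k + t * (cos_coeff (\<lambda>x. V x * cos_series c x) k - c k) = g k"
    for t c g
  proof -
    define W where "W k = cos_coeff (\<lambda>x. V x * cos_series c x) k - c k" for k
    note mult = barron_mult_cos_series[OF s V c[unfolded w_def], folded w_def]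
    have W: "W \<in> wl1 w" unfolding W_def by (rule w.wl1_diff(1)[OF mult(1) c])
    have W_norm: "wnorm w W \<le> L * wnorm w c"
      using w.wl1_diff(2)[OF mult(1) c] mult(2) unfolding W_def L_def by (simp add: distrib_right)
    have low: "\<bar>c k\<bar> \<le> wnorm w g / (\<beta> * sqrt (cos_mass k))" for k
    proof -
      have "(\<beta> * sqrt (cos_mass k) * \<bar>c k\<bar>)\<^sup>2 = \<beta>\<^sup>2 * (cos_mass k * (c k)\<^sup>2)"
        using cos_mass_pos[of k] by (simp add: power_mult_distrib mult.assoc)
      also have "\<dots> \<le> (wnorm w g)\<^sup>2"
        using energy_estimate[OF s V \<beta> V_ge t c[unfolded w_def] g[unfolded w_def]] eq
        unfolding w_def by blast
      finally have "\<beta> * sqrt (cos_mass k) * \<bar>c k\<bar> \<le> wnorm w g"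
        by (rule power2_le_imp_le[OF _ w.wnorm_nonneg])
      then show ?thesis using \<beta> cos_mass_pos[of k] by (simp add: pos_le_divide_eq mult_ac)
    qed
    have pointwise: "2 * L * (w k * \<bar>c k\<bar>) \<le> w k * \<bar>g k\<bar> + w k * \<bar>W k\<bar>
        + (if k \<in> F then 2 * L * (w k * \<bar>c k\<bar>) else 0)" for k
    proof (cases "k \<in> F")
      case True
      then show ?thesis using w.weight_nonneg[of k] by simp
    next
      case False
      then have "2 * L \<le> 1 + neumann_eigenvalue k" by (simp add: F_def)
      then have "2 * L * \<bar>c k\<bar> \<le> (1 + neumann_eigenvalue k) * \<bar>c k\<bar>" by (intro mult_right_mono) auto
      also have "\<dots> = \<bar>g k - t * W k\<bar>"
      proof -
        have "(1 + neumann_eigenvalue k) * c k = g k - t * W k" using eq by (simp add: W_def eq_diff_eq)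
        then have "\<bar>(1 + neumann_eigenvalue k) * c k\<bar> = \<bar>g k - t * W k\<bar>" by (rule arg_cong)
        then show ?thesis using neumann_eigenvalue_nonneg[of k] by (simp add: abs_mult)
      qed
      also have "\<dots> \<le> \<bar>g k\<bar> + t * \<bar>W k\<bar>"
        using t abs_triangle_ineq4[of "g k" "t * W k"] by (simp add: abs_mult)
      also have "\<dots> \<le> \<bar>g k\<bar> + \<bar>W k\<bar>" using t by (simp add: mult_left_le_one_le)
      finally have "w k * (2 * L * \<bar>c k\<bar>) \<le> w k * (\<bar>g k\<bar> + \<bar>W k\<bar>)"
        by (intro mult_left_mono w.weight_nonneg)
      then show ?thesis using False by (simp add: algebra_simps)
    qed
    have sums: "((\<lambda>k. w k * \<bar>a k\<bar>) has_sum wnorm w a) UNIV" if "a \<in> wl1 w" for a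
      using that unfolding wl1_def wnorm_def by simp
    have F_sum: "((\<lambda>k. if k \<in> F then 2 * L * (w k * \<bar>c k\<bar>) else 0) has_sum
        (\<Sum>k\<in>F. 2 * L * (w k * \<bar>c k\<bar>))) UNIV"
      by (rule has_sum_finite_neutralI[OF F]) auto
    have "2 * L * wnorm w c \<le> wnorm w g + wnorm w W + (\<Sum>k\<in>F. 2 * L * (w k * \<bar>c k\<bar>))"
      by (rule has_sum_mono[OF has_sum_cmult_right[OF sums[OF c]]
            has_sum_add[OF has_sum_add[OF sums[OF g] sums[OF W]] F_sum] pointwise])
    also have "(\<Sum>k\<in>F. 2 * L * (w k * \<bar>c k\<bar>)) \<le> A * wnorm w g"
      unfolding A_def sum_distrib_right
    proof (rule sum_mono)
      fix k
      have "2 * L * w k * \<bar>c k\<bar> \<le> 2 * L * w k * (wnorm w g / (\<beta> * sqrt (cos_mass k)))"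
        using L w.weight_nonneg by (intro mult_left_mono low) auto
      then show "2 * L * (w k * \<bar>c k\<bar>) \<le> 2 * L * w k / (\<beta> * sqrt (cos_mass k)) * wnorm w g"
        by (simp add: mult.assoc)
    qed
    finally have "L * wnorm w c \<le> (1 + A) * wnorm w g"
      using W_norm by (simp add: distrib_right)
    then show ?thesis using L by (simp add: pos_le_divide_eq mult.commute)
  qed
  moreover have "0 \<le> (1 + A) / L" using A L by simp
  ultimately show ?thesis unfolding w_def by blast
qed

text \<open>
  Existence with two extra derivatives: the continuity principle solves the equation for the
  coefficients, and reading it as \<open>(1 + \<lambda>\<^sub>k) c\<^sub>k = f\<^sub>k - (V u)\<^sub>k + c\<^sub>k\<close> improves the decay.
\<close>

lemma barron_solution_exists:
  fixes V :: "real ^ 'n \<Rightarrow> real"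
  assumes s: "0 \<le> s" and V: "V \<in> barron_space s"
    and Vmin: "0 < Vmin" and V_ge: "\<And>x. x \<in> cube \<Longrightarrow> Vmin \<le> V x"
  shows "\<exists>C\<ge>0. \<forall>f\<in>barron_space s. \<exists>u\<in>barron_space (s + 2). weak_solution V f u \<and>
    barron_norm (s + 2) u \<le> ennreal C * barron_norm s f"
proof -
  define w :: "nat ^ 'n \<Rightarrow> real" where "w = barron_weight s"
  interpret w: weight w unfolding w_def by (rule barron.weight_axioms)
  note mult = barron_mult_cos_series[OF s V, folded w_def]
  define \<beta> where "\<beta> = min 1 Vmin"
  have \<beta>: "0 < \<beta>" "\<beta> \<le> 1" "\<And>x. x \<in> cube \<Longrightarrow> \<beta> \<le> V x"
    using Vmin V_ge by (auto simp: \<beta>_def min.coboundedI2)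
  obtain C where C: "0 \<le> C" and C_bound:
    "\<forall>t c g. 0 \<le> t \<longrightarrow> t \<le> 1 \<longrightarrow> c \<in> wl1 w \<longrightarrow> g \<in> wl1 w \<longrightarrow>
     (\<forall>k. (1 + neumann_eigenvalue k) * c k + t * (cos_coeff (\<lambda>x. V x * cos_series c x) k - c k) = g k)
     \<longrightarrow> wnorm w c \<le> C * wnorm w g"
    using apriori_estimate[OF s V \<beta>] unfolding w_def by blast
  have apriori: "wnorm w c \<le> C * wnorm w g"
    if "0 \<le> t" "t \<le> 1" "c \<in> wl1 w" "g \<in> wl1 w"
      "\<And>k. (1 + neumann_eigenvalue k) * c k + t * (cos_coeff (\<lambda>x. V x * cos_series c x) k - c k) = g k"
    for t c g
    using C_bound that by blast
  \<comment> \<open>Multiplication by \<open>V - 1\<close>: the homotopy joins \<open>1 - \<Delta>\<close>, which is diagonal, to \<open>- \<Delta> + V\<close>.\<close>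
  define W where "W c = (\<lambda>k. cos_coeff (\<lambda>x. V x * cos_series c x) k - c k)" for c
  define L where "L = 2 powr s * wnorm w (cos_coeff V) + 1"
  have L: "0 \<le> L" unfolding L_def using w.wnorm_nonneg by simp
  have W_mem: "W c \<in> wl1 w" if "c \<in> wl1 w" for c
    unfolding W_def by (rule w.wl1_diff(1)[OF mult(1)[OF that] that])
  have W_norm: "wnorm w (W c) \<le> L * wnorm w c" if "c \<in> wl1 w" for c
    using w.wl1_diff(2)[OF mult(1)[OF that] that] mult(2)[OF that]
    unfolding W_def L_def by (simp add: distrib_right)
  have W_diff: "W (\<lambda>k. a k - b k) = (\<lambda>k. W a k - W b k)" if "a \<in> wl1 w" "b \<in> wl1 w" for a b
  proof
    fix k
    have "(LINT x|cube_measure. V x * cos_series (\<lambda>k. a k - b k) x * cos_basis k x)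
        = (LINT x|cube_measure. V x * cos_series a x * cos_basis k x - V x * cos_series b x * cos_basis k x)"
      using that unfolding w_def
      by (intro Bochner_Integration.integral_cong) (simp_all add: cos_series_diff algebra_simps)
    also have "\<dots> = (LINT x|cube_measure. V x * cos_series a x * cos_basis k x)
        - (LINT x|cube_measure. V x * cos_series b x * cos_basis k x)"
      by (intro Bochner_Integration.integral_diff integrable_mult_continuous mult(4) that cos_basis_continuous)
    finally show "W (\<lambda>k. a k - b k) k = W a k - W b k"
      unfolding W_def cos_coeff_def by (simp add: diff_divide_distrib)
  qed
  define d where "d = real CARD('n)"
  have "\<exists>u\<in>barron_space (s + 2). weak_solution V f u \<and>
    barron_norm (s + 2) u \<le> ennreal (d * (1 + L * C)) * barron_norm s f" if f: "f \<in> barron_space s" for f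
  proof -
    define g where "g = cos_coeff f"
    have f_int: "integrable cube_measure f" and g: "g \<in> wl1 w"
      using f unfolding mem_barron_space_iff g_def w_def by auto
    obtain c where c: "c \<in> wl1 w" and eq: "\<And>k. (1 + neumann_eigenvalue k) * c k + W c k = g k"
    proof -
      have "\<exists>c\<in>wl1 w. \<forall>k. (1 + neumann_eigenvalue k) * c k + W c k = g k"
      proof (rule w.continuity_principle[OF _ W_mem W_norm W_diff _ C L g])
        show "1 \<le> 1 + neumann_eigenvalue k" for k :: "nat ^ 'n"
          using neumann_eigenvalue_nonneg[of k] by simp
        show "wnorm w c \<le> C * wnorm w g" if "0 \<le> t" "t \<le> 1" "c \<in> wl1 w" "g \<in> wl1 w"
          "\<And>k. (1 + neumann_eigenvalue k) * c k + t * W c k = g k" for t c g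
          by (rule apriori[OF that(1-4)]) (use that(5) in \<open>simp add: W_def\<close>)
      qed
      then show ?thesis using that by blast
    qed
    define u where "u = cos_series c"
    define Vc where "Vc = cos_coeff (\<lambda>x. V x * cos_series c x)"
    define Dc where "Dc k = neumann_eigenvalue k * c k" for k
    have Dc_eq: "Dc = (\<lambda>k. g k - Vc k)"
      using eq by (auto simp: Dc_def W_def Vc_def algebra_simps fun_eq_iff)
    have Vc: "Vc \<in> wl1 w" unfolding Vc_def by (rule mult(1)[OF c])
    have Dc: "Dc \<in> wl1 w" unfolding Dc_eq by (rule w.wl1_diff(1)[OF g Vc])
    have c_norm: "wnorm w c \<le> C * wnorm w g"
      by (rule apriori[of 1, OF _ _ c g]) (use eq in \<open>auto simp: W_def\<close>)
    have le: "barron_weight (s + 2) k * \<bar>c k\<bar> \<le> d * (w k * \<bar>g k - W c k\<bar>)" for k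
    proof -
      have "barron_weight (s + 2) k * \<bar>c k\<bar> \<le> d * (w k * (1 + neumann_eigenvalue k)) * \<bar>c k\<bar>"
        unfolding d_def w_def by (intro mult_right_mono barron_weight_add_2_le s) auto
      also have "\<dots> = d * (w k * \<bar>(1 + neumann_eigenvalue k) * c k\<bar>)"
        using neumann_eigenvalue_nonneg[of k] by (simp add: abs_mult mult.assoc)
      also have "(1 + neumann_eigenvalue k) * c k = g k - W c k" using eq[of k] by linarith
      finally show ?thesis .
    qed
    have gW: "(\<lambda>k. g k - W c k) \<in> wl1 w" by (rule w.wl1_diff(1)[OF g W_mem[OF c]])
    then have gW_sum: "((\<lambda>k. d * (w k * \<bar>g k - W c k\<bar>)) has_sum (d * wnorm w (\<lambda>k. g k - W c k))) UNIV"
      unfolding wl1_def wnorm_def by (intro has_sum_cmult_right) simp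
    have c2: "c \<in> wl1 (barron_weight (s + 2))"
      unfolding wl1_def mem_Collect_eq
      by (rule summable_on_comparison_test[OF has_sum_imp_summable[OF gW_sum] le])
         (simp add: barron.weight_nonneg)
    have "wnorm (barron_weight (s + 2)) c \<le> d * wnorm w (\<lambda>k. g k - W c k)"
      using has_sum_mono[OF _ gW_sum le] c2 unfolding wl1_def wnorm_def by simp
    also have "\<dots> \<le> d * (wnorm w g + L * (C * wnorm w g))"
    proof (intro mult_left_mono)
      have "wnorm w (\<lambda>k. g k - W c k) \<le> wnorm w g + wnorm w (W c)"
        by (rule w.wl1_diff(2)[OF g W_mem[OF c]])
      also have "wnorm w (W c) \<le> L * (C * wnorm w g)"
        using W_norm[OF c] mult_left_mono[OF c_norm L] by linarith
      finally show "wnorm w (\<lambda>k. g k - W c k) \<le> wnorm w g + L * (C * wnorm w g)" by simp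
    qed (simp add: d_def)
    also have "\<dots> = d * (1 + L * C) * wnorm w g" by (simp add: algebra_simps)
    finally have norm_le: "wnorm (barron_weight (s + 2)) c \<le> d * (1 + L * C) * wnorm w g" .
    have u_cont: "continuous_on cube u"
      unfolding u_def by (rule cos_series_continuous[OF c[unfolded w_def]])
    have u_coeff: "cos_coeff u = c"
      unfolding u_def by (rule cos_coeff_cos_series[OF c[unfolded w_def]])
    have u_mem: "u \<in> barron_space (s + 2)"
      unfolding mem_barron_space_iff u_coeff
      by (intro conjI integrable_continuous_cube u_cont c2)
    have "barron_norm (s + 2) u = ennreal (wnorm (barron_weight (s + 2)) c)"
      using barron_norm_eq_wnorm[of u "s + 2"] c2 by (simp add: u_coeff)
    also have "\<dots> \<le> ennreal (d * (1 + L * C) * wnorm w g)" by (intro ennreal_leI norm_le)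
    also have "\<dots> = ennreal (d * (1 + L * C)) * barron_norm s f"
      using barron_norm_eq_wnorm[of f s] g C L w.wnorm_nonneg
      by (simp add: ennreal_mult g_def w_def d_def)
    finally have u_norm: "barron_norm (s + 2) u \<le> ennreal (d * (1 + L * C)) * barron_norm s f" .
    note H1 = cos_series_H1[OF c[unfolded w_def] Dc[unfolded w_def Dc_def[abs_def]], folded Dc_def u_def]
    have "weak_solution V f u"
      unfolding weak_solution_def
    proof (intro exI[of _ "cos_series_grad c"] conjI allI impI)
      show grad: "has_H1_gradient u (cos_series_grad c)" by (rule H1(1))
      fix v :: "real ^ 'n \<Rightarrow> real" and H assume vH: "has_H1_gradient v H"
      have v: "square_integrable v" and H: "square_integrable H"
        using vH unfolding has_H1_gradient_def by auto
      note v_int = square_integrable_imp_integrable[OF v]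
      have Dc_int: "integrable cube_measure (\<lambda>x. v x * cos_series Dc x)"
        by (intro integrable_mult_continuous v_int cos_series_continuous[OF Dc[unfolded w_def]])
      have Vc_int: "integrable cube_measure (\<lambda>x. v x * cos_series Vc x)"
        by (intro integrable_mult_continuous v_int cos_series_continuous[OF Vc[unfolded w_def]])
      have grad_int: "integrable cube_measure (\<lambda>x. cos_series_grad c x \<bullet> H x)"
        using grad H unfolding has_H1_gradient_def by (intro square_integrable_inner) auto
      have V_meas: "(\<lambda>x. V x * u x) \<in> borel_measurable cube_measure"
        unfolding u_def by (rule borel_measurable_integrable[OF mult(4)[OF c]])
      have Vu: "AE x in cube_measure. V x * u x * v x = v x * cos_series Vc x"
        using mult(3)[OF c] by eventually_elim (simp add: u_def Vc_def mult.commute)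
      have Vu_int: "integrable cube_measure (\<lambda>x. V x * u x * v x)"
        by (rule integrable_cong_AE_imp[OF Vc_int])
           (use Vu V_meas v_int in \<open>auto elim: eventually_mono\<close>)
      have fv: "AE x in cube_measure. f x * v x = v x * cos_series Dc x + v x * cos_series Vc x"
        using eq_cos_series_cos_coeff[OF f_int g[unfolded g_def w_def]]
      proof eventually_elim
        case (elim x)
        have "cos_series Dc x = cos_series g x - cos_series Vc x"
          unfolding Dc_eq by (rule cos_series_diff[OF g[unfolded w_def] Vc[unfolded w_def]])
        then have "f x = cos_series Dc x + cos_series Vc x" using elim by (simp add: g_def)
        then show ?case by (simp add: algebra_simps)
      qed
      have "(LINT x|cube_measure. cos_series_grad c x \<bullet> H x + V x * u x * v x)
          = (LINT x|cube_measure. cos_series_grad c x \<bullet> H x) + (LINT x|cube_measure. V x * u x * v x)"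
        by (intro Bochner_Integration.integral_add grad_int Vu_int)
      also have "(LINT x|cube_measure. V x * u x * v x) = (LINT x|cube_measure. v x * cos_series Vc x)"
        by (rule integral_cong_AE) (use Vu Vu_int Vc_int in auto)
      also have "(LINT x|cube_measure. cos_series_grad c x \<bullet> H x) = (LINT x|cube_measure. v x * cos_series Dc x)"
        by (rule H1(2)[OF vH])
      also have "(LINT x|cube_measure. v x * cos_series Dc x) + (LINT x|cube_measure. v x * cos_series Vc x)
          = (LINT x|cube_measure. v x * cos_series Dc x + v x * cos_series Vc x)"
        by (intro Bochner_Integration.integral_add[symmetric] Dc_int Vc_int)
      also have "\<dots> = (LINT x|cube_measure. f x * v x)"
        by (rule integral_cong_AE)
           (use fv Dc_int Vc_int f_int v_int in \<open>auto elim: eventually_mono\<close>)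
      finally show "(LINT x|cube_measure. cos_series_grad c x \<bullet> H x + V x * u x * v x)
          = (LINT x|cube_measure. f x * v x)" .
    qed
    with u_mem u_norm show ?thesis by blast
  qed
  moreover have "0 \<le> d * (1 + L * C)" using C L by (simp add: d_def)
  ultimately show ?thesis by blast
qed

theorem theorem2p6:
  fixes V :: "real ^ 'n \<Rightarrow> real" and Vmin s :: real
  assumes "s \<ge> 0"
    and "V \<in> barron_space s"
    and "Vmin > 0"
    and "\<And>x. x \<in> cube \<Longrightarrow> V x \<ge> Vmin"
  shows "(\<forall>f\<in>barron_space s. \<exists>u\<in>barron_space (s + 2). weak_solution V f u \<and>
            (\<forall>w. weak_solution V f w \<longrightarrow> (AE x in cube_measure. w x = u x)))
       \<and> (\<exists>C>0. (\<forall>f\<in>barron_space s. \<forall>u. weak_solution V f u \<longrightarrow>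
                    barron_norm (s + 2) u \<le> ennreal C * barron_norm s f)
              \<and> (s = 0 \<longrightarrow> (\<forall>f\<in>barron_space 0. \<forall>u. weak_solution V f u \<longrightarrow>
                    barron_norm 2 u \<le> ennreal C * barron_norm 0 f)))"
proof -
  have V_int: "integrable cube_measure V" and V_coeff: "cos_coeff V \<in> wl1 (barron_weight s)"
    using assms(2) unfolding mem_barron_space_iff by auto
  have V_bdd: "AE x in cube_measure. \<bar>V x\<bar> \<le> wnorm (barron_weight s) (cos_coeff V)"
    using eq_cos_series_cos_coeff[OF V_int V_coeff]
    by eventually_elim (simp add: abs_cos_series_le[OF V_coeff])
  have unique: "AE x in cube_measure. w x = u x" if "weak_solution V f u" "weak_solution V f w" for f u w
    by (rule weak_solution_unique[OF borel_measurable_integrable[OF V_int] V_bdd _ that])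
       (use assms(3,4) in force)
  obtain C where C: "0 \<le> C" and solve: "\<And>f. f \<in> barron_space s \<Longrightarrow>
      \<exists>u\<in>barron_space (s + 2). weak_solution V f u \<and> barron_norm (s + 2) u \<le> ennreal C * barron_norm s f"
    using barron_solution_exists[OF assms] by blast
  have existence: "\<exists>u\<in>barron_space (s + 2). weak_solution V f u \<and>
      (\<forall>w. weak_solution V f w \<longrightarrow> (AE x in cube_measure. w x = u x))" if "f \<in> barron_space s" for f
    using solve[OF that] unique by blast
  have bound: "barron_norm (s + 2) w \<le> ennreal (C + 1) * barron_norm s f"
    if f: "f \<in> barron_space s" and w: "weak_solution V f w" for f w
  proof -
    obtain u where u: "u \<in> barron_space (s + 2)" "weak_solution V f u"
      and u_norm: "barron_norm (s + 2) u \<le> ennreal C * barron_norm s f"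
      using solve[OF f] by blast
    have "cos_coeff w = cos_coeff u"
    proof (rule cos_coeff_cong_AE[OF unique[OF u(2) w]])
      show "w \<in> borel_measurable cube_measure"
        using w unfolding weak_solution_def has_H1_gradient_def square_integrable_def by blast
      show "u \<in> borel_measurable cube_measure"
        using u(1) unfolding mem_barron_space_iff by (auto intro: borel_measurable_integrable)
    qed
    then have "barron_norm (s + 2) w = barron_norm (s + 2) u" by (simp add: barron_norm_def)
    also note u_norm
    also have "ennreal C * barron_norm s f \<le> ennreal (C + 1) * barron_norm s f"
      by (intro mult_right_mono ennreal_leI) auto
    finally show ?thesis .
  qed
  show ?thesis
  proof (intro conjI exI[of _ "C + 1"])
    show "\<forall>f\<in>barron_space s. \<exists>u\<in>barron_space (s + 2). weak_solution V f u \<and>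
        (\<forall>w. weak_solution V f w \<longrightarrow> (AE x in cube_measure. w x = u x))"
      using existence by blast
    show "C + 1 > 0" using C by simp
    show "\<forall>f\<in>barron_space s. \<forall>u. weak_solution V f u \<longrightarrow>
        barron_norm (s + 2) u \<le> ennreal (C + 1) * barron_norm s f"
      using bound by blast
    show "s = 0 \<longrightarrow> (\<forall>f\<in>barron_space 0. \<forall>u. weak_solution V f u \<longrightarrow>
        barron_norm 2 u \<le> ennreal (C + 1) * barron_norm 0 f)"
      using bound by auto
  qed
qed

end
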